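(* Let $M$ be a connected compact embedded translator in $\mathbb{R}^{m+1}$ whose boundary consists of two strictly convex closed curves (strictly convex closed hypersurfaces of the respective hyperplanes when $m>2$) $\Gamma_1,\Gamma_2$, contained respectively in two parallel hyperplanes $P_1,P_2$ orthogonal to $\mathrm{v}$. Assume $M$ lies in the closed slab between $P_1$ and $P_2$, and that $\Gamma_1$ and $\Gamma_2$ are both symmetric with respect to a hyperplane $\Pi$ containing the direction $\mathrm{v}$. Then $M$ is symmetric with respect to $\Pi$.
   Context: A translator is an oriented smooth hypersurface (possibly with boundary) whose mean curvature vector $\mathbf{H}$ satisfies $\mathbf{H}=\mathrm{v}^\perp$, where $\mathrm{v}$ is the fixed unit direction of translation and $\mathrm{v}^\perp$ its orthogonal projection onto the normal bundle. *)

theory Defs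
  imports "HOL-Analysis.Analysis"
begin

coinductive smooth_on :: "'a::euclidean_space set \<Rightarrow> ('a \<Rightarrow> real) \<Rightarrow> bool" where
  "f differentiable_on S \<Longrightarrow> (\<forall>w. smooth_on S (\<lambda>x. frechet_derivative f (at x) w))
     \<Longrightarrow> smooth_on S f"

definition grad :: "('a::euclidean_space \<Rightarrow> real) \<Rightarrow> 'a \<Rightarrow> 'a" where
  "grad f x = (\<Sum>i\<in>Basis. frechet_derivative f (at x) i *\<^sub>R i)"

definition divergence :: "('a::euclidean_space \<Rightarrow> 'a) \<Rightarrow> 'a \<Rightarrow> real" where
  "divergence F x = (\<Sum>i\<in>Basis. frechet_derivative (\<lambda>y. F y \<bullet> i) (at x) i)"

definition gW :: "('a::euclidean_space \<Rightarrow> real) \<Rightarrow> 'a \<Rightarrow> real" where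
  "gW u x = sqrt (1 + (norm (grad u x))\<^sup>2)"

text \<open>Local graph chart of S near p: S is, inside a ball around p, the graph
  {y + u y e | y in the hyperplane e-perp} of a smooth function u over the hyperplane
  orthogonal to the unit vector e.  The function u is extended to an open cylinder
  invariant under translations along e, so that ordinary Euclidean derivatives are
  derivatives along the hyperplane.\<close>
definition graph_chart :: "'a::euclidean_space set \<Rightarrow> 'a \<Rightarrow> 'a \<Rightarrow> 'a set \<Rightarrow> ('a \<Rightarrow> real) \<Rightarrow> bool" where
  "graph_chart S p e \<Omega> u \<longleftrightarrow>
     norm e = 1 \<and> open \<Omega> \<and>
     (\<forall>y t. y \<in> \<Omega> \<longleftrightarrow> y + t *\<^sub>R e \<in> \<Omega>) \<and>
     (\<forall>y t. u (y + t *\<^sub>R e) = u y) \<and>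
     smooth_on \<Omega> u \<and>
     (\<exists>r>0. S \<inter> ball p r = {y + u y *\<^sub>R e | y. y \<in> \<Omega> \<and> y \<bullet> e = 0} \<inter> ball p r)"

definition smooth_hypersurface :: "'a::euclidean_space set \<Rightarrow> bool" where
  "smooth_hypersurface S \<longleftrightarrow> (\<forall>p\<in>S. \<exists>e \<Omega> u. graph_chart S p e \<Omega> u)"

definition chart_normal :: "'a::euclidean_space \<Rightarrow> 'a \<Rightarrow> ('a \<Rightarrow> real) \<Rightarrow> 'a" where
  "chart_normal p e u = (let y = p - (p \<bullet> e) *\<^sub>R e in (e - grad u y) /\<^sub>R gW u y)"

text \<open>Translator equation H = v-perp at the point q of S, in a graph chart:
  the mean curvature vector of a graph is  div(grad u / W) nu, and v-perp = (v . nu) nu,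
  so the equation reads  div(grad u / W) = v . nu.\<close>
definition translator_at :: "'a::euclidean_space \<Rightarrow> 'a set \<Rightarrow> 'a \<Rightarrow> bool" where
  "translator_at v S q \<longleftrightarrow> (\<exists>e \<Omega> u. graph_chart S q e \<Omega> u \<and>
     (let y = q - (q \<bullet> e) *\<^sub>R e in
        divergence (\<lambda>x. grad u x /\<^sub>R gW u x) y = v \<bullet> chart_normal q e u))"

text \<open>M is a compact smooth embedded translator with boundary bd: M is a compact
  regular domain (with smooth boundary bd) inside a smooth embedded hypersurface S,
  and the translator equation holds at every point of M (up to the boundary).\<close>
definition compact_translator_with_boundary :: "'a::euclidean_space \<Rightarrow> 'a set \<Rightarrow> 'a set \<Rightarrow> bool" where
  "compact_translator_with_boundary v M bd \<longleftrightarrow>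
     compact M \<and> bd \<subseteq> M \<and>
     (\<exists>S. smooth_hypersurface S \<and> M \<subseteq> S \<and>
        (\<forall>p\<in>M - bd. \<exists>r>0. S \<inter> ball p r \<subseteq> M) \<and>
        (\<forall>p\<in>bd. \<exists>r>0. \<exists>\<phi> e \<Omega> u. graph_chart S p e \<Omega> u \<and> smooth_on (ball p r) \<phi> \<and>
            (\<exists>w. w \<bullet> chart_normal p e u = 0 \<and> frechet_derivative \<phi> (at p) w \<noteq> 0) \<and>
            M \<inter> ball p r = {q \<in> S \<inter> ball p r. \<phi> q \<le> 0} \<and>
            bd \<inter> ball p r = {q \<in> S \<inter> ball p r. \<phi> q = 0}) \<and>
        (\<forall>q\<in>M. translator_at v S q))"

definition hyperplane :: "'a::euclidean_space \<Rightarrow> real \<Rightarrow> 'a set" where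
  "hyperplane a c = {x. x \<bullet> a = c}"

definition strictly_convex_closed_hypersurface_in :: "'a::euclidean_space set \<Rightarrow> 'a set \<Rightarrow> bool" where
  "strictly_convex_closed_hypersurface_in \<Gamma> P \<longleftrightarrow>
     (\<exists>K. compact K \<and> convex K \<and> K \<subseteq> P \<and> aff_dim K = int DIM('a) - 1 \<and>
          (\<forall>x\<in>K. \<forall>y\<in>K. x \<noteq> y \<longrightarrow> open_segment x y \<subseteq> rel_interior K) \<and>
          \<Gamma> = rel_frontier K)"

text \<open>Reflection across the hyperplane {x. x . a = b}, with a a unit vector.\<close>
definition reflect :: "'a::euclidean_space \<Rightarrow> real \<Rightarrow> 'a \<Rightarrow> 'a" where
  "reflect a b x = x - (2 * (x \<bullet> a - b)) *\<^sub>R a"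

end

theory Submission
  imports Defs
begin

text \<open>
  Alexandrov's method of moving planes, in a form that does not need \<open>M\<close> to bound a domain. Consider
  the midpoints of all pairs of points of \<open>M\<close> on a line in direction \<open>a\<close>, counting an interior point where
  \<open>M\<close> is tangent to \<open>a\<close> as a double pair, and suppose that the largest value \<open>t0\<close> of \<open>m \<bullet> a\<close> over all
  midpoints \<open>m\<close> exceeds \<open>b\<close>. Reflecting \<open>M\<close> in \<open>x \<bullet> a = t0\<close> gives a translator that lies on one side of
  \<open>M\<close> and touches it, at an interior point or on the mirror. Both sheets are graphs over a common
  hyperplane, and the difference of two solutions of the translator equation obeys the strong maximum
  principle and the Hopf lemma, so the set of contact points off the mirror is open in \<open>M\<close>. But on a
  translator \<open>x \<bullet> (a + \<epsilon> v)\<close> has no interior local maximum, which rules out such a set, and then Hopf's lemma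
  rules out a contact on the mirror. The boundary does not interfere: by strict convexity and symmetry it
  is transversal to \<open>a\<close> away from the mirror \<open>x \<bullet> a = b\<close> and pairs of boundary points have their midpoint
  on it; only an interior point of \<open>M\<close> touching the lower hyperplane opposite a boundary point needs extra care.
  By the symmetry \<open>(a, b) \<mapsto> (-a, -b)\<close> all midpoints lie on the mirror. The points without a mirror image
  then form an open set, which is again excluded by the maximum principle.
\<close>

section \<open>Twice continuously differentiable functions\<close>

text \<open>Where x . w has an interior local maximum on M, the normal is parallel to w and the mean
  curvature vector, the normal part of v, has a nonpositive product with w; hence v . w \<le> 0,
  which fails for w = a + \<epsilon> v. A small \<epsilon> keeps the maximiser beyond the mirror.
  The main obstacle is a boundary point where M is tangent to a, since pairs might collapse there.
  At such a point the tangent plane is horizontal and M is the graph of a function u over it. As u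
  is constant on the boundary and the equation gives its Hessian trace 1, the Hessian form has rank
  one and is positive in direction a. So the point lies on the lower curve, and heights rise
  strictly along a line in direction a from the boundary on; two points of such a line have equal
  height and cannot both lie on M nearby. Charts are needed in directions dictated by the argument
  (a, v, the normal), while the definition supplies an unspecified chart at each point. The equation
  is therefore transported through defining functions of the hypersurface, where its form is
  independent of the chart.\<close>

definition C2 :: "'a::euclidean_space set \<Rightarrow> ('a \<Rightarrow> real) \<Rightarrow> ('a \<Rightarrow> 'a) \<Rightarrow> ('a \<Rightarrow> 'a \<Rightarrow> 'a) \<Rightarrow> bool" where
  "C2 U u g H \<longleftrightarrow> open U \<and> (\<forall>x\<in>U. (u has_derivative (\<lambda>h. g x \<bullet> h)) (at x)) \<and>
     (\<forall>x\<in>U. (g has_derivative H x) (at x)) \<and> (\<forall>h. continuous_on U (\<lambda>x. H x h))"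

definition tr :: "('a::euclidean_space \<Rightarrow> 'a) \<Rightarrow> real" where
  "tr L = (\<Sum>i\<in>Basis. L i \<bullet> i)"

lemma C2_D:
  assumes "C2 U u g H"
  shows "open U" "x \<in> U \<Longrightarrow> (u has_derivative (\<lambda>h. g x \<bullet> h)) (at x)"
    "x \<in> U \<Longrightarrow> (g has_derivative H x) (at x)" "continuous_on U (\<lambda>x. H x h)"
    "x \<in> U \<Longrightarrow> linear (H x)" "continuous_on U u" "continuous_on U g"
proof -
  show "open U" and d: "x \<in> U \<Longrightarrow> (u has_derivative (\<lambda>h. g x \<bullet> h)) (at x)"
    and e: "x \<in> U \<Longrightarrow> (g has_derivative H x) (at x)" and "continuous_on U (\<lambda>x. H x h)" for x h
    using assms unfolding C2_def by auto
  show "x \<in> U \<Longrightarrow> linear (H x)"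
    using e[of x] has_derivative_linear by blast
  show "continuous_on U u"
    using d by (metis continuous_at_imp_continuous_on has_derivative_continuous)
  show "continuous_on U g"
    using e by (metis continuous_at_imp_continuous_on has_derivative_continuous)
qed

lemma C2_subset: "C2 U u g H \<Longrightarrow> open V \<Longrightarrow> V \<subseteq> U \<Longrightarrow> C2 V u g H"
  unfolding C2_def by (meson continuous_on_subset in_mono)

lemma C2_diff:
  assumes "C2 U u g H" "C2 U u' g' H'"
  shows "C2 U (\<lambda>x. u x - u' x) (\<lambda>x. g x - g' x) (\<lambda>x h. H x h - H' x h)"
  using assms unfolding C2_def inner_diff_left
  by (auto intro!: continuous_intros has_derivative_diff)

lemma C2_const_minus:
  assumes "C2 U u g H"
  shows "C2 U (\<lambda>x. c - u x) (\<lambda>x. - g x) (\<lambda>x h. - H x h)"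
  using assms unfolding C2_def inner_minus_left
  by (auto intro!: continuous_intros derivative_eq_intros)

lemma smooth_on_D:
  assumes "smooth_on S f"
  shows "f differentiable_on S" "smooth_on S (\<lambda>x. frechet_derivative f (at x) w)"
  using assms by (auto elim: smooth_on.cases)

lemma grad_inner:
  assumes "f differentiable (at x)"
  shows "(f has_derivative (\<lambda>h. grad f x \<bullet> h)) (at x)"
proof -
  have d: "(f has_derivative frechet_derivative f (at x)) (at x)"
    using assms frechet_derivative_works by blast
  then have l: "linear (frechet_derivative f (at x))" by (rule has_derivative_linear)
  have "frechet_derivative f (at x) h = grad f x \<bullet> h" for h
  proof -
    have "frechet_derivative f (at x) h = frechet_derivative f (at x) (\<Sum>i\<in>Basis. (h \<bullet> i) *\<^sub>R i)"
      by (simp add: euclidean_representation)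
    also have "\<dots> = (\<Sum>i\<in>Basis. (h \<bullet> i) * frechet_derivative f (at x) i)"
      by (simp add: linear_sum[OF l] linear_scale[OF l])
    finally show ?thesis
      by (simp add: grad_def inner_sum_left inner_sum_right inner_commute mult.commute)
  qed
  then show ?thesis using d by presburger
qed

lemma has_derivative_grad:
  assumes "(f has_derivative (\<lambda>h. g \<bullet> h)) (at x)"
  shows "grad f x = g"
proof -
  have "(f has_derivative (\<lambda>h. grad f x \<bullet> h)) (at x)"
    using assms differentiable_def grad_inner by blast
  then have "(\<lambda>h. grad f x \<bullet> h) = (\<lambda>h. g \<bullet> h)"
    using assms has_derivative_unique by blast
  then show ?thesis by (metis inner_commute vector_eq_rdot)
qed

text \<open>Unfolding the coinductive predicate twice shows that second partial derivatives are
  smooth again; being differentiable, they are continuous.\<close>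

lemma smooth_on_C2:
  fixes u :: "'a::euclidean_space \<Rightarrow> real"
  assumes "smooth_on U u" "open U"
  obtains H where "C2 U u (grad u) H"
proof
  define D where "D = (\<lambda>x. frechet_derivative u (at x))"
  define H where "H = (\<lambda>x h. \<Sum>i\<in>Basis. frechet_derivative (\<lambda>z. D z i) (at x) h *\<^sub>R (i::'a))"
  have 0: "f differentiable (at x)" if "smooth_on U f" "x \<in> U" for f :: "'a \<Rightarrow> real" and x
    using smooth_on_D(1)[OF that(1)] that(2) assms(2) differentiable_on_eq_differentiable_at by blast
  have s1: "smooth_on U (\<lambda>z. D z w)" for w
    unfolding D_def using assms smooth_on_D by blast
  have s2: "smooth_on U (\<lambda>x. frechet_derivative (\<lambda>z. D z w) (at x) h)" for w h
    using s1 smooth_on_D by blast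
  show "C2 U u (grad u) H"
    unfolding C2_def
  proof (intro conjI ballI allI)
    fix x assume x: "x \<in> U"
    show "(u has_derivative (\<lambda>h. grad u x \<bullet> h)) (at x)"
      using 0[OF assms(1) x] grad_inner by blast
    have "((\<lambda>z. D z i) has_derivative frechet_derivative (\<lambda>z. D z i) (at x)) (at x)" for i
      using 0[OF s1 x] frechet_derivative_works by blast
    then have "((\<lambda>z. \<Sum>i\<in>Basis. D z i *\<^sub>R i) has_derivative H x) (at x)"
      unfolding H_def
      by (intro has_derivative_sum has_derivative_scaleR_left)
    then show "(grad u has_derivative H x) (at x)"
      unfolding grad_def[abs_def] D_def .
  next
    fix h
    have "continuous_on U (\<lambda>x. frechet_derivative (\<lambda>z. D z i) (at x) h)" for i
      using smooth_on_D(1)[OF s2] by (rule differentiable_imp_continuous_on)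
    then show "continuous_on U (\<lambda>x. H x h)"
      unfolding H_def by (intro continuous_intros)
  qed (rule assms)
qed

section \<open>Taylor estimates and second order conditions\<close>

lemma DERIV_along_line:
  fixes u :: "'a::real_inner \<Rightarrow> real"
  assumes "(u has_derivative (\<lambda>h. g \<bullet> h)) (at (x + t *\<^sub>R h))"
  shows "((\<lambda>t. u (x + t *\<^sub>R h)) has_real_derivative g \<bullet> h) (at t)"
proof -
  have "((\<lambda>t. u (x + t *\<^sub>R h)) has_derivative (\<lambda>s. g \<bullet> (s *\<^sub>R h))) (at t)"
    by (rule has_derivative_compose[of "\<lambda>t. x + t *\<^sub>R h" "\<lambda>s. s *\<^sub>R h", OF _ assms])
       (auto intro!: derivative_eq_intros)
  moreover have "(\<lambda>s. g \<bullet> (s *\<^sub>R h)) = (*) (g \<bullet> h)" by (rule ext) simp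
  ultimately show ?thesis unfolding has_field_derivative_def by simp
qed

lemma C2_gradient_expansion:
  assumes "C2 U u g H" "x \<in> U" "\<eta> > 0"
  obtains \<delta> where "\<delta> > 0" "\<And>h. norm h < \<delta> \<Longrightarrow> \<bar>u (x+h) - u x - g x \<bullet> h - (H x h \<bullet> h)/2\<bar> \<le> \<eta> * (norm h)\<^sup>2"
proof -
  note C = C2_D[OF assms(1)]
  obtain r where r: "r > 0" "ball x r \<subseteq> U" using C(1) assms(2) openE by blast
  obtain d where d: "d > 0" "\<And>y. norm (y - x) < d \<Longrightarrow> norm (g y - g x - H x (y - x)) \<le> \<eta> * norm (y - x)"
    using C(3)[OF assms(2)] assms(3) unfolding has_derivative_at_alt by metis
  have lin: "linear (H x)" using C assms by blast
  show ?thesis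
  proof
    show "min r d > 0" using r d by simp
    fix h :: 'a assume h: "norm h < min r d"
    \<comment> \<open>Without the first and second order Taylor terms, the derivative of
      \<open>G\<close> is the first order remainder of \<open>g\<close> at \<open>x\<close>, which
      differentiability of \<open>g\<close> at this one point controls.\<close>
    define G where "G = (\<lambda>t. u (x + t *\<^sub>R h) - t * (g x \<bullet> h) - t\<^sup>2/2 * (H x h \<bullet> h))"
    have D: "(G has_real_derivative (g (x + t *\<^sub>R h) \<bullet> h - g x \<bullet> h - t * (H x h \<bullet> h))) (at t)"
      if "0 \<le> t" "t \<le> 1" for t
    proof -
      have "norm (t *\<^sub>R h) < r"
        using that h mult_left_le_one_le[of "norm h" t] by simp
      then have "x + t *\<^sub>R h \<in> U" using r by (auto simp: dist_norm)
      from DERIV_along_line[OF C(2)[OF this]] show ?thesis unfolding G_def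
        by (auto intro!: derivative_eq_intros)
    qed
    have "\<exists>t. t > 0 \<and> t < 1 \<and> G 1 - G 0 = (1 - 0) * (g (x + t *\<^sub>R h) \<bullet> h - g x \<bullet> h - t * (H x h \<bullet> h))"
      by (rule MVT2) (use D in auto)
    then obtain t where t: "0 < t" "t < 1" "G 1 - G 0 = g (x + t *\<^sub>R h) \<bullet> h - g x \<bullet> h - t * (H x h \<bullet> h)"
      by auto
    have tn: "norm (t *\<^sub>R h) \<le> norm h" using t by (simp add: mult_left_le_one_le)
    have "norm (g (x + t *\<^sub>R h) - g x - H x (t *\<^sub>R h)) \<le> \<eta> * norm (t *\<^sub>R h)"
      using d(2)[of "x + t *\<^sub>R h"] h tn by simp
    also have "\<dots> \<le> \<eta> * norm h" using tn assms(3) by (intro mult_left_mono) auto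
    finally have le: "norm (g (x + t *\<^sub>R h) - g x - H x (t *\<^sub>R h)) \<le> \<eta> * norm h" .
    have "g (x + t *\<^sub>R h) \<bullet> h - g x \<bullet> h - t * (H x h \<bullet> h) = (g (x + t *\<^sub>R h) - g x - H x (t *\<^sub>R h)) \<bullet> h"
      by (simp add: inner_diff_left linear_scale[OF lin])
    also have "\<bar>\<dots>\<bar> \<le> norm (g (x + t *\<^sub>R h) - g x - H x (t *\<^sub>R h)) * norm h"
      by (rule Cauchy_Schwarz_ineq2)
    also have "\<dots> \<le> \<eta> * norm h * norm h" using le by (intro mult_right_mono) auto
    finally show "\<bar>u (x+h) - u x - g x \<bullet> h - (H x h \<bullet> h)/2\<bar> \<le> \<eta> * (norm h)\<^sup>2"
      using t(3) unfolding G_def by (simp add: power2_eq_square mult.assoc)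
  qed
qed

text \<open>\<open>C2\<close> gives continuity of the Hessian for each fixed \<open>h\<close> only.
  Bounds on the basis vectors add up to an operator bound on a compact ball; the gradient is then
  Lipschitz there, and the mean value theorem gives a quadratic remainder with a constant
  independent of the base point.\<close>

lemma C2_locally_bounded:
  fixes x :: "'a::euclidean_space"
  assumes "C2 U u g H" "x \<in> U"
  obtains r L where "r > 0" "L > 0" "cball x r \<subseteq> U"
    "\<And>z h. z \<in> cball x r \<Longrightarrow> norm (H z h) \<le> L * norm h" "\<And>z. z \<in> cball x r \<Longrightarrow> norm (g z) \<le> L"
    "\<And>z w. z \<in> cball x r \<Longrightarrow> w \<in> cball x r \<Longrightarrow> \<bar>u w - u z - g z \<bullet> (w - z)\<bar> \<le> L * (norm (w - z))\<^sup>2"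
proof -
  note C = C2_D[OF assms(1)]
  obtain r where r: "r > 0" "cball x r \<subseteq> U" using C(1) assms(2) open_contains_cball by blast
  have "\<exists>B. \<forall>z\<in>cball x r. norm (H z i) \<le> B" for i
  proof -
    have "compact ((\<lambda>z. H z i) ` cball x r)"
      using C(4) r(2) by (intro compact_continuous_image) (auto intro: continuous_on_subset)
    then show ?thesis using compact_imp_bounded bounded_iff by (metis imageI)
  qed
  then obtain B where B: "\<And>i z. z \<in> cball x r \<Longrightarrow> norm (H z i) \<le> B i" by metis
  have "compact (g ` cball x r)"
    using C(7) r(2) by (intro compact_continuous_image) (auto intro: continuous_on_subset)
  then obtain L0 where L0: "\<And>z. z \<in> cball x r \<Longrightarrow> norm (g z) \<le> L0"
    using compact_imp_bounded bounded_iff by (metis imageI)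
  define L where "L = (\<Sum>i\<in>Basis. \<bar>B i\<bar>) + \<bar>L0\<bar> + 1"
  have Lp: "L > 0" unfolding L_def by (smt (verit) abs_ge_zero sum_nonneg)
  have HL: "norm (H z h) \<le> L * norm h" if z: "z \<in> cball x r" for z h
  proof -
    have zU: "z \<in> U" using z r by blast
    have l: "linear (H z)" by (rule C(5)[OF zU])
    have "H z h = H z (\<Sum>i\<in>Basis. (h \<bullet> i) *\<^sub>R i)" by (simp add: euclidean_representation)
    also have "\<dots> = (\<Sum>i\<in>Basis. (h \<bullet> i) *\<^sub>R H z i)"
      by (simp add: linear_sum[OF l] linear_scale[OF l])
    finally have "norm (H z h) \<le> (\<Sum>i\<in>Basis. norm ((h \<bullet> i) *\<^sub>R H z i))"
      by (metis norm_sum)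
    also have "\<dots> \<le> (\<Sum>i\<in>Basis. norm h * \<bar>B i\<bar>)"
    proof (intro sum_mono)
      fix i :: 'a assume "i \<in> Basis"
      then have "\<bar>h \<bullet> i\<bar> * norm (H z i) \<le> norm h * \<bar>B i\<bar>"
        using B[OF z, of i] Basis_le_norm[of i h] by (intro mult_mono) auto
      then show "norm ((h \<bullet> i) *\<^sub>R H z i) \<le> norm h * \<bar>B i\<bar>" by simp
    qed
    also have "\<dots> = norm h * (\<Sum>i\<in>Basis. \<bar>B i\<bar>)" by (simp add: sum_distrib_left)
    also have "\<dots> \<le> norm h * L" unfolding L_def by (intro mult_left_mono) auto
    finally show ?thesis by (simp add: mult.commute)
  qed
  have gL: "norm (g w - g z) \<le> L * norm (w - z)" if "z \<in> cball x r" "w \<in> cball x r" for z w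
  proof (rule differentiable_bound[of "cball x r" g H])
    fix y assume y: "y \<in> cball x r"
    then have yU: "y \<in> U" using r by blast
    show "(g has_derivative H y) (at y within cball x r)"
      by (rule has_derivative_at_withinI[OF C(3)[OF yU]])
    show "onorm (H y) \<le> L" by (rule onorm_le) (rule HL[OF y])
  qed (use that in auto)
  show ?thesis
  proof
    show "norm (g z) \<le> L" if "z \<in> cball x r" for z
      using L0[OF that] unfolding L_def by (smt (verit) abs_ge_zero sum_nonneg)
    fix z w assume z: "z \<in> cball x r" and w: "w \<in> cball x r"
    define h where "h = w - z"
    have inb: "z + t *\<^sub>R h \<in> cball x r" if "0 \<le> t" "t \<le> 1" for t
    proof -
      have "z + t *\<^sub>R h = (1-t) *\<^sub>R z + t *\<^sub>R w" unfolding h_def by (simp add: algebra_simps)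
      then show ?thesis using convexD[OF convex_cball z w, of "1-t" t] that by auto
    qed
    have D: "((\<lambda>t. u (z + t *\<^sub>R h)) has_real_derivative (g (z + t *\<^sub>R h) \<bullet> h)) (at t)"
      if "0 \<le> t" "t \<le> 1" for t
    proof -
      have "z + t *\<^sub>R h \<in> U" using r inb[OF that] by blast
      from DERIV_along_line[OF C(2)[OF this]] show ?thesis .
    qed
    have "\<exists>t. t > 0 \<and> t < 1 \<and> u (z + 1 *\<^sub>R h) - u (z + 0 *\<^sub>R h) = (1 - 0) * (g (z + t *\<^sub>R h) \<bullet> h)"
      by (rule MVT2) (use D in auto)
    then obtain t where t: "0 < t" "t < 1" "u (z + h) - u z = g (z + t *\<^sub>R h) \<bullet> h" by auto
    have "\<bar>(g (z + t *\<^sub>R h) - g z) \<bullet> h\<bar> \<le> norm (g (z + t *\<^sub>R h) - g z) * norm h"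
      by (rule Cauchy_Schwarz_ineq2)
    also have "\<dots> \<le> (L * norm (t *\<^sub>R h)) * norm h"
      using gL[OF z inb[of t]] t by (intro mult_right_mono) auto
    also have "\<dots> \<le> (L * norm h) * norm h" using t Lp
      by (intro mult_right_mono mult_left_mono) (auto simp: mult_left_le_one_le)
    finally show "\<bar>u w - u z - g z \<bullet> (w - z)\<bar> \<le> L * (norm (w - z))\<^sup>2"
      using t(3) unfolding h_def by (simp add: inner_diff_left power2_eq_square mult.assoc)
  qed (use r HL Lp in auto)
qed

text \<open>The comparison is required only for arbitrarily small steps in the one direction
  \<open>h\<close>, since at boundary points of M values are known on one side only.\<close>

lemma C2_second_order_nonneg:
  assumes "C2 U u g H" "x \<in> U" "g x \<bullet> h = 0"
    and "\<And>e. e > 0 \<Longrightarrow> \<exists>s. 0 < s \<and> s < e \<and> u x \<le> u (x + s *\<^sub>R h)"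
  shows "0 \<le> H x h \<bullet> h"
proof (rule ccontr)
  assume n: "\<not> 0 \<le> H x h \<bullet> h"
  then have hn: "h \<noteq> 0" by auto
  have lin: "linear (H x)" using C2_D(5)[OF assms(1,2)] .
  \<comment> \<open>With this constant the Taylor error is at most half the size of the negative
    quadratic term.\<close>
  define \<eta> where "\<eta> = - (H x h \<bullet> h) / (4 * (norm h)\<^sup>2)"
  have e: "\<eta> > 0" using n hn unfolding \<eta>_def by (auto simp: divide_simps)
  obtain \<delta> where d: "\<delta> > 0" "\<And>h. norm h < \<delta> \<Longrightarrow> \<bar>u (x+h) - u x - g x \<bullet> h - (H x h \<bullet> h)/2\<bar> \<le> \<eta> * (norm h)\<^sup>2"
    using C2_gradient_expansion[OF assms(1,2) e] by blast
  obtain s where s: "0 < s" "s < \<delta> / norm h" "u x \<le> u (x + s *\<^sub>R h)"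
    using assms(4)[of "\<delta> / norm h"] d hn by auto
  have "norm (s *\<^sub>R h) < \<delta>" using s hn by (simp add: field_simps)
  from d(2)[OF this] have "\<bar>u (x + s *\<^sub>R h) - u x - s\<^sup>2 * (H x h \<bullet> h)/2\<bar> \<le> \<eta> * (s\<^sup>2 * (norm h)\<^sup>2)"
    using assms(3) by (simp add: linear_scale[OF lin] power_mult_distrib power2_eq_square algebra_simps)
  moreover have "\<eta> * (s\<^sup>2 * (norm h)\<^sup>2) = - s\<^sup>2 * (H x h \<bullet> h) / 4"
    unfolding \<eta>_def using hn by (simp add: field_simps)
  ultimately have "0 \<le> s\<^sup>2 * (H x h \<bullet> h)" using s(3) by (simp add: abs_le_iff)
  then show False using n s(1) by (simp add: zero_le_mult_iff)
qed

lemma C2_local_min: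
  assumes "C2 U u g H" "x \<in> U" "V \<subseteq> U" "open V" "x \<in> V" "\<And>y. y \<in> V \<Longrightarrow> u x \<le> u y"
  shows "g x = 0" "\<And>h. 0 \<le> H x h \<bullet> h"
proof -
  have "(u has_derivative (\<lambda>h. g x \<bullet> h)) (at x)" using C2_D assms by blast
  then have "(\<lambda>h. g x \<bullet> h) = (\<lambda>h. 0)"
    using differential_zero_maxmin[of x V u] assms by blast
  then show g: "g x = 0" by (metis inner_eq_zero_iff)
  fix h
  show "0 \<le> H x h \<bullet> h"
  proof (rule C2_second_order_nonneg[OF assms(1,2)])
    fix e :: real assume e: "e > 0"
    obtain r where r: "r > 0" "ball x r \<subseteq> V" using assms openE by blast
    define s where "s = min (e/2) (r / (2 * (norm h + 1)))"
    have "s \<le> r / (2 * (norm h + 1))" "s > 0" unfolding s_def using r e by (auto simp: add_nonneg_pos)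
    then have "s * norm h \<le> r / (2 * (norm h + 1)) * norm h" by (intro mult_right_mono) auto
    also have "\<dots> = r * (norm h / (2 * (norm h + 1)))" by simp
    also have "\<dots> < r * 1" using r
      by (intro mult_strict_left_mono) (auto simp: divide_less_eq add_nonneg_pos intro: add_nonneg_pos)
    finally have "x + s *\<^sub>R h \<in> V" using r \<open>s > 0\<close> by (auto simp: dist_norm)
    then show "\<exists>s. 0 < s \<and> s < e \<and> u x \<le> u (x + s *\<^sub>R h)"
      using assms(6) \<open>s > 0\<close> e by (intro exI[of _ s]) (auto simp: s_def)
  qed (use g in simp)
qed

section \<open>Traces and quadratic forms of linear maps that need not be symmetric\<close>

lemma tr_diff: "tr (\<lambda>h. L h - L' h) = tr L - tr L'"
  by (simp add: tr_def inner_diff_left sum_subtractf)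

lemma tr_scale: "tr (\<lambda>h. c *\<^sub>R L h) = c * tr L"
  by (simp add: tr_def sum_distrib_left)

lemma tr_minus: "tr (\<lambda>h. - L h) = - tr L"
  by (simp add: tr_def sum_negf)

lemma quadratic_form_le_trace:
  assumes "linear L" "\<And>h. 0 \<le> L h \<bullet> h"
  shows "L p \<bullet> p \<le> (norm p)\<^sup>2 * tr L"
proof -
  define s where "s = (\<lambda>i. sqrt (L i \<bullet> i))"
  have s2: "(s i)\<^sup>2 = L i \<bullet> i" and s0: "0 \<le> s i" for i using assms(2) by (auto simp: s_def)
  have cross: "\<bar>L i \<bullet> j + L j \<bullet> i\<bar> \<le> 2 * s i * s j" for i j
  proof -
    have "0 \<le> L j \<bullet> j * c\<^sup>2 + (L i \<bullet> j + L j \<bullet> i) * c + L i \<bullet> i" for c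
      using assms(2)[of "i + c *\<^sub>R j"]
      by (simp add: linear_add[OF assms(1)] linear_scale[OF assms(1)] inner_add_left inner_add_right power2_eq_square algebra_simps)
    then have "(L i \<bullet> j + L j \<bullet> i)\<^sup>2 \<le> 4 * (L j \<bullet> j) * (L i \<bullet> i)"
    proof -
      assume *: "\<And>c. 0 \<le> L j \<bullet> j * c\<^sup>2 + (L i \<bullet> j + L j \<bullet> i) * c + L i \<bullet> i"
      define B where "B = L i \<bullet> j + L j \<bullet> i"
      define A where "A = L j \<bullet> j"
      define D where "D = L i \<bullet> i"
      have q: "0 \<le> A * c\<^sup>2 + B * c + D" for c using * unfolding A_def B_def D_def .
      have "B\<^sup>2 \<le> 4 * A * D"
      proof (cases "A = 0")
        case True
        have "B = 0"
        proof (rule ccontr)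
          assume "B \<noteq> 0"
          \<comment> \<open>At this point the linear function would take the value -1.\<close>
          then show False using q[of "- (D+1) / B"] True by simp
        qed
        then show ?thesis using True by simp
      next
        case False
        then have "A > 0" using assms(2)[of j] A_def by simp
        then show ?thesis using q[of "- B / (2*A)"] by (simp add: power2_eq_square field_simps)
      qed
      then show ?thesis unfolding A_def B_def D_def .
    qed
    also have "\<dots> = (2 * s i * s j)\<^sup>2" by (simp add: power_mult_distrib s2)
    finally show ?thesis using s0 by (metis abs_le_square_iff abs_of_nonneg mult_nonneg_nonneg zero_le_numeral)
  qed
  define c where "c = (\<lambda>i. p \<bullet> i)"
  have p: "p = (\<Sum>i\<in>Basis. c i *\<^sub>R i)" by (simp add: c_def euclidean_representation)
  have Lp: "L p = (\<Sum>i\<in>Basis. c i *\<^sub>R L i)"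
    by (subst p) (simp add: linear_sum[OF assms(1)] linear_scale[OF assms(1)])
  have e2: "L p \<bullet> p = (\<Sum>i\<in>Basis. \<Sum>j\<in>Basis. c i * c j * (L j \<bullet> i))"
  proof -
    have "L p \<bullet> p = (\<Sum>i\<in>Basis. c i *\<^sub>R L i) \<bullet> (\<Sum>j\<in>Basis. c j *\<^sub>R j)" using Lp p by simp
    then show ?thesis
      by (simp add: inner_sum_left inner_sum_right sum_distrib_left mult.assoc)
  qed
  have e1: "L p \<bullet> p = (\<Sum>i\<in>Basis. \<Sum>j\<in>Basis. c i * c j * (L i \<bullet> j))"
    unfolding e2 by (subst sum.swap) (simp add: mult.commute mult.left_commute)
  have "2 * (L p \<bullet> p) = (\<Sum>i\<in>Basis. \<Sum>j\<in>Basis. c i * c j * (L i \<bullet> j + L j \<bullet> i))"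
    using e1 e2 by (simp add: distrib_left sum.distrib)
  also have "\<dots> \<le> (\<Sum>i\<in>Basis. \<Sum>j\<in>Basis. 2 * ((\<bar>c i\<bar> * s i) * (\<bar>c j\<bar> * s j)))"
  proof (intro sum_mono)
    fix i j
    have "c i * c j * (L i \<bullet> j + L j \<bullet> i) \<le> \<bar>c i * c j\<bar> * \<bar>L i \<bullet> j + L j \<bullet> i\<bar>"
      by (metis abs_ge_self abs_mult)
    also have "\<dots> \<le> \<bar>c i * c j\<bar> * (2 * s i * s j)" using cross by (intro mult_left_mono) auto
    finally show "c i * c j * (L i \<bullet> j + L j \<bullet> i) \<le> 2 * ((\<bar>c i\<bar> * s i) * (\<bar>c j\<bar> * s j))"
      by (simp add: abs_mult mult.assoc mult.left_commute)
  qed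
  also have "\<dots> = 2 * (\<Sum>i\<in>Basis. \<bar>c i\<bar> * s i)\<^sup>2"
    unfolding power2_eq_square sum_product by (simp only: sum_distrib_left)
  also have "\<dots> \<le> 2 * ((\<Sum>i\<in>Basis. \<bar>c i\<bar>\<^sup>2) * (\<Sum>i\<in>Basis. (s i)\<^sup>2))"
    using Cauchy_Schwarz_ineq_sum[of "\<lambda>i. \<bar>c i\<bar>" s Basis] by simp
  also have "(\<Sum>i\<in>Basis. \<bar>c i\<bar>\<^sup>2) = (norm p)\<^sup>2"
    by (simp only: c_def power2_abs power2_norm_eq_inner euclidean_inner[of p p]) (simp add: power2_eq_square)
  finally show ?thesis by (simp add: s2 tr_def)
qed

lemma tr_compose_inner: "linear L \<Longrightarrow> (\<Sum>i\<in>Basis. (w \<bullet> i) *\<^sub>R L i) = L w"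
  by (metis (no_types, lifting) euclidean_representation linear_scale linear_sum sum.cong)

text \<open>In an orthonormal basis containing the direction of \<open>n\<close> only one diagonal
  entry survives. The proof stays in \<open>Basis\<close> and projects each basis vector onto the
  complement of \<open>n\<close>, again without symmetry. It serves wherever a form is known on
  tangent vectors only.\<close>

lemma tr_eq_normal_part:
  assumes "linear L" "\<And>h. h \<bullet> n = 0 \<Longrightarrow> L h \<bullet> h = 0"
  shows "(norm n)\<^sup>2 * tr L = L n \<bullet> n"
proof (cases "n = 0")
  case False
  define m where "m = n /\<^sub>R norm n"
  have mm: "m \<bullet> m = 1" using False by (simp add: m_def dot_square_norm power2_eq_square)
  have "L i \<bullet> i = (m \<bullet> i) * (L i \<bullet> m) + (m \<bullet> i) * (L m \<bullet> i) - (m \<bullet> i)\<^sup>2 * (L m \<bullet> m)" for i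
  proof -
    have "(i - (m \<bullet> i) *\<^sub>R m) \<bullet> m = 0" using mm by (simp add: inner_diff_left inner_commute[of i m])
    then have "(i - (m \<bullet> i) *\<^sub>R m) \<bullet> n = 0" using False by (auto simp: m_def)
    note zero = assms(2)[OF this]
    have "L (i - (m \<bullet> i) *\<^sub>R m) \<bullet> (i - (m \<bullet> i) *\<^sub>R m)
        = (L i - (m \<bullet> i) *\<^sub>R L m) \<bullet> (i - (m \<bullet> i) *\<^sub>R m)"
      by (simp only: linear_diff[OF assms(1)] linear_scale[OF assms(1)])
    also have "\<dots> = L i \<bullet> i - (m \<bullet> i) * (L i \<bullet> m) - (m \<bullet> i) * (L m \<bullet> i) + (m \<bullet> i)\<^sup>2 * (L m \<bullet> m)"
      by (simp only: inner_diff_left inner_diff_right inner_scaleR_left inner_scaleR_right power2_eq_square) algebra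
    finally show ?thesis using zero by linarith
  qed
  then have "tr L = (\<Sum>i\<in>Basis. (m \<bullet> i) * (L i \<bullet> m) + (m \<bullet> i) * (L m \<bullet> i) - (m \<bullet> i)\<^sup>2 * (L m \<bullet> m))"
    unfolding tr_def by (intro sum.cong refl)
  then have "tr L = (\<Sum>i\<in>Basis. (m \<bullet> i) * (L i \<bullet> m)) + (\<Sum>i\<in>Basis. (m \<bullet> i) * (L m \<bullet> i)) - (\<Sum>i\<in>Basis. (m \<bullet> i)\<^sup>2 * (L m \<bullet> m))"
    by (simp only: sum.distrib sum_subtractf)
  also have "(\<Sum>i\<in>Basis. (m \<bullet> i) * (L i \<bullet> m)) = (\<Sum>i\<in>Basis. (m \<bullet> i) *\<^sub>R L i) \<bullet> m"
    by (simp add: inner_sum_left)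
  also have "\<dots> = L m \<bullet> m" by (simp add: tr_compose_inner[OF assms(1)])
  also have "(\<Sum>i\<in>Basis. (m \<bullet> i) * (L m \<bullet> i)) = L m \<bullet> m"
    by (simp add: euclidean_inner[of "L m" m] mult.commute)
  also have "(\<Sum>i\<in>Basis. (m \<bullet> i)\<^sup>2 * (L m \<bullet> m)) = L m \<bullet> m"
    using mm by (simp add: sum_distrib_right[symmetric] euclidean_inner[of m m] power2_eq_square)
  finally have "tr L = L m \<bullet> m" by simp
  then show ?thesis using False by (simp add: m_def linear_scale[OF assms(1)] power2_eq_square divide_simps mult_ac)
qed (use linear_0[OF assms(1)] in simp)

section \<open>Hopf lemma and strong maximum principle for translator graphs\<close>

text \<open>With p = grad u, L = Hess u and W = sqrt (1 + |p|^2), this is W^3 div (grad u / W), the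
  mean curvature operator without denominators.\<close>

definition Aop :: "'a::euclidean_space \<Rightarrow> ('a \<Rightarrow> 'a) \<Rightarrow> real" where
  "Aop p L = (1 + (norm p)\<^sup>2) * tr L - L p \<bullet> p"

text \<open>The translator equation multiplied by W^3, for a graph over the hyperplane orthogonal to
  \<open>e\<close> with unit normal (e - p) / W.\<close>

definition Qop :: "'a::euclidean_space \<Rightarrow> 'a \<Rightarrow> 'a \<Rightarrow> ('a \<Rightarrow> 'a) \<Rightarrow> real" where
  "Qop v e p L = Aop p L - (1 + (norm p)\<^sup>2) * (v \<bullet> (e - p))"

text \<open>Ellipticity: the coefficient matrix (1 + |p|^2) Id - p p^T is positive definite. Both
  maximum principles rest on this sign.\<close>

lemma Aop_nonneg:
  assumes "linear L" "\<And>h. 0 \<le> L h \<bullet> h"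
  shows "0 \<le> Aop p L"
proof -
  have "0 \<le> tr L" unfolding tr_def by (intro sum_nonneg) (use assms in auto)
  then show ?thesis
    using quadratic_form_le_trace[OF assms, of p] unfolding Aop_def by (simp add: distrib_right)
qed

lemma Aop_diff_scale: "Aop p (\<lambda>h. L h - c *\<^sub>R L' h) = Aop p L - c * Aop p L'"
  unfolding Aop_def tr_diff tr_scale by (simp add: inner_diff_left right_diff_distrib left_diff_distrib)

lemma C2_gaussian:
  fixes c :: "'a::euclidean_space" and \<alpha> k :: real
  defines "E \<equiv> \<lambda>x. exp (- \<alpha> * ((x - c) \<bullet> (x - c)))"
  shows "C2 UNIV (\<lambda>x. E x - k) (\<lambda>x. (-2 * \<alpha> * E x) *\<^sub>R (x - c))
     (\<lambda>x h. (-2 * \<alpha> * E x) *\<^sub>R h + (4 * \<alpha>\<^sup>2 * E x * ((x - c) \<bullet> h)) *\<^sub>R (x - c))"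
  unfolding C2_def E_def
  apply (intro conjI ballI allI)
     apply simp
    apply (rule derivative_eq_intros refl)+
    apply (auto simp: fun_eq_iff inner_commute algebra_simps)[1]
   apply (rule derivative_eq_intros refl)+
   apply (auto simp: fun_eq_iff inner_commute algebra_simps power2_eq_square)[1]
  apply (intro continuous_intros)
  done

text \<open>Barrier: \<open>exp (-\<alpha>|x-c|\<^sup>2) - exp (-\<alpha>\<rho>\<^sup>2)\<close> on the annulus \<open>\<rho>/2 \<le> |x-c| \<le> \<rho>\<close>.\<close>

lemma hopf_boundary_point:
  fixes c q :: "'a::euclidean_space"
  assumes d: "C2 U d g H" and U: "cball c \<rho> \<subseteq> U" and \<rho>: "\<rho> > 0" and q: "dist c q = \<rho>" "d q = 0"
    and pos: "\<And>x. x \<in> ball c \<rho> \<Longrightarrow> 0 < d x"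
    and pde: "\<And>x. x \<in> ball c \<rho> \<Longrightarrow> Aop (P x) (H x) \<le> C * norm (g x)"
    and P: "\<And>x. x \<in> ball c \<rho> \<Longrightarrow> norm (P x) \<le> \<Lambda>"
    and C: "C \<ge> 0"
  shows "0 < g q \<bullet> (c - q)"
proof -
  note D = C2_D[OF d]
  define n where "n = real DIM('a)"
  \<comment> \<open>Up to the factor \<open>E x\<close>, the second order part of the barrier is at
    least \<alpha>^2 \<rho>^2 on the annulus, and the other terms are at most \<alpha> (2 (1 +
    \<Lambda>^2) n + 2 C \<rho>). The summand 1 makes \<alpha> \<rho>^2 strictly larger than the
    bracket.\<close>
  define \<alpha> where "\<alpha> = (2 * (1 + \<Lambda>\<^sup>2) * n + 2 * C * \<rho> + 1) / \<rho>\<^sup>2"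
  have n: "n > 0" unfolding n_def by simp
  have num: "2 * (1 + \<Lambda>\<^sup>2) * n + 2 * C * \<rho> + 1 > 0"
    using n C \<rho> by (intro add_nonneg_pos add_nonneg_nonneg mult_nonneg_nonneg) auto
  then have \<alpha>: "\<alpha> > 0" unfolding \<alpha>_def using \<rho> by simp
  have \<alpha>\<rho>: "\<alpha> * \<rho>\<^sup>2 > 2 * (1 + \<Lambda>\<^sup>2) * n + 2 * C * \<rho>" unfolding \<alpha>_def using \<rho> by simp
  define E where "E = (\<lambda>x. exp (- \<alpha> * ((x - c) \<bullet> (x - c))))"
  define w where "w = (\<lambda>x. E x - exp (- \<alpha> * \<rho>\<^sup>2))"
  define gw where "gw = (\<lambda>x. (-2 * \<alpha> * E x) *\<^sub>R (x - c))"
  define Hw where "Hw = (\<lambda>x h. (-2 * \<alpha> * E x) *\<^sub>R h + (4 * \<alpha>\<^sup>2 * E x * ((x - c) \<bullet> h)) *\<^sub>R (x - c))"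
  have w: "C2 UNIV w gw Hw"
    unfolding w_def gw_def Hw_def E_def by (rule C2_gaussian)
  have E0: "E x > 0" for x unfolding E_def by simp
  have Aw: "Aop p (Hw x) = E x * (4 * \<alpha>\<^sup>2 * ((1 + (norm p)\<^sup>2) * (norm (x - c))\<^sup>2 - ((x - c) \<bullet> p)\<^sup>2)
        - 2 * \<alpha> * ((1 + (norm p)\<^sup>2) * n - (norm p)\<^sup>2))" for p x
  proof -
    have T1: "tr (Hw x) = E x * (4 * \<alpha>\<^sup>2 * (norm (x - c))\<^sup>2 - 2 * \<alpha> * n)"
    proof -
      have "tr (Hw x) = (\<Sum>i\<in>Basis. -2 * \<alpha> * E x + 4 * \<alpha>\<^sup>2 * E x * (((x - c) \<bullet> i) * ((x - c) \<bullet> i)))"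
        unfolding tr_def Hw_def
        by (intro sum.cong refl) (simp add: inner_add_left inner_diff_left algebra_simps)
      also have "\<dots> = n * (-2 * \<alpha> * E x) + 4 * \<alpha>\<^sup>2 * E x * (norm (x - c))\<^sup>2"
        by (simp add: sum.distrib n_def sum_distrib_left[symmetric] power2_norm_eq_inner euclidean_inner[of "x - c" "x - c"] sum_subtractf)
      finally show ?thesis by (simp add: algebra_simps)
    qed
    have T2: "Hw x p \<bullet> p = E x * (4 * \<alpha>\<^sup>2 * ((x - c) \<bullet> p)\<^sup>2 - 2 * \<alpha> * (norm p)\<^sup>2)"
      unfolding Hw_def by (simp only: inner_add_left inner_scaleR_left power2_norm_eq_inner) (simp add: algebra_simps power2_eq_square)
    show ?thesis unfolding Aop_def T1 T2 by (simp only: algebra_simps)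
  qed
  have barrier: "C * norm (gw x) < Aop (P x) (Hw x)" if x: "x \<in> ball c \<rho>" "\<rho>/2 \<le> norm (x - c)" for x
  proof -
    have nx: "norm (x - c) < \<rho>" using x by (simp add: dist_norm norm_minus_commute)
    have "\<bar>(x - c) \<bullet> P x\<bar> \<le> norm (x - c) * norm (P x)" by (rule Cauchy_Schwarz_ineq2)
    then have "((x - c) \<bullet> P x)\<^sup>2 \<le> (norm (x - c))\<^sup>2 * (norm (P x))\<^sup>2"
      by (metis abs_ge_zero power2_abs power_mono power_mult_distrib)
    then have 1: "(norm (x - c))\<^sup>2 \<le> (1 + (norm (P x))\<^sup>2) * (norm (x - c))\<^sup>2 - ((x - c) \<bullet> P x)\<^sup>2"
      by (simp add: algebra_simps)
    have "(\<rho>/2)\<^sup>2 \<le> (norm (x - c))\<^sup>2" using x \<rho> by (intro power_mono) auto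
    then have 2: "\<rho>\<^sup>2 \<le> 4 * ((1 + (norm (P x))\<^sup>2) * (norm (x - c))\<^sup>2 - ((x - c) \<bullet> P x)\<^sup>2)"
      using 1 by (simp add: power_divide)
    have "(norm (P x))\<^sup>2 \<le> \<Lambda>\<^sup>2" using P[OF x(1)] by (intro power_mono) auto
    then have 3: "(1 + (norm (P x))\<^sup>2) * n - (norm (P x))\<^sup>2 \<le> (1 + \<Lambda>\<^sup>2) * n"
      using n by (smt (verit) mult_right_mono zero_le_power2)
    have "\<alpha> * (2 * (1 + \<Lambda>\<^sup>2) * n + 2 * C * \<rho>) < \<alpha> * (\<alpha> * \<rho>\<^sup>2)"
      using \<alpha> \<alpha>\<rho> by (intro mult_strict_left_mono) auto
    also have "\<dots> \<le> \<alpha>\<^sup>2 * (4 * ((1 + (norm (P x))\<^sup>2) * (norm (x - c))\<^sup>2 - ((x - c) \<bullet> P x)\<^sup>2))"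
      using 2 \<alpha> by (simp add: power2_eq_square[of \<alpha>] mult.assoc)
    finally have 4: "\<alpha> * (2 * (1 + \<Lambda>\<^sup>2) * n + 2 * C * \<rho>) < 4 * \<alpha>\<^sup>2 * ((1 + (norm (P x))\<^sup>2) * (norm (x - c))\<^sup>2 - ((x - c) \<bullet> P x)\<^sup>2)"
      by (simp only: mult.assoc mult.left_commute)
    have 5: "2 * \<alpha> * ((1 + (norm (P x))\<^sup>2) * n - (norm (P x))\<^sup>2) \<le> 2 * \<alpha> * ((1 + \<Lambda>\<^sup>2) * n)"
      using 3 \<alpha> by (intro mult_left_mono) auto
    have "2 * \<alpha> * (C * norm (x - c)) \<le> 2 * \<alpha> * (C * \<rho>)"
      using nx C \<alpha> by (intro mult_left_mono) auto
    with 4 5 have 6: "2 * \<alpha> * (C * norm (x - c)) < 4 * \<alpha>\<^sup>2 * ((1 + (norm (P x))\<^sup>2) * (norm (x - c))\<^sup>2 - ((x - c) \<bullet> P x)\<^sup>2)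
        - 2 * \<alpha> * ((1 + (norm (P x))\<^sup>2) * n - (norm (P x))\<^sup>2)"
      by (simp add: algebra_simps)
    have "C * norm (gw x) = E x * (2 * \<alpha> * (C * norm (x - c)))"
      unfolding gw_def using \<alpha> E0[of x] by (simp add: abs_mult)
    also have "\<dots> < Aop (P x) (Hw x)" unfolding Aw using 6 E0 by (intro mult_strict_left_mono)
    finally show ?thesis .
  qed
  have cd: "continuous_on (cball c \<rho>) d" using D(6) U continuous_on_subset by blast
  have dnn: "0 \<le> d x" if "x \<in> cball c \<rho>" for x
    by (rule continuous_ge_on_closure[of "ball c \<rho>" d x 0])
       (use cd \<rho> that pos in \<open>auto simp: closure_ball less_imp_le\<close>)
  obtain x1 where x1: "x1 \<in> cball c (\<rho>/2)" "\<And>x. x \<in> cball c (\<rho>/2) \<Longrightarrow> d x1 \<le> d x"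
  proof -
    have "cball c (\<rho>/2) \<subseteq> cball c \<rho>" using \<rho> by auto
    then have "continuous_on (cball c (\<rho>/2)) d" using cd continuous_on_subset by blast
    then have "\<exists>x\<in>cball c (\<rho>/2). \<forall>y\<in>cball c (\<rho>/2). d x \<le> d y"
      using \<rho> by (intro continuous_attains_inf) auto
    then show ?thesis using that by blast
  qed
  \<comment> \<open>As \<epsilon> is the minimum of \<open>d\<close> on the half ball and
    \<open>w\<close> is at most 1, \<open>d - \<epsilon> * w\<close> is nonnegative there; on the
    outer sphere \<open>w\<close> vanishes. So a negative minimum lies in the open annulus, where
    \<open>barrier\<close> contradicts \<open>pde\<close>.\<close>
  define \<epsilon> where "\<epsilon> = d x1"
  have \<epsilon>: "\<epsilon> > 0" unfolding \<epsilon>_def using pos[of x1] x1(1) \<rho> by auto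
  define G where "G = (\<lambda>x. d x - \<epsilon> * w x)"
  have G2: "C2 U G (\<lambda>x. g x - \<epsilon> *\<^sub>R gw x) (\<lambda>x h. H x h - \<epsilon> *\<^sub>R Hw x h)"
  proof -
    have "C2 U (\<lambda>x. \<epsilon> * w x) (\<lambda>x. \<epsilon> *\<^sub>R gw x) (\<lambda>x h. \<epsilon> *\<^sub>R Hw x h)"
      using C2_subset[OF w D(1)] unfolding C2_def
      by (auto intro!: derivative_eq_intros continuous_intros)
    then show ?thesis unfolding G_def by (intro C2_diff[OF d])
  qed
  have wle: "w x \<le> 1" for x
    unfolding w_def E_def using \<alpha> by (smt (verit) exp_gt_zero exp_le_one_iff inner_ge_zero mult_minus_left mult_nonneg_nonneg)
  have Gnn: "0 \<le> G x" if xx: "x \<in> cball c \<rho>" for x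
  proof -
    have "continuous_on (cball c \<rho>) G" using C2_D(6)[OF G2] U continuous_on_subset by blast
    then have "\<exists>x\<in>cball c \<rho>. \<forall>y\<in>cball c \<rho>. G x \<le> G y"
      using \<rho> by (intro continuous_attains_inf) auto
    then obtain x0 where x0: "x0 \<in> cball c \<rho>" "\<And>y. y \<in> cball c \<rho> \<Longrightarrow> G x0 \<le> G y" by blast
    have "0 \<le> G x0"
    proof (rule ccontr)
      assume neg: "\<not> 0 \<le> G x0"
      have a: "\<rho>/2 < norm (x0 - c)"
      proof (rule ccontr)
        assume "\<not> \<rho>/2 < norm (x0 - c)"
        then have "\<epsilon> \<le> d x0" unfolding \<epsilon>_def by (intro x1(2)) (simp add: dist_norm norm_minus_commute)
        moreover have "\<epsilon> * w x0 \<le> \<epsilon>" using wle[of x0] \<epsilon> by (simp add: mult_left_le)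
        ultimately show False using neg unfolding G_def by linarith
      qed
      have b: "x0 \<in> ball c \<rho>"
      proof (rule ccontr)
        assume "x0 \<notin> ball c \<rho>"
        then have "norm (x0 - c) = \<rho>" using x0(1) by (simp add: dist_norm norm_minus_commute)
        then have "w x0 = 0" unfolding w_def E_def by (simp add: dot_square_norm)
        then show False using neg dnn[OF x0(1)] unfolding G_def by simp
      qed
      have bU: "ball c \<rho> \<subseteq> U" "x0 \<in> U" using U b by (auto simp: subset_iff)
      have m: "G x0 \<le> G y" if "y \<in> ball c \<rho>" for y using x0(2) that by simp
      note lm = C2_local_min[OF G2 bU(2) bU(1) open_ball b m]
      have g0: "g x0 = \<epsilon> *\<^sub>R gw x0" using lm(1) by simp
      have "linear (\<lambda>h. H x0 h - \<epsilon> *\<^sub>R Hw x0 h)" using C2_D(5)[OF G2 bU(2)] .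
      then have "0 \<le> Aop (P x0) (\<lambda>h. H x0 h - \<epsilon> *\<^sub>R Hw x0 h)" using lm(2) by (rule Aop_nonneg)
      then have "\<epsilon> * Aop (P x0) (Hw x0) \<le> Aop (P x0) (H x0)" by (simp add: Aop_diff_scale)
      also have "\<dots> \<le> C * norm (g x0)" by (rule pde[OF b])
      also have "\<dots> = \<epsilon> * (C * norm (gw x0))" using \<epsilon> by (simp add: g0)
      also have "\<dots> < \<epsilon> * Aop (P x0) (Hw x0)" using barrier[OF b] a \<epsilon> by (intro mult_strict_left_mono) auto
      finally show False by simp
    qed
    then show ?thesis using x0(2)[OF xx] by linarith
  qed
  have nq: "norm (q - c) = \<rho>" using q by (simp add: dist_norm norm_minus_commute)
  have qU: "q \<in> U" using U q by (auto simp: subset_iff)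
  have wq: "w q = 0" unfolding w_def E_def using nq by (simp add: dot_square_norm)
  \<comment> \<open>\<open>G\<close> vanishes at \<open>q\<close> and is nonnegative on the ball, so
    its derivative towards the centre is nonnegative; the barrier contributes a strictly positive
    derivative.\<close>
  have "((\<lambda>t. G (q + t *\<^sub>R (c - q))) has_real_derivative (g q - \<epsilon> *\<^sub>R gw q) \<bullet> (c - q)) (at 0)"
    by (rule DERIV_along_line) (use C2_D(2)[OF G2 qU] in simp)
  moreover have "\<not> (g q - \<epsilon> *\<^sub>R gw q) \<bullet> (c - q) < 0"
  proof
    assume "(g q - \<epsilon> *\<^sub>R gw q) \<bullet> (c - q) < 0"
    from DERIV_neg_dec_right[OF calculation this] obtain s where s: "s > 0"
      "\<And>h. 0 < h \<Longrightarrow> h < s \<Longrightarrow> G (q + h *\<^sub>R (c - q)) < G q" by auto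
    define h where "h = min (s/2) 1"
    have h: "0 < h" "h < s" "h \<le> 1" using s unfolding h_def by auto
    have "c - (q + h *\<^sub>R (c - q)) = (1 - h) *\<^sub>R (c - q)" by (simp add: algebra_simps)
    then have "dist c (q + h *\<^sub>R (c - q)) = (1 - h) * \<rho>"
      using h nq by (simp add: dist_norm norm_minus_commute)
    also have "\<dots> \<le> \<rho>" using h \<rho> by (simp add: mult_left_le_one_le)
    finally have "0 \<le> G (q + h *\<^sub>R (c - q))" by (intro Gnn) simp
    with s(2)[OF h(1,2)] show False using wq q(2) unfolding G_def by simp
  qed
  ultimately have "\<epsilon> * (gw q \<bullet> (c - q)) \<le> g q \<bullet> (c - q)" by (simp add: inner_diff_left)
  moreover have "gw q \<bullet> (c - q) = 2 * \<alpha> * E q * \<rho>\<^sup>2"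
  proof -
    have "gw q \<bullet> (c - q) = 2 * \<alpha> * E q * ((q - c) \<bullet> (q - c))"
      unfolding gw_def by (simp add: inner_diff_left inner_diff_right algebra_simps)
    then show ?thesis by (simp add: dot_square_norm nq)
  qed
  moreover have "\<epsilon> * (2 * \<alpha> * E q * \<rho>\<^sup>2) > 0" using \<epsilon> \<alpha> E0[of q] \<rho> by simp
  ultimately show ?thesis by (metis order_less_le_trans)
qed

text \<open>If the zero set were not open, a largest zero-free ball around a nearby point would
  touch it at some \<open>q\<close>. Hopf's lemma makes the gradient at \<open>q\<close> nonzero,
  although \<open>q\<close> is an interior minimum. Connectedness of the ball does the rest.\<close>

lemma strong_maximum_principle:
  fixes c x0 :: "'a::euclidean_space"
  assumes d: "C2 U d g H" and U: "ball c R \<subseteq> U"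
    and nn: "\<And>x. x \<in> ball c R \<Longrightarrow> 0 \<le> d x"
    and pde: "\<And>x. x \<in> ball c R \<Longrightarrow> Aop (P x) (H x) \<le> C * norm (g x)"
    and P: "\<And>x. x \<in> ball c R \<Longrightarrow> norm (P x) \<le> \<Lambda>"
    and C: "C \<ge> 0" and x0: "x0 \<in> ball c R" "d x0 = 0" and x: "x \<in> ball c R"
  shows "d x = 0"
proof -
  define Z where "Z = {x \<in> ball c R. d x = 0}"
  have cd: "continuous_on (ball c R) d" using C2_D(6)[OF d] U continuous_on_subset by blast
  have "openin (top_of_set (ball c R)) Z"
  proof -
    have "\<exists>r>0. ball z r \<subseteq> Z" if z: "z \<in> Z" for z
    proof -
      have zb: "z \<in> ball c R" using z Z_def by simp
      then obtain r3 where r3: "r3 > 0" "ball z r3 \<subseteq> ball c R"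
        by (meson open_ball openE)
      \<comment> \<open>The touching ball has its centre within \<open>r\<close> of \<open>z\<close>
        and radius at most \<open>r\<close>; a third of the available radius keeps it inside
        \<open>ball c R\<close>.\<close>
      define r where "r = r3 / 3"
      have r: "r > 0" "3 * r = r3" using r3 by (auto simp: r_def)
      have "d y = 0" if y: "y \<in> ball z r" for y
      proof (rule ccontr)
        assume dy: "d y \<noteq> 0"
        have cb: "cball y r \<subseteq> ball z r3"
        proof
          fix t assume "t \<in> cball y r"
          then show "t \<in> ball z r3" using y r dist_triangle[of z t y] by (simp add: dist_commute)
        qed
        define K where "K = cball y r \<inter> {t. d t = 0}"
        have K': "K = {t \<in> cball y r. d t = 0}" unfolding K_def by auto
        have sub: "cball y r \<subseteq> ball c R" using cb r3 by blast
        then have "continuous_on (cball y r) d" using cd continuous_on_subset by blast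
        then have "closed K" unfolding K' by (intro continuous_closed_preimage_constant) auto
        then have "compact K" unfolding K' using compact_Int_closed[OF compact_cball, of K y r]
          by (metis (no_types, lifting) Int_absorb1 K' mem_Collect_eq subsetI)
        moreover have zK: "z \<in> K" unfolding K_def using y z Z_def by (auto simp: dist_commute)
        ultimately have "\<exists>q\<in>K. \<forall>t\<in>K. dist y q \<le> dist y t"
          by (intro continuous_attains_inf) (auto intro!: continuous_intros)
        then obtain q where q: "q \<in> K" "\<And>t. t \<in> K \<Longrightarrow> dist y q \<le> dist y t" by blast
        define \<rho> where "\<rho> = dist y q"
        have \<rho>: "\<rho> > 0" using q(1) dy unfolding \<rho>_def K_def by auto
        have \<rho>r: "\<rho> \<le> r" using q(1) unfolding \<rho>_def K_def by auto
        have sub2: "cball y \<rho> \<subseteq> ball c R" using sub \<rho>r by (auto simp: subset_iff)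
        have qb: "q \<in> ball c R" using sub2 unfolding \<rho>_def by auto
        have "0 < g q \<bullet> (y - q)"
        proof (rule hopf_boundary_point[OF d _ \<rho> _ _ _ _ _ C, where P=P and \<Lambda>=\<Lambda>])
          show "cball y \<rho> \<subseteq> U" using sub2 U by blast
          show "d q = 0" using q K_def by auto
          fix t assume t: "t \<in> ball y \<rho>"
          then have tb: "t \<in> ball c R" using sub2 by (meson ball_subset_cball in_mono)
          show "Aop (P t) (H t) \<le> C * norm (g t)" "norm (P t) \<le> \<Lambda>" using pde P tb by auto
          have "t \<notin> K" using q(2)[of t] t unfolding \<rho>_def by auto
          moreover have "t \<in> cball y r" using t \<rho>r by auto
          ultimately have "d t \<noteq> 0" unfolding K_def by auto
          then show "0 < d t" using nn[OF tb] by simp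
        qed (simp add: \<rho>_def)
        moreover have "g q = 0"
          by (rule C2_local_min(1)[OF d _ U open_ball qb]) (use U qb nn q(1) K_def in auto)
        ultimately show False by simp
      qed
      moreover have "ball z r \<subseteq> ball c R" using r3 r by auto
      ultimately show ?thesis using r(1) unfolding Z_def by blast
    qed
    then have "open Z" using open_contains_ball by blast
    then show ?thesis unfolding Z_def by (metis (no_types, lifting) mem_Collect_eq openin_open_eq open_ball subsetI)
  qed
  moreover have "closedin (top_of_set (ball c R)) Z"
    unfolding Z_def using continuous_closedin_preimage_constant[OF cd] by auto
  ultimately have "Z = {} \<or> Z = ball c R" using connected_clopen[of "ball c R"] by auto
  then show ?thesis using x0 x unfolding Z_def by blast
qed

text \<open>Freezing the second order coefficients at \<open>p2\<close> leaves differences that are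
  Lipschitz in the gradient. The equation does not contain the unknown function itself, so no zeroth
  order term appears and the maximum principles apply to the difference of two solutions. The
  summands of the constant come from \<open>Ntr\<close>, \<open>LL\<close> and the two parts of
  \<open>B\<close>, in this order.\<close>

lemma Qop_difference_bound:
  fixes p1 p2 :: "'a::euclidean_space"
  assumes l: "linear L1" and L1: "\<And>h. norm (L1 h) \<le> \<Lambda> * norm h" and p: "norm p1 \<le> \<Lambda>" "norm p2 \<le> \<Lambda>"
    and v: "norm v = 1" and e: "norm e = 1" and Q: "Qop v e p1 L1 = 0" "Qop v e p2 L2 = 0"
  shows "Aop p2 (\<lambda>h. L2 h - L1 h) \<le> (2 * \<Lambda>\<^sup>2 * real DIM('a) + 2 * \<Lambda>\<^sup>2 + 2 * \<Lambda> * (1 + \<Lambda>) + (1 + \<Lambda>\<^sup>2)) * norm (p2 - p1)"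
proof -
  define \<delta> where "\<delta> = norm (p2 - p1)"
  define N where "N = (norm p2)\<^sup>2 - (norm p1)\<^sup>2"
  have \<Lambda>: "\<Lambda> \<ge> 0" using p(1) norm_ge_zero order_trans by blast
  have \<delta>: "\<delta> \<ge> 0" unfolding \<delta>_def by simp
  have N: "\<bar>N\<bar> \<le> 2 * \<Lambda> * \<delta>"
  proof -
    have "N = (p2 - p1) \<bullet> (p2 + p1)"
      unfolding N_def by (simp add: power2_norm_eq_inner inner_diff_left inner_diff_right inner_add_right inner_commute[of p1 p2])
    also have "\<bar>\<dots>\<bar> \<le> \<delta> * norm (p2 + p1)" unfolding \<delta>_def by (rule Cauchy_Schwarz_ineq2)
    also have "\<dots> \<le> \<delta> * (\<Lambda> + \<Lambda>)" using p norm_triangle_ineq[of p2 p1] \<delta> by (intro mult_left_mono) auto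
    finally show ?thesis by (simp add: algebra_simps)
  qed
  have tr: "\<bar>tr L1\<bar> \<le> real DIM('a) * \<Lambda>"
  proof -
    have "\<bar>tr L1\<bar> \<le> (\<Sum>i\<in>Basis. \<bar>L1 i \<bullet> i\<bar>)" unfolding tr_def by (rule sum_abs)
    also have "\<dots> \<le> (\<Sum>i\<in>(Basis::'a set). \<Lambda>)"
    proof (intro sum_mono)
      fix i :: 'a assume i: "i \<in> Basis"
      have "\<bar>L1 i \<bullet> i\<bar> \<le> norm (L1 i) * norm i" by (rule Cauchy_Schwarz_ineq2)
      also have "\<dots> \<le> \<Lambda>" using L1[of i] i by simp
      finally show "\<bar>L1 i \<bullet> i\<bar> \<le> \<Lambda>" .
    qed
    finally show ?thesis by simp
  qed
  have Ntr: "\<bar>N * tr L1\<bar> \<le> 2 * \<Lambda>\<^sup>2 * real DIM('a) * \<delta>"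
  proof -
    have "\<bar>N * tr L1\<bar> \<le> (2 * \<Lambda> * \<delta>) * (real DIM('a) * \<Lambda>)"
      unfolding abs_mult using N tr \<Lambda> \<delta> by (intro mult_mono) auto
    then show ?thesis by (simp add: power2_eq_square mult_ac)
  qed
  have LL: "\<bar>L1 p2 \<bullet> p2 - L1 p1 \<bullet> p1\<bar> \<le> 2 * \<Lambda>\<^sup>2 * \<delta>"
  proof -
    have "L1 p2 \<bullet> p2 - L1 p1 \<bullet> p1 = L1 (p2 - p1) \<bullet> p2 + L1 p1 \<bullet> (p2 - p1)"
      by (simp add: linear_diff[OF l] inner_diff_left inner_diff_right)
    moreover have "\<bar>L1 (p2 - p1) \<bullet> p2\<bar> \<le> (\<Lambda> * \<delta>) * \<Lambda>"
    proof -
      have "\<bar>L1 (p2 - p1) \<bullet> p2\<bar> \<le> norm (L1 (p2 - p1)) * norm p2" by (rule Cauchy_Schwarz_ineq2)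
      also have "\<dots> \<le> (\<Lambda> * \<delta>) * \<Lambda>" using L1[of "p2 - p1"] p \<Lambda> \<delta> unfolding \<delta>_def by (intro mult_mono) auto
      finally show ?thesis .
    qed
    moreover have "\<bar>L1 p1 \<bullet> (p2 - p1)\<bar> \<le> (\<Lambda> * \<Lambda>) * \<delta>"
    proof -
      have "\<bar>L1 p1 \<bullet> (p2 - p1)\<bar> \<le> norm (L1 p1) * \<delta>" unfolding \<delta>_def by (rule Cauchy_Schwarz_ineq2)
      also have "norm (L1 p1) \<le> \<Lambda> * \<Lambda>" using L1[of p1] p(1) \<Lambda> by (meson mult_left_mono order_trans)
      finally show ?thesis using \<delta> by (simp add: mult_right_mono)
    qed
    ultimately show ?thesis by (simp add: power2_eq_square abs_le_iff algebra_simps)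
  qed
  have B: "(1 + (norm p2)\<^sup>2) * (v \<bullet> (e - p2)) - (1 + (norm p1)\<^sup>2) * (v \<bullet> (e - p1)) \<le> (2 * \<Lambda> * (1 + \<Lambda>) + (1 + \<Lambda>\<^sup>2)) * \<delta>"
  proof -
    have "(1 + (norm p2)\<^sup>2) * (v \<bullet> (e - p2)) - (1 + (norm p1)\<^sup>2) * (v \<bullet> (e - p1))
        = N * (v \<bullet> (e - p2)) + (1 + (norm p1)\<^sup>2) * (v \<bullet> (p1 - p2))"
      unfolding N_def by (simp add: inner_diff_right algebra_simps)
    moreover have "N * (v \<bullet> (e - p2)) \<le> (2 * \<Lambda> * \<delta>) * (1 + \<Lambda>)"
    proof -
      have "\<bar>v \<bullet> (e - p2)\<bar> \<le> norm v * norm (e - p2)" by (rule Cauchy_Schwarz_ineq2)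
      also have "\<dots> \<le> 1 + \<Lambda>" using v e p norm_triangle_ineq4[of e p2] by simp
      finally have "\<bar>N\<bar> * \<bar>v \<bullet> (e - p2)\<bar> \<le> (2 * \<Lambda> * \<delta>) * (1 + \<Lambda>)"
        using N \<Lambda> \<delta> by (intro mult_mono) auto
      then show ?thesis by (metis abs_ge_self abs_mult order_trans)
    qed
    moreover have "(1 + (norm p1)\<^sup>2) * (v \<bullet> (p1 - p2)) \<le> (1 + \<Lambda>\<^sup>2) * \<delta>"
    proof -
      have "\<bar>v \<bullet> (p1 - p2)\<bar> \<le> norm v * norm (p1 - p2)" by (rule Cauchy_Schwarz_ineq2)
      then have 1: "v \<bullet> (p1 - p2) \<le> \<delta>" using v unfolding \<delta>_def by (simp add: norm_minus_commute)
      have "(norm p1)\<^sup>2 \<le> \<Lambda>\<^sup>2" using p by (intro power_mono) auto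
      then have "(1 + (norm p1)\<^sup>2) * \<delta> \<le> (1 + \<Lambda>\<^sup>2) * \<delta>" using \<delta> by (intro mult_right_mono) auto
      moreover have "(1 + (norm p1)\<^sup>2) * (v \<bullet> (p1 - p2)) \<le> (1 + (norm p1)\<^sup>2) * \<delta>"
        using 1 by (intro mult_left_mono) (auto intro: add_nonneg_nonneg)
      ultimately show ?thesis by linarith
    qed
    ultimately show ?thesis by (simp add: algebra_simps)
  qed
  have "Aop p2 (\<lambda>h. L2 h - L1 h) = Aop p2 L2 - Aop p2 L1"
    using Aop_diff_scale[of p2 L2 1 L1] by simp
  also have "Aop p2 L1 = Aop p1 L1 + N * tr L1 - (L1 p2 \<bullet> p2 - L1 p1 \<bullet> p1)"
    unfolding Aop_def N_def by (simp add: algebra_simps)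
  finally have "Aop p2 (\<lambda>h. L2 h - L1 h) = ((1 + (norm p2)\<^sup>2) * (v \<bullet> (e - p2)) - (1 + (norm p1)\<^sup>2) * (v \<bullet> (e - p1)))
      - N * tr L1 + (L1 p2 \<bullet> p2 - L1 p1 \<bullet> p1)"
    using Q unfolding Qop_def by linarith
  also have "\<dots> \<le> (2 * \<Lambda> * (1 + \<Lambda>) + (1 + \<Lambda>\<^sup>2)) * \<delta> + 2 * \<Lambda>\<^sup>2 * real DIM('a) * \<delta> + 2 * \<Lambda>\<^sup>2 * \<delta>"
    using B Ntr LL by linarith
  finally show ?thesis unfolding \<delta>_def[symmetric] by (simp add: algebra_simps)
qed

definition ordered_solutions where
  "ordered_solutions v e c \<rho> u1 p1 H1 u2 p2 H2 \<longleftrightarrow>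
    (\<forall>y\<in>ball c \<rho>. Qop v e (p1 y) (H1 y) = 0 \<and> Qop v e (p2 y) (H2 y) = 0 \<and> u1 y \<le> u2 y)"

text \<open>The outcomes of the strong maximum principle and of Hopf's lemma at a contact point on
  the bounding sphere; \<open>p1\<close> and \<open>p2\<close> stand for the gradients.\<close>

definition contact_alternative :: "'a::euclidean_space \<Rightarrow> real \<Rightarrow> ('a \<Rightarrow> real) \<Rightarrow> ('a \<Rightarrow> 'a) \<Rightarrow> ('a \<Rightarrow> real) \<Rightarrow> ('a \<Rightarrow> 'a) \<Rightarrow> bool" where
  "contact_alternative c \<rho> u1 p1 u2 p2 \<longleftrightarrow> (\<forall>y\<in>ball c \<rho>. u1 y = u2 y) \<or>
    (\<forall>y\<in>ball c \<rho>. u1 y < u2 y) \<and> (\<forall>q. dist c q = \<rho> \<longrightarrow> u1 q = u2 q \<longrightarrow> 0 < (p2 q - p1 q) \<bullet> (c - q))"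

text \<open>The constants depend only on bounds near \<open>x\<close>, so one \<open>R\<close>
  serves all balls inside \<open>ball x R\<close>. This uniformity is needed when balls touching the
  boundary at varying points are used.\<close>

lemma translator_comparison:
  fixes x :: "'a::euclidean_space"
  assumes u1: "C2 U u1 p1 H1" and u2: "C2 U u2 p2 H2" and x: "x \<in> U" and v: "norm v = 1" and e: "norm e = 1"
  obtains R where "R > 0" "ball x R \<subseteq> U"
    "\<forall>c \<rho>. 0 < \<rho> \<and> cball c \<rho> \<subseteq> ball x R \<and> ordered_solutions v e c \<rho> u1 p1 H1 u2 p2 H2
      \<longrightarrow> contact_alternative c \<rho> u1 p1 u2 p2"
proof -
  obtain r1 L1 where 1: "r1 > 0" "L1 > 0" "cball x r1 \<subseteq> U"
    "\<And>z h. z \<in> cball x r1 \<Longrightarrow> norm (H1 z h) \<le> L1 * norm h" "\<And>z. z \<in> cball x r1 \<Longrightarrow> norm (p1 z) \<le> L1"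
    using C2_locally_bounded[OF u1 x] by metis
  obtain r2 L2 where 2: "r2 > 0" "L2 > 0" "cball x r2 \<subseteq> U"
    "\<And>z h. z \<in> cball x r2 \<Longrightarrow> norm (H2 z h) \<le> L2 * norm h" "\<And>z. z \<in> cball x r2 \<Longrightarrow> norm (p2 z) \<le> L2"
    using C2_locally_bounded[OF u2 x] by metis
  define R where "R = min r1 r2"
  define \<Lambda> where "\<Lambda> = L1 + L2"
  define C where "C = 2 * \<Lambda>\<^sup>2 * real DIM('a) + 2 * \<Lambda>\<^sup>2 + 2 * \<Lambda> * (1 + \<Lambda>) + (1 + \<Lambda>\<^sup>2)"
  have C: "C \<ge> 0" unfolding C_def \<Lambda>_def using 1(2) 2(2) by (intro add_nonneg_nonneg mult_nonneg_nonneg) auto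
  have d: "C2 U (\<lambda>x. u2 x - u1 x) (\<lambda>x. p2 x - p1 x) (\<lambda>x h. H2 x h - H1 x h)" by (rule C2_diff[OF u2 u1])
  have pde: "Aop (p2 y) (\<lambda>h. H2 y h - H1 y h) \<le> C * norm (p2 y - p1 y)" "norm (p2 y) \<le> \<Lambda>"
    if y: "y \<in> ball x R" and Q: "Qop v e (p1 y) (H1 y) = 0" "Qop v e (p2 y) (H2 y) = 0" for y
  proof -
    have yb: "y \<in> cball x r1" "y \<in> cball x r2" using y R_def by auto
    have yU: "y \<in> U" using yb 1(3) by blast
    show n2: "norm (p2 y) \<le> \<Lambda>" using 2(5)[OF yb(2)] 1(2) unfolding \<Lambda>_def by linarith
    have n1: "norm (p1 y) \<le> \<Lambda>" using 1(5)[OF yb(1)] 2(2) unfolding \<Lambda>_def by linarith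
    have h: "norm (H1 y h) \<le> \<Lambda> * norm h" for h
    proof -
      have "L1 * norm h \<le> \<Lambda> * norm h" unfolding \<Lambda>_def using 2(2) by (intro mult_right_mono) auto
      then show ?thesis using 1(4)[OF yb(1), of h] by linarith
    qed
    show "Aop (p2 y) (\<lambda>h. H2 y h - H1 y h) \<le> C * norm (p2 y - p1 y)"
      unfolding C_def by (rule Qop_difference_bound[OF C2_D(5)[OF u1 yU] h n1 n2 v e Q])
  qed
  show ?thesis
  proof (rule that)
    show "R > 0" using 1(1) 2(1) R_def by simp
    show RU: "ball x R \<subseteq> U" using 1(3) R_def by (auto simp: subset_iff)
    have main: "contact_alternative c \<rho> u1 p1 u2 p2"
      if \<rho>: "\<rho> > 0" and cb: "cball c \<rho> \<subseteq> ball x R"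
      and Q1: "\<And>y. y \<in> ball c \<rho> \<Longrightarrow> Qop v e (p1 y) (H1 y) = 0"
      and Q2: "\<And>y. y \<in> ball c \<rho> \<Longrightarrow> Qop v e (p2 y) (H2 y) = 0"
      and le: "\<And>y. y \<in> ball c \<rho> \<Longrightarrow> u1 y \<le> u2 y" for c \<rho>
    proof -
    have bb: "y \<in> ball x R" if "y \<in> ball c \<rho>" for y using that cb by (meson ball_subset_cball in_mono)
    have pd: "Aop (p2 y) (\<lambda>h. H2 y h - H1 y h) \<le> C * norm (p2 y - p1 y)" "norm (p2 y) \<le> \<Lambda>"
      if "y \<in> ball c \<rho>" for y using pde[OF bb[OF that] Q1[OF that] Q2[OF that]] by auto
    show ?thesis
    proof (cases "\<exists>y\<in>ball c \<rho>. u1 y = u2 y")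
      case True
      then obtain y0 where y0: "y0 \<in> ball c \<rho>" "u2 y0 - u1 y0 = 0" by auto
      have "u2 y - u1 y = 0" if "y \<in> ball c \<rho>" for y
        by (rule strong_maximum_principle[OF d _ _ pd C y0 that])
           (use le bb RU in \<open>auto simp: subset_iff\<close>)
      then show ?thesis unfolding contact_alternative_def by auto
    next
      case False
      then have lt: "u1 y < u2 y" if "y \<in> ball c \<rho>" for y using le[OF that] that by force
      have "0 < (p2 q - p1 q) \<bullet> (c - q)" if "dist c q = \<rho>" "u1 q = u2 q" for q
        by (rule hopf_boundary_point[OF d _ \<rho> that(1) _ _ pd C])
           (use lt that(2) cb RU in \<open>auto simp: subset_iff\<close>)
      then show ?thesis using lt unfolding contact_alternative_def by auto
    qed
    qed
    then show "\<forall>c \<rho>. 0 < \<rho> \<and> cball c \<rho> \<subseteq> ball x R \<and> ordered_solutions v e c \<rho> u1 p1 H1 u2 p2 H2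
      \<longrightarrow> contact_alternative c \<rho> u1 p1 u2 p2"
      unfolding ordered_solutions_def by blast
  qed
qed

section \<open>The translator equation for graphs and level sets\<close>

text \<open>Together with functions constant along \<open>e\<close>, this allows open sets and
  derivatives of the ambient space in place of those of the hyperplane. Points of the graph are
  their own lifts.\<close>

definition lift :: "'a::euclidean_space \<Rightarrow> ('a \<Rightarrow> real) \<Rightarrow> 'a \<Rightarrow> 'a" where
  "lift e u z = z - (z \<bullet> e) *\<^sub>R e + u z *\<^sub>R e"

definition cylindrical :: "'a::euclidean_space \<Rightarrow> 'a set \<Rightarrow> ('a \<Rightarrow> real) \<Rightarrow> bool" where
  "cylindrical e D u \<longleftrightarrow> (\<forall>z\<in>D. \<forall>t. z + t *\<^sub>R e \<in> D \<and> u (z + t *\<^sub>R e) = u z)"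

text \<open>For a level set with gradient g and Hessian L this is |g|^3 (div (g / |g|) + v . g /
  |g|), so its vanishing on the level set is the translator equation.\<close>

definition Eop :: "'a::euclidean_space \<Rightarrow> 'a \<Rightarrow> ('a \<Rightarrow> 'a) \<Rightarrow> real" where
  "Eop v g L = (norm g)\<^sup>2 * tr L - L g \<bullet> g + (norm g)\<^sup>2 * (v \<bullet> g)"

lemma lift_inner: "norm e = 1 \<Longrightarrow> lift e u z \<bullet> e = u z"
  by (simp add: lift_def inner_add_left inner_diff_left dot_square_norm)

lemma lift_self: "z \<bullet> e = u z \<Longrightarrow> lift e u z = z"
  by (simp add: lift_def)

lemma lift_shift:
  assumes "cylindrical e D u" "norm e = 1" "z \<in> D"
  shows "lift e u (z + t *\<^sub>R e) = lift e u z"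
  using assms by (simp add: lift_def cylindrical_def inner_add_left dot_square_norm algebra_simps)

lemma cylindrical_lift:
  assumes "cylindrical e D u" "z \<in> D"
  shows "lift e u z \<in> D" "u (lift e u z) = u z"
proof -
  have "lift e u z = z + (u z - z \<bullet> e) *\<^sub>R e" by (simp add: lift_def algebra_simps)
  then show "lift e u z \<in> D" "u (lift e u z) = u z" using assms unfolding cylindrical_def by metis+
qed

text \<open>Invariance of \<open>u\<close> along \<open>e\<close> is differentiated, and then the
  resulting invariance of \<open>p\<close>; the last claim differentiates
  \<open>p y \<bullet> e = 0\<close>.\<close>

lemma cylindrical_C2:
  assumes u: "C2 D u p H" and c: "cylindrical e D u" and z: "z \<in> D"
  shows "p z \<bullet> e = 0" "p (z + t *\<^sub>R e) = p z" "H (z + t *\<^sub>R e) = H z" "H z e = 0" "H z h \<bullet> e = 0"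
proof -
  note C = C2_D[OF u]
  have cD: "z + t *\<^sub>R e \<in> D" "u (z + t *\<^sub>R e) = u z" if "z \<in> D" for z t
    using c that unfolding cylindrical_def by auto
  have pe: "p z \<bullet> e = 0" if z: "z \<in> D" for z
  proof -
    have "((\<lambda>t. u (z + t *\<^sub>R e)) has_real_derivative p z \<bullet> e) (at 0)"
      by (rule DERIV_along_line) (use C(2)[OF z] in simp)
    moreover have "(\<lambda>t. u (z + t *\<^sub>R e)) = (\<lambda>t. u z)" using cD z by auto
    ultimately show ?thesis by (metis DERIV_const DERIV_unique)
  qed
  show "p z \<bullet> e = 0" by (rule pe[OF z])
  have pt: "p (z + t *\<^sub>R e) = p z" if z: "z \<in> D" for z t
  proof -
    have "((\<lambda>y. u (y + t *\<^sub>R e)) has_derivative (\<lambda>h. p (z + t *\<^sub>R e) \<bullet> h)) (at z)"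
      by (rule has_derivative_compose[of "\<lambda>y. y + t *\<^sub>R e" "\<lambda>h. h", OF _ C(2)[OF cD(1)[OF z]]])
         (auto intro!: derivative_eq_intros)
    then have "(u has_derivative (\<lambda>h. p (z + t *\<^sub>R e) \<bullet> h)) (at z)"
      by (rule has_derivative_transform_within_open[OF _ C(1) z]) (use cD in auto)
    then show ?thesis using C(2)[OF z] has_derivative_grad by metis
  qed
  show "p (z + t *\<^sub>R e) = p z" by (rule pt[OF z])
  have "((\<lambda>y. p (y + t *\<^sub>R e)) has_derivative H (z + t *\<^sub>R e)) (at z)"
    by (rule has_derivative_compose[of "\<lambda>y. y + t *\<^sub>R e" "\<lambda>h. h", OF _ C(3)[OF cD(1)[OF z]]])
       (auto intro!: derivative_eq_intros)
  then have "(p has_derivative H (z + t *\<^sub>R e)) (at z)"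
    by (rule has_derivative_transform_within_open[OF _ C(1) z]) (use pt in auto)
  then show "H (z + t *\<^sub>R e) = H z" using C(3)[OF z] has_derivative_unique by blast
  have "((\<lambda>t. p (z + t *\<^sub>R e)) has_derivative (\<lambda>s. H z (s *\<^sub>R e))) (at 0)"
    by (rule has_derivative_compose[of "\<lambda>t. z + t *\<^sub>R e" "\<lambda>s. s *\<^sub>R e" 0, where g=p])
       (use C(3)[OF z] in \<open>auto intro!: derivative_eq_intros\<close>)
  moreover have "(\<lambda>t. p (z + t *\<^sub>R e)) = (\<lambda>t. p z)" using pt[OF z] by auto
  ultimately have "(\<lambda>s. H z (s *\<^sub>R e)) = (\<lambda>s. 0)"
    using has_derivative_unique[of "\<lambda>t. p z" _ "0::real" "\<lambda>s. 0"] by auto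
  then have "H z (1 *\<^sub>R e) = 0" by metis
  then show "H z e = 0" by simp
  have "((\<lambda>y. p y \<bullet> e) has_derivative (\<lambda>h. H z h \<bullet> e)) (at z)"
    using C(3)[OF z] by (auto intro!: derivative_eq_intros)
  moreover have "((\<lambda>y. p y \<bullet> e) has_derivative (\<lambda>h. 0)) (at z)"
    by (rule has_derivative_transform_within_open[OF has_derivative_const[of 0] C(1) z]) (use pe in auto)
  ultimately have "(\<lambda>h. H z h \<bullet> e) = (\<lambda>h. 0)" by (rule has_derivative_unique)
  then show "H z h \<bullet> e = 0" by metis
qed

lemma has_derivative_lift:
  assumes "(u has_derivative (\<lambda>h. p \<bullet> h)) (at z)"
  shows "(lift e u has_derivative (\<lambda>h. h - (h \<bullet> e) *\<^sub>R e + (p \<bullet> h) *\<^sub>R e)) (at z)"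
  unfolding lift_def[abs_def] using assms by (auto intro!: derivative_eq_intros)

lemma continuous_on_lift: "C2 D u p H \<Longrightarrow> continuous_on D (lift e u)"
  unfolding lift_def[abs_def] using C2_D(6) by (intro continuous_intros) blast

text \<open>Comparing two charts through one level set function, this shows that the translator equation
  does not depend on the chart.\<close>

lemma Eop_eq_Qop:
  fixes e :: "'a::euclidean_space"
  assumes u: "C2 D u p Hu" and c: "cylindrical e D u" and e: "norm e = 1" and z: "z \<in> D"
    and F: "C2 B F g H" and zB: "lift e u z \<in> B" and W: "open W" "z \<in> W"
    and zero: "\<And>y. y \<in> W \<Longrightarrow> y \<in> D \<Longrightarrow> lift e u y \<in> B \<Longrightarrow> F (lift e u y) = 0"
    and g0: "g (lift e u z) \<noteq> 0"
  shows "g (lift e u z) \<bullet> e \<noteq> 0" "g (lift e u z) = (g (lift e u z) \<bullet> e) *\<^sub>R (e - p z)"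
    "Eop v (g (lift e u z)) (H (lift e u z)) = - ((g (lift e u z) \<bullet> e)^3 * Qop v e (p z) (Hu z))"
proof -
  note Cu = C2_D[OF u] and CF = C2_D[OF F] and cy = cylindrical_C2[OF u c]
  have ee: "e \<bullet> e = 1" using e by (simp add: dot_square_norm)
  define V where "V = W \<inter> (D \<inter> lift e u -` B)"
  have oV: "open V" unfolding V_def
    by (intro open_Int W continuous_open_preimage[OF continuous_on_lift[OF u]] Cu(1) CF(1))
  have zV: "z \<in> V" unfolding V_def using W z zB by simp
  define T where "T = (\<lambda>y h. h - (h \<bullet> e) *\<^sub>R e + (p y \<bullet> h) *\<^sub>R e)"
  have lder: "(lift e u has_derivative T y) (at y)" if "y \<in> D" for y
    unfolding T_def by (rule has_derivative_lift[OF Cu(2)[OF that]])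
  \<comment> \<open>First derivative of \<open>F\<close> along the graph: \<open>T y h\<close> is
    tangent to the graph, so the gradient of \<open>F\<close> is normal to it.\<close>
  have first: "g (lift e u y) \<bullet> T y h = 0" if y: "y \<in> V" for y h
  proof -
    have yy: "y \<in> D" "lift e u y \<in> B" using y V_def by auto
    have "((\<lambda>y. F (lift e u y)) has_derivative (\<lambda>h. g (lift e u y) \<bullet> T y h)) (at y)"
      by (rule has_derivative_compose[OF lder[OF yy(1)] CF(2)[OF yy(2)]])
    moreover have "((\<lambda>y. F (lift e u y)) has_derivative (\<lambda>h. 0)) (at y)"
      by (rule has_derivative_transform_within_open[OF has_derivative_const[of 0] oV y])
         (use zero in \<open>auto simp: V_def\<close>)
    ultimately have "(\<lambda>h. g (lift e u y) \<bullet> T y h) = (\<lambda>h. 0)" by (rule has_derivative_unique)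
    then show ?thesis by metis
  qed
  define G where "G = g (lift e u z)"
  define L where "L = H (lift e u z)"
  define lam where "lam = G \<bullet> e"
  define n where "n = e - p z"
  have linL: "linear L" unfolding L_def by (rule CF(5)[OF zB])
  have linH: "linear (Hu z)" by (rule Cu(5)[OF z])
  have Gn: "G = lam *\<^sub>R n"
  proof -
    have "G \<bullet> h = (lam *\<^sub>R n) \<bullet> h" for h
      using first[OF zV, of h] unfolding G_def[symmetric] T_def n_def lam_def
      by (simp add: inner_add_right inner_diff_right inner_diff_left inner_commute algebra_simps)
    then show ?thesis by (metis inner_commute vector_eq_rdot)
  qed
  then show G': "g (lift e u z) = (g (lift e u z) \<bullet> e) *\<^sub>R (e - p z)" unfolding G_def n_def lam_def .
  have lam0: "lam \<noteq> 0" using g0 Gn unfolding G_def by auto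
  then show "g (lift e u z) \<bullet> e \<noteq> 0" unfolding lam_def G_def .
  \<comment> \<open>Second derivative: the lift bends in direction \<open>e\<close> only, so on
    tangent vectors the Hessian form of \<open>F\<close> is \<open>- lam\<close> times that of
    \<open>u\<close>.\<close>
  have second: "L (T z h) \<bullet> T z h + lam * (Hu z h \<bullet> h) = 0" for h
  proof -
    have gl: "((\<lambda>y. g (lift e u y)) has_derivative (\<lambda>k. L (T z k))) (at z)"
      unfolding L_def by (rule has_derivative_compose[OF lder[OF z] CF(3)[OF zB]])
    have Td: "((\<lambda>y. T y h) has_derivative (\<lambda>k. (Hu z k \<bullet> h) *\<^sub>R e)) (at z)"
      unfolding T_def using Cu(3)[OF z] by (auto intro!: derivative_eq_intros)
    have "((\<lambda>y. g (lift e u y) \<bullet> T y h) has_derivative (\<lambda>k. G \<bullet> ((Hu z k \<bullet> h) *\<^sub>R e) + L (T z k) \<bullet> T z h)) (at z)"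
      unfolding G_def by (rule has_derivative_inner[OF gl Td])
    moreover have "((\<lambda>y. g (lift e u y) \<bullet> T y h) has_derivative (\<lambda>k. 0)) (at z)"
      by (rule has_derivative_transform_within_open[OF has_derivative_const[of 0] oV zV])
         (use first in auto)
    ultimately have "(\<lambda>k. G \<bullet> ((Hu z k \<bullet> h) *\<^sub>R e) + L (T z k) \<bullet> T z h) = (\<lambda>k. 0)" by (rule has_derivative_unique)
    then have "G \<bullet> ((Hu z h \<bullet> h) *\<^sub>R e) + L (T z h) \<bullet> T z h = 0" by metis
    then show ?thesis unfolding lam_def by (simp add: mult.commute)
  qed
  \<comment> \<open>This combination vanishes on tangent vectors, hence its trace can be read off
    along the normal \<open>n\<close>. The Hessian of \<open>u\<close> annihilates \<open>e\<close>,
    so it sees only \<open>p z\<close> there.\<close>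
  define K where "K = (\<lambda>h. L h - (- lam) *\<^sub>R Hu z h)"
  have linK: "linear K"
    unfolding K_def by (intro linear_compose_sub linL linear_compose_scale_right linH)
  have "K h \<bullet> h = 0" if h: "h \<bullet> n = 0" for h
  proof -
    have "h \<bullet> e = p z \<bullet> h" using h unfolding n_def by (simp add: inner_diff_right inner_commute)
    then have "T z h = h" unfolding T_def by simp
    with second[of h] show ?thesis unfolding K_def by (simp add: inner_add_left)
  qed
  from tr_eq_normal_part[OF linK this] have "(norm n)\<^sup>2 * tr K = K n \<bullet> n" .
  moreover have "tr K = tr L + lam * tr (Hu z)"
    unfolding K_def tr_diff tr_scale by simp
  moreover have "K n \<bullet> n = L n \<bullet> n + lam * (Hu z n \<bullet> n)"
    unfolding K_def by (simp add: inner_add_left)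
  moreover have "Hu z n \<bullet> n = Hu z (p z) \<bullet> p z"
    unfolding n_def linear_diff[OF linH] using cy(4,5)[OF z] by (simp add: inner_diff_right)
  ultimately have eq: "(norm n)\<^sup>2 * tr L - L n \<bullet> n = - lam * ((norm n)\<^sup>2 * tr (Hu z) - Hu z (p z) \<bullet> p z)"
    by (simp add: algebra_simps)
  have nn: "(norm n)\<^sup>2 = 1 + (norm (p z))\<^sup>2"
    unfolding n_def using cy(1)[OF z] ee
    by (simp add: power2_norm_eq_inner inner_diff_left inner_diff_right inner_commute)
  have "Eop v G L = lam\<^sup>2 * ((norm n)\<^sup>2 * tr L - L n \<bullet> n) + lam^3 * ((norm n)\<^sup>2 * (v \<bullet> n))"
    unfolding Eop_def Gn linear_scale[OF linL]
    by (simp add: power_mult_distrib power2_eq_square power3_eq_cube algebra_simps)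
  also have "\<dots> = - (lam^3 * Qop v e (p z) (Hu z))"
    unfolding eq unfolding Qop_def Aop_def nn n_def[symmetric]
    by (simp add: power2_eq_square power3_eq_cube algebra_simps)
  finally show "Eop v (g (lift e u z)) (H (lift e u z)) = - ((g (lift e u z) \<bullet> e)^3 * Qop v e (p z) (Hu z))"
    unfolding G_def L_def lam_def .
qed

section \<open>Implicit functions of class C2\<close>

lemma DERIV_const_sign_imp_inj:
  fixes F :: "'a::euclidean_space \<Rightarrow> real"
  assumes F: "C2 B F g H" and B: "convex B" and pos: "\<And>z. z \<in> B \<Longrightarrow> g z \<bullet> e \<noteq> 0"
    and z: "z \<in> B" "z + t *\<^sub>R e \<in> B" and eq: "F z = F (z + t *\<^sub>R e)"
  shows "t = 0"
proof (rule ccontr)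
  assume t: "t \<noteq> 0"
  define h where "h = t *\<^sub>R e"
  have inB: "z + s *\<^sub>R h \<in> B" if "0 \<le> s" "s \<le> 1" for s
  proof -
    have "z + s *\<^sub>R h = (1 - s) *\<^sub>R z + s *\<^sub>R (z + h)" by (simp add: algebra_simps)
    then show ?thesis using convexD[OF B z(1), of "z + h" "1 - s" s] z(2) that unfolding h_def by simp
  qed
  have "((\<lambda>s. F (z + s *\<^sub>R h)) has_real_derivative g (z + s *\<^sub>R h) \<bullet> h) (at s)" if "0 \<le> s" "s \<le> 1" for s
    by (rule DERIV_along_line[OF C2_D(2)[OF F inB[OF that]]])
  then have "\<exists>s. s > 0 \<and> s < 1 \<and> F (z + 1 *\<^sub>R h) - F (z + 0 *\<^sub>R h) = (1 - 0) * (g (z + s *\<^sub>R h) \<bullet> h)"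
    by (intro MVT2) auto
  then obtain s where s: "0 < s" "s < 1" "0 = g (z + s *\<^sub>R h) \<bullet> h" using eq unfolding h_def by auto
  then show False using pos[OF inB, of s] t unfolding h_def by simp
qed

text \<open>\<open>\<Psi>\<close> replaces the \<open>e\<close> component by the value of
  \<open>F\<close> and so straightens the zero set. Strict monotonicity of \<open>F\<close> along
  \<open>e\<close> makes it injective on a ball and invariance of domain makes it open; the inverse
  supplies \<open>u\<close>. Second derivatives come from differentiating the explicit formula for
  \<open>p\<close>.\<close>

lemma graph_of_level_set:
  fixes e q :: "'a::euclidean_space"
  assumes F: "C2 (ball q R0) F g H" and R0: "R0 > 0" and Fq: "F q = 0" and e: "norm e = 1" and ge: "g q \<bullet> e \<noteq> 0"
  obtains R D u p Hu where "0 < R" "R \<le> R0" "C2 D u p Hu" "cylindrical e D u" "q \<in> D"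
    "\<And>z. z \<in> D \<Longrightarrow> lift e u z \<in> ball q R \<and> F (lift e u z) = 0"
    "\<And>z. z \<in> ball q R \<Longrightarrow> F z = 0 \<longleftrightarrow> z \<in> D \<and> z \<bullet> e = u z"
    "\<And>z. z \<in> ball q R \<Longrightarrow> g z \<bullet> e \<noteq> 0"
proof -
  note CF = C2_D[OF F]
  have ee: "e \<bullet> e = 1" using e by (simp add: dot_square_norm)
  have "open (ball q R0 \<inter> (\<lambda>z. g z \<bullet> e) -` (- {0}))"
    by (intro continuous_open_preimage continuous_intros CF(7)) auto
  moreover have "q \<in> ball q R0 \<inter> (\<lambda>z. g z \<bullet> e) -` (- {0})" using R0 ge by simp
  ultimately obtain R where R: "R > 0" "ball q R \<subseteq> ball q R0 \<inter> (\<lambda>z. g z \<bullet> e) -` (- {0})"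
    using openE by blast
  define R' where "R' = min R R0"
  define B where "B = ball q R'"
  have R': "0 < R'" "R' \<le> R0" unfolding R'_def using R(1) R0 by auto
  have BR: "B \<subseteq> ball q R0" and gB: "\<And>z. z \<in> B \<Longrightarrow> g z \<bullet> e \<noteq> 0"
    using R(2) unfolding B_def R'_def by (auto simp: subset_iff)
  have FB: "C2 B F g H" using C2_subset[OF F] BR unfolding B_def by auto
  note CB = C2_D[OF FB]
  define \<Psi> where "\<Psi> = (\<lambda>z. z - (z \<bullet> e) *\<^sub>R e + F z *\<^sub>R e)"
  have \<Psi>e: "\<Psi> z \<bullet> e = F z" for z unfolding \<Psi>_def by (simp add: inner_add_left inner_diff_left ee)
  have c\<Psi>: "continuous_on B \<Psi>" unfolding \<Psi>_def by (intro continuous_intros CB(6))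
  have inj: "inj_on \<Psi> B"
  proof (rule inj_onI)
    fix x y assume x: "x \<in> B" and y: "y \<in> B" and eq: "\<Psi> x = \<Psi> y"
    have Feq: "F x = F y" using eq \<Psi>e by metis
    then have "y = x + (y \<bullet> e - x \<bullet> e) *\<^sub>R e" using eq unfolding \<Psi>_def by (simp add: algebra_simps)
    then obtain t where t: "y = x + t *\<^sub>R e" by blast
    have "t = 0"
      by (rule DERIV_const_sign_imp_inj[OF FB _ gB x]) (use y t Feq in \<open>auto simp: B_def\<close>)
    then show "x = y" using t by simp
  qed
  define inv where "inv = inv_into B \<Psi>"
  have inv1: "inv (\<Psi> z) = z" if "z \<in> B" for z unfolding inv_def using inj that by simp
  have inv2: "inv y \<in> B" "\<Psi> (inv y) = y" if "y \<in> \<Psi> ` B" for y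
    unfolding inv_def using that by (auto simp: inv_into_into f_inv_into_f)
  have oI: "open (\<Psi> ` B)" by (rule invariance_of_domain[OF c\<Psi> _ inj]) (simp add: B_def)
  define pr where "pr = (\<lambda>z. z - (z \<bullet> e) *\<^sub>R e)"
  have pr_e: "pr z \<bullet> e = 0" for z unfolding pr_def by (simp add: inner_diff_left ee)
  have pr_sh: "pr (z + t *\<^sub>R e) = pr z" for z t unfolding pr_def by (simp add: inner_add_left ee algebra_simps)
  define D where "D = pr -` (\<Psi> ` B)"
  define u where "u = (\<lambda>z. inv (pr z) \<bullet> e)"
  have oD: "open D" unfolding D_def
    by (intro continuous_open_vimage oI) (auto simp: pr_def intro!: continuous_intros)
  have liftu: "lift e u z = inv (pr z)" "F (lift e u z) = 0" "lift e u z \<in> B" if "z \<in> D" for z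
  proof -
    have z: "pr z \<in> \<Psi> ` B" using that D_def by simp
    note i = inv2[OF z]
    have F0: "F (inv (pr z)) = 0" using \<Psi>e i(2) pr_e by metis
    then have "inv (pr z) - (inv (pr z) \<bullet> e) *\<^sub>R e = pr z" using i(2) unfolding \<Psi>_def by simp
    then show "lift e u z = inv (pr z)" unfolding lift_def u_def pr_def by (simp add: algebra_simps)
    then show "F (lift e u z) = 0" "lift e u z \<in> B" using F0 i(1) by auto
  qed
  have cyl: "cylindrical e D u" unfolding cylindrical_def D_def u_def by (simp add: pr_sh)
  have graph: "F z = 0 \<longleftrightarrow> z \<in> D \<and> z \<bullet> e = u z" if z: "z \<in> B" for z
  proof
    assume "F z = 0"
    then have "\<Psi> z = pr z" unfolding \<Psi>_def pr_def by simp
    then show "z \<in> D \<and> z \<bullet> e = u z" using z inv1[OF z] unfolding D_def u_def by (metis image_eqI vimageI2)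
  next
    assume "z \<in> D \<and> z \<bullet> e = u z"
    then show "F z = 0" using liftu(2)[of z] lift_self[of z e u] by simp
  qed
  have qB: "q \<in> B" unfolding B_def using R' by simp
  have qD: "q \<in> D" using graph[OF qB] Fq by simp
  \<comment> \<open>Implicit differentiation: \<open>e - p z\<close> is the normal of the level set
    scaled to \<open>e\<close> component 1.\<close>
  define p where "p = (\<lambda>z. e - (inverse (g (lift e u z) \<bullet> e)) *\<^sub>R g (lift e u z))"
  have ud: "(u has_derivative (\<lambda>h. p z \<bullet> h)) (at z)" if z: "z \<in> D" for z
  proof -
    define x where "x = lift e u z"
    have xB: "x \<in> B" and Fx: "F x = 0" and xi: "x = inv (pr z)" using liftu[OF z] x_def by auto
    have \<Psi>x: "\<Psi> x = pr z" unfolding xi by (rule inv2) (use z D_def in simp)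
    define G where "G = g x"
    have G: "G \<bullet> e \<noteq> 0" unfolding G_def by (rule gB[OF xB])
    define P' where "P' = (\<lambda>h. h - (h \<bullet> e) *\<^sub>R e + (G \<bullet> h) *\<^sub>R e)"
    \<comment> \<open>Explicit right inverse of the derivative \<open>P'\<close> of
      \<open>\<Psi>\<close>, as required for differentiating the inverse map.\<close>
    define I' where "I' = (\<lambda>k. k - (k \<bullet> e) *\<^sub>R e + ((k \<bullet> e - G \<bullet> (k - (k \<bullet> e) *\<^sub>R e)) / (G \<bullet> e)) *\<^sub>R e)"
    have "(\<Psi> has_derivative P') (at x)"
      unfolding \<Psi>_def P'_def G_def using CB(2)[OF xB] by (auto intro!: derivative_eq_intros)
    moreover have "P' \<circ> I' = id"
      unfolding P'_def I'_def using G by (auto simp: fun_eq_iff inner_add_left inner_add_right inner_diff_left inner_diff_right ee)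
    ultimately have "(inv has_derivative I') (at (\<Psi> x))"
      by (intro has_derivative_inverse_strong[OF CB(1) xB c\<Psi> inv1])
    then have invd: "(inv has_derivative I') (at (pr z))" unfolding \<Psi>x .
    have "(pr has_derivative (\<lambda>h. h - (h \<bullet> e) *\<^sub>R e)) (at z)"
      unfolding pr_def by (auto intro!: derivative_eq_intros)
    then have "((\<lambda>z. inv (pr z)) has_derivative (\<lambda>h. I' (h - (h \<bullet> e) *\<^sub>R e))) (at z)"
      by (rule has_derivative_compose[where f=pr and g=inv, OF _ invd])
    then have ud1: "(u has_derivative (\<lambda>h. I' (h - (h \<bullet> e) *\<^sub>R e) \<bullet> e)) (at z)"
      unfolding u_def by (auto intro!: derivative_eq_intros)
    have ud2: "I' (h - (h \<bullet> e) *\<^sub>R e) \<bullet> e = p z \<bullet> h" for h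
      unfolding I'_def p_def x_def[symmetric] G_def[symmetric] using G
      by (simp add: inner_add_left inner_add_right inner_diff_left inner_diff_right ee field_simps inner_commute)
    show ?thesis by (rule has_derivative_eq_rhs[OF ud1]) (rule ext, rule ud2)
  qed
  define T where "T = (\<lambda>y h. h - (h \<bullet> e) *\<^sub>R e + (p y \<bullet> h) *\<^sub>R e)"
  define GT where "GT = (\<lambda>z h. H (lift e u z) (T z h))"
  define Hu where "Hu = (\<lambda>z h. ((inverse (g (lift e u z) \<bullet> e))\<^sup>2 * (GT z h \<bullet> e)) *\<^sub>R g (lift e u z)
      - (inverse (g (lift e u z) \<bullet> e)) *\<^sub>R GT z h)"
  have clift: "continuous_on D (lift e u)"
    by (rule continuous_at_imp_continuous_on) (use has_derivative_continuous[OF has_derivative_lift[OF ud]] in blast)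
  have "C2 D u p Hu"
    unfolding C2_def
  proof (intro conjI ballI allI)
    fix z assume z: "z \<in> D"
    note l = liftu[OF z]
    show "(u has_derivative (\<bullet>) (p z)) (at z)" by (rule ud[OF z])
    have "(lift e u has_derivative T z) (at z)" unfolding T_def by (rule has_derivative_lift[OF ud[OF z]])
    then have gd: "((\<lambda>z. g (lift e u z)) has_derivative GT z) (at z)"
      unfolding GT_def by (rule has_derivative_compose[where f="lift e u" and g=g, OF _ CB(3)[OF l(3)]])
    show "(p has_derivative Hu z) (at z)"
      unfolding p_def using gB[OF l(3)]
      by (auto intro!: derivative_eq_intros gd simp: Hu_def power2_eq_square algebra_simps)
  next
    fix h
    have cg: "continuous_on D (\<lambda>z. g (lift e u z))"
      by (rule continuous_on_compose2[OF CB(7) clift]) (use liftu in auto)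
    have cp: "continuous_on D p"
      unfolding p_def using liftu(3) gB by (intro continuous_intros cg) blast
    have cH: "continuous_on D (\<lambda>z. H (lift e u z) k)" for k
      by (rule continuous_on_compose2[OF CB(4) clift]) (use liftu in auto)
    have "GT z h = H (lift e u z) h + (p z \<bullet> h - h \<bullet> e) *\<^sub>R H (lift e u z) e" if "z \<in> D" for z
    proof -
      have l: "linear (H (lift e u z))" by (rule CB(5)[OF liftu(3)[OF that]])
      show ?thesis unfolding GT_def T_def
        by (simp add: linear_add[OF l] linear_diff[OF l] linear_scale[OF l] algebra_simps)
    qed
    then have cGT: "continuous_on D (\<lambda>z. GT z h)"
      by (subst continuous_on_cong[OF refl]) (auto intro!: continuous_intros cH cp)
    show "continuous_on D (\<lambda>z. Hu z h)"
      unfolding Hu_def using liftu(3) gB by (intro continuous_intros cg cGT) auto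
  qed (rule oD)
  then show ?thesis
    by (intro that[of R' D u p Hu]) (use R' cyl qD liftu graph gB in \<open>auto simp: B_def\<close>)
qed

section \<open>From the given charts to the equation without denominators\<close>

lemma graph_chart_D:
  fixes S :: "'a::euclidean_space set"
  assumes ch: "graph_chart S q e \<Omega> u" and q: "q \<in> S"
  obtains H R where "C2 \<Omega> u (grad u) H" "cylindrical e \<Omega> u" "norm e = 1" "R > 0" "ball q R \<subseteq> \<Omega>"
    "\<And>z. z \<in> ball q R \<Longrightarrow> z \<in> S \<longleftrightarrow> z \<bullet> e = u z"
proof -
  from ch have e: "norm e = 1" and o: "open \<Omega>" and c1: "\<And>y t. y \<in> \<Omega> \<longleftrightarrow> y + t *\<^sub>R e \<in> \<Omega>"
    and c2: "\<And>y t. u (y + t *\<^sub>R e) = u y" and s: "smooth_on \<Omega> u"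
    unfolding graph_chart_def by blast+
  from ch obtain r where r: "r > 0" "S \<inter> ball q r = {y + u y *\<^sub>R e | y. y \<in> \<Omega> \<and> y \<bullet> e = 0} \<inter> ball q r"
    unfolding graph_chart_def by blast
  have ee: "e \<bullet> e = 1" using e by (simp add: dot_square_norm)
  obtain H where H: "C2 \<Omega> u (grad u) H" using smooth_on_C2[OF s o] by blast
  have cyl: "cylindrical e \<Omega> u" unfolding cylindrical_def using c1 c2 by blast
  have "q \<in> S \<inter> ball q r" using q r(1) by simp
  then have "q \<in> {y + u y *\<^sub>R e | y. y \<in> \<Omega> \<and> y \<bullet> e = 0}" unfolding r(2) by simp
  then obtain y where "q = y + u y *\<^sub>R e" "y \<in> \<Omega>" by blast
  then have "q \<in> \<Omega>" using c1 by simp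
  then obtain r' where r': "r' > 0" "ball q r' \<subseteq> \<Omega>" using o openE by blast
  define R where "R = min r r'"
  have "z \<in> S \<longleftrightarrow> z \<bullet> e = u z" if z: "z \<in> ball q R" for z
  proof -
    have zr: "z \<in> ball q r" and z\<Omega>: "z \<in> \<Omega>" using z r' unfolding R_def by (auto simp: subset_iff)
    have "z \<in> S \<longleftrightarrow> (\<exists>y. z = y + u y *\<^sub>R e \<and> y \<in> \<Omega> \<and> y \<bullet> e = 0)" using r(2) zr by blast
    also have "\<dots> \<longleftrightarrow> z \<bullet> e = u z"
    proof
      assume "\<exists>y. z = y + u y *\<^sub>R e \<and> y \<in> \<Omega> \<and> y \<bullet> e = 0"
      then show "z \<bullet> e = u z" using c2 by (auto simp: inner_add_left ee)
    next
      assume zz: "z \<bullet> e = u z"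
      have "z + (- (z \<bullet> e)) *\<^sub>R e \<in> \<Omega>" "u (z + (- (z \<bullet> e)) *\<^sub>R e) = u z" using c1 c2 z\<Omega> by blast+
      then show "\<exists>y. z = y + u y *\<^sub>R e \<and> y \<in> \<Omega> \<and> y \<bullet> e = 0"
        by (intro exI[of _ "z + (- (z \<bullet> e)) *\<^sub>R e"]) (simp add: zz inner_diff_left ee)
    qed
    finally show ?thesis .
  qed
  then show ?thesis using that[OF H cyl e, of R] r(1) r' unfolding R_def by (simp add: subset_iff)
qed

text \<open>Expanding div (grad u / W) and multiplying by W^3 turns the definition into
  \<open>Qop\<close>. The definition evaluates at the foot point of \<open>q\<close> in the
  hyperplane; invariance along \<open>e\<close> moves gradient and Hessian to
  \<open>q\<close>.\<close>

lemma translator_at_Qop: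
  fixes v :: "'a::euclidean_space"
  assumes t: "translator_at v S q" and q: "q \<in> S"
  obtains e \<Omega> u H R where "C2 \<Omega> u (grad u) H" "cylindrical e \<Omega> u" "norm e = 1" "R > 0" "ball q R \<subseteq> \<Omega>"
    "\<And>z. z \<in> ball q R \<Longrightarrow> z \<in> S \<longleftrightarrow> z \<bullet> e = u z" "Qop v e (grad u q) (H q) = 0"
proof -
  from t obtain e \<Omega> u where ch: "graph_chart S q e \<Omega> u"
    and eq: "divergence (\<lambda>x. grad u x /\<^sub>R gW u x) (q - (q \<bullet> e) *\<^sub>R e) = v \<bullet> chart_normal q e u"
    unfolding translator_at_def Let_def by blast
  obtain H R where H: "C2 \<Omega> u (grad u) H" "cylindrical e \<Omega> u" "norm e = 1" "R > 0" "ball q R \<subseteq> \<Omega>"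
    "\<And>z. z \<in> ball q R \<Longrightarrow> z \<in> S \<longleftrightarrow> z \<bullet> e = u z"
    using graph_chart_D[OF ch q] by blast
  have q\<Omega>: "q \<in> \<Omega>" using H(4,5) by auto
  define y where "y = q - (q \<bullet> e) *\<^sub>R e"
  have y': "y = q + (- (q \<bullet> e)) *\<^sub>R e" unfolding y_def by simp
  have y\<Omega>: "y \<in> \<Omega>" using H(2) q\<Omega> unfolding y' cylindrical_def by blast
  have gy: "grad u y = grad u q" "H y = H q" unfolding y' by (rule cylindrical_C2[OF H(1,2) q\<Omega>])+
  define p where "p = grad u q"
  define L where "L = H q"
  have linL: "linear L" unfolding L_def by (rule C2_D(5)[OF H(1) q\<Omega>])
  define W where "W = sqrt (1 + (norm p)\<^sup>2)"
  have W0: "W > 0" unfolding W_def by (simp add: add_pos_nonneg)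
  have W2: "W * W = 1 + (norm p)\<^sup>2" unfolding W_def by simp
  have gW: "gW u y = W" unfolding gW_def W_def gy p_def ..
  have dg: "(grad u has_derivative L) (at y)" using C2_D(3)[OF H(1) y\<Omega>] unfolding gy L_def .
  have dW: "(gW u has_derivative (\<lambda>h. (p \<bullet> L h) / W)) (at y)"
  proof -
    have "((\<lambda>x. 1 + grad u x \<bullet> grad u x) has_derivative (\<lambda>h. 2 * (p \<bullet> L h))) (at y)"
      by (auto intro!: derivative_eq_intros dg simp: gy p_def inner_commute)
    then have 1: "((\<lambda>x. sqrt (1 + grad u x \<bullet> grad u x)) has_derivative (\<lambda>h. 2 * (p \<bullet> L h) * (inverse (sqrt (1 + grad u y \<bullet> grad u y)) / 2))) (at y)"
      by (intro has_derivative_real_sqrt) (auto simp: add_pos_nonneg)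
    have 2: "gW u = (\<lambda>x. sqrt (1 + grad u x \<bullet> grad u x))"
      unfolding gW_def[abs_def] by (simp add: power2_norm_eq_inner)
    have 3: "sqrt (1 + grad u y \<bullet> grad u y) = W"
      unfolding W_def gy p_def by (simp add: power2_norm_eq_inner)
    have 4: "(\<lambda>h. 2 * (p \<bullet> L h) * (inverse W / 2)) = (\<lambda>h. (p \<bullet> L h) / W)"
      by (rule ext) (simp add: inverse_eq_divide)
    show ?thesis unfolding 2 using 1 unfolding 3 4 .
  qed
  have "frechet_derivative (\<lambda>x. (grad u x /\<^sub>R gW u x) \<bullet> i) (at y) h = (L h \<bullet> i) / W - (p \<bullet> i) * (p \<bullet> L h) / W^3" for i h
  proof -
    have "((\<lambda>x. (grad u x /\<^sub>R gW u x) \<bullet> i) has_derivative (\<lambda>h. (L h \<bullet> i) / W - (p \<bullet> i) * (p \<bullet> L h) / W^3)) (at y)"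
    proof -
      have d1: "((\<lambda>x. inverse (gW u x) * (grad u x \<bullet> i)) has_derivative
          (\<lambda>h. inverse (gW u y) * (L h \<bullet> i) + - (inverse (gW u y) * (p \<bullet> L h / W) * inverse (gW u y)) * (grad u y \<bullet> i))) (at y)"
        by (rule has_derivative_mult[OF Deriv.has_derivative_inverse[OF _ dW] has_derivative_inner_left[OF dg]])
           (use W0 gW in simp)
      have d2: "(\<lambda>h. inverse W * (L h \<bullet> i) + - (inverse W * (p \<bullet> L h / W) * inverse W) * (p \<bullet> i)) = (\<lambda>h. (L h \<bullet> i) / W - (p \<bullet> i) * (p \<bullet> L h) / W^3)"
        using W0 by (intro ext) (simp add: divide_simps power3_eq_cube)
      show ?thesis
        unfolding inner_scaleR_left using d1 unfolding gW gy p_def[symmetric] d2 .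
    qed
    from frechet_derivative_at[OF this] show ?thesis by (rule fun_cong[OF sym])
  qed
  then have "divergence (\<lambda>x. grad u x /\<^sub>R gW u x) y = (\<Sum>i\<in>Basis. (L i \<bullet> i) / W - (p \<bullet> i) * (p \<bullet> L i) / W^3)"
    unfolding divergence_def by simp
  also have "\<dots> = tr L / W - (\<Sum>i\<in>Basis. (p \<bullet> i) *\<^sub>R L i) \<bullet> p / W^3"
    by (simp add: sum_subtractf tr_def sum_divide_distrib inner_sum_left inner_commute[of p "L i" for i])
  also have "\<dots> = tr L / W - L p \<bullet> p / W^3" by (simp add: tr_compose_inner[OF linL])
  finally have "tr L / W - L p \<bullet> p / W^3 = (v \<bullet> (e - p)) / W"
    using eq unfolding y_def[symmetric] chart_normal_def Let_def gW gy p_def[symmetric] by (simp add: divide_inverse mult.commute)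
  then have "W^3 * (tr L / W - L p \<bullet> p / W^3) = W^3 * ((v \<bullet> (e - p)) / W)" by simp
  then have "W * W * tr L - L p \<bullet> p = W * W * (v \<bullet> (e - p))"
    using W0 by (simp add: power3_eq_cube right_diff_distrib)
  then have "Qop v e (grad u q) (H q) = 0"
    unfolding Qop_def Aop_def p_def[symmetric] L_def[symmetric] W2 by simp
  then show ?thesis using that[OF H] by blast
qed

section \<open>Local structure of a translator with boundary\<close>

text \<open>Lets the condition \<phi> \<le> 0 that cuts out M near its boundary be expressed by a C2
  function on the parameter domain of a graph.\<close>

lemma C2_compose_lift:
  assumes u: "C2 D u p H" and \<phi>: "C2 B \<phi> g\<phi> H\<phi>" and lB: "\<And>z. z \<in> D \<Longrightarrow> lift e u z \<in> B"
  obtains H\<psi> where "C2 D (\<lambda>z. \<phi> (lift e u z))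
    (\<lambda>z. g\<phi> (lift e u z) - (g\<phi> (lift e u z) \<bullet> e) *\<^sub>R e + (g\<phi> (lift e u z) \<bullet> e) *\<^sub>R p z) H\<psi>"
proof -
  note Cu = C2_D[OF u] and C\<phi> = C2_D[OF \<phi>]
  define T where "T = (\<lambda>y h. h - (h \<bullet> e) *\<^sub>R e + (p y \<bullet> h) *\<^sub>R e)"
  define G where "G = (\<lambda>z h. H\<phi> (lift e u z) (T z h))"
  define H\<psi> where "H\<psi> = (\<lambda>z h. G z h - (G z h \<bullet> e) *\<^sub>R e + ((G z h \<bullet> e) *\<^sub>R p z + (g\<phi> (lift e u z) \<bullet> e) *\<^sub>R H z h))"
  have cl: "continuous_on D (lift e u)" by (rule continuous_on_lift[OF u])
  have "C2 D (\<lambda>z. \<phi> (lift e u z))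
    (\<lambda>z. g\<phi> (lift e u z) - (g\<phi> (lift e u z) \<bullet> e) *\<^sub>R e + (g\<phi> (lift e u z) \<bullet> e) *\<^sub>R p z) H\<psi>"
    unfolding C2_def
  proof (intro conjI ballI allI)
    fix z assume z: "z \<in> D"
    have l: "(lift e u has_derivative T z) (at z)" unfolding T_def by (rule has_derivative_lift[OF Cu(2)[OF z]])
    have d1: "((\<lambda>z. \<phi> (lift e u z)) has_derivative (\<lambda>h. g\<phi> (lift e u z) \<bullet> T z h)) (at z)"
      by (rule has_derivative_compose[OF l C\<phi>(2)[OF lB[OF z]]])
    have d2: "g\<phi> (lift e u z) \<bullet> T z h = (g\<phi> (lift e u z) - (g\<phi> (lift e u z) \<bullet> e) *\<^sub>R e + (g\<phi> (lift e u z) \<bullet> e) *\<^sub>R p z) \<bullet> h" for h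
      unfolding T_def by (simp add: inner_add_left inner_add_right inner_diff_left inner_diff_right inner_commute algebra_simps)
    show "((\<lambda>z. \<phi> (lift e u z)) has_derivative (\<lambda>h. (g\<phi> (lift e u z) - (g\<phi> (lift e u z) \<bullet> e) *\<^sub>R e + (g\<phi> (lift e u z) \<bullet> e) *\<^sub>R p z) \<bullet> h)) (at z)"
      by (rule has_derivative_eq_rhs[OF d1]) (rule ext, rule d2)
    have gd: "((\<lambda>z. g\<phi> (lift e u z)) has_derivative G z) (at z)"
      unfolding G_def by (rule has_derivative_compose[OF l C\<phi>(3)[OF lB[OF z]]])
    show "((\<lambda>z. g\<phi> (lift e u z) - (g\<phi> (lift e u z) \<bullet> e) *\<^sub>R e + (g\<phi> (lift e u z) \<bullet> e) *\<^sub>R p z) has_derivative H\<psi> z) (at z)"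
      unfolding H\<psi>_def
      by (rule derivative_eq_intros gd Cu(3)[OF z] refl)+ (simp add: algebra_simps)
  next
    fix h
    have cg: "continuous_on D (\<lambda>z. g\<phi> (lift e u z))"
      by (rule continuous_on_compose2[OF C\<phi>(7) cl]) (use lB in auto)
    have cH: "continuous_on D (\<lambda>z. H\<phi> (lift e u z) k)" for k
      by (rule continuous_on_compose2[OF C\<phi>(4) cl]) (use lB in auto)
    have "G z h = H\<phi> (lift e u z) h + (p z \<bullet> h - h \<bullet> e) *\<^sub>R H\<phi> (lift e u z) e" if "z \<in> D" for z
    proof -
      have l: "linear (H\<phi> (lift e u z))" by (rule C\<phi>(5)[OF lB[OF that]])
      show ?thesis unfolding G_def T_def
        by (simp add: linear_add[OF l] linear_diff[OF l] linear_scale[OF l] algebra_simps)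
    qed
    then have cG: "continuous_on D (\<lambda>z. G z h)"
      by (subst continuous_on_cong[OF refl]) (auto intro!: continuous_intros cH Cu(7))
    show "continuous_on D (\<lambda>z. H\<psi> z h)"
      unfolding H\<psi>_def by (intro continuous_intros cg cG Cu(4,7))
  qed (rule Cu(1))
  then show ?thesis by (rule that)
qed

text \<open>Adding \<open>\<sigma> *\<^sub>R G\<close> to the tangent step changes \<open>F\<close>
  by about s \<sigma> |G|^2, which at both ends \<plusminus>\<sigma>0 outweighs the error, so the
  intermediate value theorem yields a zero. Tangent vectors thus become secants, which can be tested
  against convexity and height.\<close>

lemma zero_set_tangent:
  assumes F: "C2 B F g H" and x: "x \<in> B" "F x = 0" and gx: "g x \<noteq> 0" and \<tau>: "\<tau> \<bullet> g x = 0" and \<eta>: "\<eta> > 0"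
  obtains s0 where "s0 > 0" "\<And>s. 0 < s \<Longrightarrow> s < s0 \<Longrightarrow> \<exists>k. norm (k - \<tau>) < \<eta> \<and> x + s *\<^sub>R k \<in> B \<and> F (x + s *\<^sub>R k) = 0"
proof -
  note C = C2_D[OF F]
  define G where "G = g x"
  have nG: "norm G > 0" using gx G_def by simp
  define \<sigma>0 where "\<sigma>0 = \<eta> / (2 * norm G)"
  have \<sigma>0: "\<sigma>0 > 0" unfolding \<sigma>0_def using \<eta> nG by simp
  define K where "K = norm \<tau> + \<eta>"
  have K: "K > 0" unfolding K_def using \<eta> by (simp add: add_nonneg_pos)
  have kK: "norm (\<tau> + \<sigma> *\<^sub>R G) \<le> K" "norm (\<sigma> *\<^sub>R G) < \<eta>" if "\<bar>\<sigma>\<bar> \<le> \<sigma>0" for \<sigma>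
  proof -
    have "norm (\<sigma> *\<^sub>R G) \<le> \<sigma>0 * norm G" using that by (simp add: mult_right_mono)
    also have "\<dots> = \<eta> / 2" unfolding \<sigma>0_def using nG by simp
    finally show "norm (\<sigma> *\<^sub>R G) < \<eta>" using \<eta> by simp
    then show "norm (\<tau> + \<sigma> *\<^sub>R G) \<le> K" unfolding K_def using norm_triangle_ineq[of \<tau> "\<sigma> *\<^sub>R G"] by linarith
  qed
  \<comment> \<open>The directions have norm at most \<open>K\<close>, so the linearisation error is
    at most half of the main term s \<sigma>0 |G|^2.\<close>
  define \<epsilon> where "\<epsilon> = \<sigma>0 * (norm G)\<^sup>2 / (2 * K)"
  have \<epsilon>: "\<epsilon> > 0" unfolding \<epsilon>_def using \<sigma>0 nG K by simp
  obtain r where r: "r > 0" "ball x r \<subseteq> B" using C(1) x(1) openE by blast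
  obtain d where d: "d > 0" "\<And>y. norm (y - x) < d \<Longrightarrow> norm (F y - F x - G \<bullet> (y - x)) \<le> \<epsilon> * norm (y - x)"
    using C(2)[OF x(1)] \<epsilon> unfolding has_derivative_at_alt G_def by metis
  show ?thesis
  proof
    show "min r d / K > 0" using r d K by simp
    fix s assume s: "0 < s" "s < min r d / K"
    have sK: "s * K < r" "s * K < d" using s K by (simp_all add: pos_less_divide_eq)
    have near: "norm (s *\<^sub>R (\<tau> + \<sigma> *\<^sub>R G)) \<le> s * K" if "\<bar>\<sigma>\<bar> \<le> \<sigma>0" for \<sigma>
      using kK[OF that] s by simp
    have inB: "x + s *\<^sub>R (\<tau> + \<sigma> *\<^sub>R G) \<in> B" if "\<bar>\<sigma>\<bar> \<le> \<sigma>0" for \<sigma>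
    proof -
      have "x + s *\<^sub>R (\<tau> + \<sigma> *\<^sub>R G) \<in> ball x r"
        using near[OF that] sK by (simp add: dist_norm del: norm_scaleR)
      then show ?thesis using r by blast
    qed
    have est: "\<bar>F (x + s *\<^sub>R (\<tau> + \<sigma> *\<^sub>R G)) - s * \<sigma> * (norm G)\<^sup>2\<bar> \<le> s * (\<sigma>0 * (norm G)\<^sup>2 / 2)" if "\<bar>\<sigma>\<bar> \<le> \<sigma>0" for \<sigma>
    proof -
      have "norm (F (x + s *\<^sub>R (\<tau> + \<sigma> *\<^sub>R G)) - F x - G \<bullet> (s *\<^sub>R (\<tau> + \<sigma> *\<^sub>R G))) \<le> \<epsilon> * norm (s *\<^sub>R (\<tau> + \<sigma> *\<^sub>R G))"
        using d(2)[of "x + s *\<^sub>R (\<tau> + \<sigma> *\<^sub>R G)"] near[OF that] sK by simp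
      also have "\<dots> \<le> \<epsilon> * (s * K)" using near[OF that] \<epsilon> by (intro mult_left_mono) auto
      also have "\<dots> = s * (\<sigma>0 * (norm G)\<^sup>2 / 2)" unfolding \<epsilon>_def using K by simp
      also have "G \<bullet> (s *\<^sub>R (\<tau> + \<sigma> *\<^sub>R G)) = s * \<sigma> * (norm G)\<^sup>2"
        using \<tau> unfolding G_def by (simp add: inner_add_right inner_commute dot_square_norm)
      finally show ?thesis using x(2) by simp
    qed
    have pos: "s * (\<sigma>0 * (norm G)\<^sup>2 / 2) > 0" using s \<sigma>0 nG by simp
    define A where "A = s * \<sigma>0 * (norm G)\<^sup>2"
    have A: "A > 0" "\<bar>F (x + s *\<^sub>R (\<tau> + \<sigma>0 *\<^sub>R G)) - A\<bar> \<le> A / 2" "\<bar>F (x + s *\<^sub>R (\<tau> + (-\<sigma>0) *\<^sub>R G)) + A\<bar> \<le> A / 2"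
      using est[of \<sigma>0] est[of "-\<sigma>0"] pos \<sigma>0 unfolding A_def by (simp_all add: mult.assoc)
    have "\<exists>\<sigma>\<ge>-\<sigma>0. \<sigma> \<le> \<sigma>0 \<and> F (x + s *\<^sub>R (\<tau> + \<sigma> *\<^sub>R G)) = 0"
    proof (rule IVT')
      show "F (x + s *\<^sub>R (\<tau> + (-\<sigma>0) *\<^sub>R G)) \<le> 0" "0 \<le> F (x + s *\<^sub>R (\<tau> + \<sigma>0 *\<^sub>R G))"
        using A by linarith+
      show "continuous_on {-\<sigma>0..\<sigma>0} (\<lambda>\<sigma>. F (x + s *\<^sub>R (\<tau> + \<sigma> *\<^sub>R G)))"
        by (rule continuous_on_compose2[OF C(6)]) (auto intro!: continuous_intros inB)
    qed (use \<sigma>0 in auto)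
    then obtain \<sigma> where \<sigma>': "-\<sigma>0 \<le> \<sigma>" "\<sigma> \<le> \<sigma>0" "F (x + s *\<^sub>R (\<tau> + \<sigma> *\<^sub>R G)) = 0" by blast
    then have \<sigma>: "\<bar>\<sigma>\<bar> \<le> \<sigma>0" "F (x + s *\<^sub>R (\<tau> + \<sigma> *\<^sub>R G)) = 0" by linarith+
    show "\<exists>k. norm (k - \<tau>) < \<eta> \<and> x + s *\<^sub>R k \<in> B \<and> F (x + s *\<^sub>R k) = 0"
      using \<sigma> inB kK(2)[OF \<sigma>(1)] by (intro exI[of _ "\<tau> + \<sigma> *\<^sub>R G"]) simp
  qed
qed

text \<open>Near \<open>x\<close> the function increases along \<open>w\<close>, and its signs at
  \<open>x \<plusminus> \<epsilon> w\<close> persist for nearby base points. Hence one segment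
  length serves all of them, whether or not they lie on the zero set.\<close>

lemma transversal_zero:
  assumes \<psi>: "C2 B \<psi> g H" and x: "x \<in> B" "\<psi> x = 0" and gw: "g x \<bullet> w > 0" and \<epsilon>0: "\<epsilon>0 > 0"
  obtains \<epsilon> \<delta> where "0 < \<epsilon>" "\<epsilon> \<le> \<epsilon>0" "\<delta> > 0"
    "\<And>z. z \<in> ball x \<delta> \<Longrightarrow> \<exists>\<sigma>. \<bar>\<sigma>\<bar> < \<epsilon> \<and> (\<forall>t. \<bar>t\<bar> \<le> \<epsilon> \<longrightarrow> z + t *\<^sub>R w \<in> B \<and>
       (\<psi> (z + t *\<^sub>R w) = 0 \<longleftrightarrow> t = \<sigma>) \<and> (\<psi> (z + t *\<^sub>R w) < 0 \<longleftrightarrow> t < \<sigma>))"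
proof -
  note C = C2_D[OF \<psi>]
  have "open (B \<inter> (\<lambda>z. g z \<bullet> w) -` {0<..})"
    by (intro continuous_open_preimage continuous_intros C(1,7))
  moreover have "x \<in> B \<inter> (\<lambda>z. g z \<bullet> w) -` {0<..}" using x gw by simp
  ultimately obtain r where r: "r > 0" "ball x r \<subseteq> B \<inter> (\<lambda>z. g z \<bullet> w) -` {0<..}"
    using openE by blast
  have rB: "z \<in> B" "g z \<bullet> w > 0" if "z \<in> ball x r" for z using that r by auto
  have w0: "w \<noteq> 0" using gw by auto
  define \<epsilon> where "\<epsilon> = min \<epsilon>0 (r / (2 * norm w))"
  have \<epsilon>: "0 < \<epsilon>" "\<epsilon> \<le> \<epsilon>0" "\<epsilon> * norm w \<le> r / 2"
  proof -
    show "0 < \<epsilon>" "\<epsilon> \<le> \<epsilon>0" unfolding \<epsilon>_def using \<epsilon>0 r w0 by auto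
    have "\<epsilon> * norm w \<le> r / (2 * norm w) * norm w" unfolding \<epsilon>_def by (intro mult_right_mono) auto
    then show "\<epsilon> * norm w \<le> r / 2" using w0 by simp
  qed
  have inr: "z + t *\<^sub>R w \<in> ball x r" if "z \<in> ball x (r/2)" "\<bar>t\<bar> \<le> \<epsilon>" for z t
  proof -
    have "norm (t *\<^sub>R w) \<le> \<epsilon> * norm w" using that by (simp add: mult_right_mono)
    then have "norm (t *\<^sub>R w) \<le> r / 2" using \<epsilon> by linarith
    moreover have "norm (z - x) < r/2" using that by (simp add: dist_norm norm_minus_commute)
    ultimately have "norm (z - x + t *\<^sub>R w) < r" using norm_triangle_ineq[of "z - x" "t *\<^sub>R w"] by linarith
    then show ?thesis by (simp add: dist_norm norm_minus_commute[of x] algebra_simps)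
  qed
  have mono: "\<psi> (z + s *\<^sub>R w) < \<psi> (z + t *\<^sub>R w)" if z: "z \<in> ball x (r/2)" and "-\<epsilon> \<le> s" "s < t" "t \<le> \<epsilon>" for z s t
  proof (rule DERIV_pos_imp_increasing[OF \<open>s < t\<close>])
    fix t' assume "s \<le> t'" "t' \<le> t"
    then have i: "z + t' *\<^sub>R w \<in> ball x r" using that by (intro inr) auto
    have "((\<lambda>t. \<psi> (z + t *\<^sub>R w)) has_real_derivative g (z + t' *\<^sub>R w) \<bullet> w) (at t')"
      by (rule DERIV_along_line) (rule C(2)[OF rB(1)[OF i]])
    then show "\<exists>y. ((\<lambda>t. \<psi> (z + t *\<^sub>R w)) has_real_derivative y) (at t') \<and> 0 < y" using rB(2)[OF i] by blast
  qed
  have xb: "x \<in> ball x (r/2)" using r by simp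
  have "\<psi> (x + (-\<epsilon>) *\<^sub>R w) < 0" "0 < \<psi> (x + \<epsilon> *\<^sub>R w)"
    using mono[OF xb, of "-\<epsilon>" 0] mono[OF xb, of 0 \<epsilon>] \<epsilon> x by auto
  moreover have "open (ball x (r/2) \<inter> (\<lambda>z. \<psi> (z + t *\<^sub>R w)) -` S)" if "\<bar>t\<bar> \<le> \<epsilon>" "open S" for t S
  proof (rule continuous_open_preimage[OF _ open_ball that(2)])
    show "continuous_on (ball x (r/2)) (\<lambda>z. \<psi> (z + t *\<^sub>R w))"
      by (rule continuous_on_compose2[OF C(6)]) (use inr rB that in \<open>auto intro!: continuous_intros\<close>)
  qed
  from this[of "-\<epsilon>" "{..<0}"] this[of \<epsilon> "{0<..}"]
  have "open (ball x (r/2) \<inter> (\<lambda>z. \<psi> (z + (-\<epsilon>) *\<^sub>R w)) -` {..<0})" "open (ball x (r/2) \<inter> (\<lambda>z. \<psi> (z + \<epsilon> *\<^sub>R w)) -` {0<..})"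
    using \<epsilon>(1) by auto
  ultimately obtain \<delta>1 \<delta>2 where \<delta>: "\<delta>1 > 0" "ball x \<delta>1 \<subseteq> ball x (r/2) \<inter> (\<lambda>z. \<psi> (z + (-\<epsilon>) *\<^sub>R w)) -` {..<0}"
     "\<delta>2 > 0" "ball x \<delta>2 \<subseteq> ball x (r/2) \<inter> (\<lambda>z. \<psi> (z + \<epsilon> *\<^sub>R w)) -` {0<..}"
    using xb by (meson IntI openE vimageI greaterThan_iff lessThan_iff)
  show ?thesis
  proof (rule that[OF \<epsilon>(1,2), of "min \<delta>1 \<delta>2"])
    show "min \<delta>1 \<delta>2 > 0" using \<delta> by simp
    fix z assume "z \<in> ball x (min \<delta>1 \<delta>2)"
    then have z1: "z \<in> ball x \<delta>1" and z2: "z \<in> ball x \<delta>2" by auto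
    have z: "z \<in> ball x (r/2)" "\<psi> (z + (-\<epsilon>) *\<^sub>R w) < 0" "0 < \<psi> (z + \<epsilon> *\<^sub>R w)"
      using \<delta>(2) \<delta>(4) z1 z2 by auto
    have "\<exists>\<sigma>\<ge>-\<epsilon>. \<sigma> \<le> \<epsilon> \<and> \<psi> (z + \<sigma> *\<^sub>R w) = 0"
    proof (rule IVT')
      show "continuous_on {-\<epsilon>..\<epsilon>} (\<lambda>\<sigma>. \<psi> (z + \<sigma> *\<^sub>R w))"
        by (rule continuous_on_compose2[OF C(6)]) (use inr[OF z(1)] rB in \<open>auto intro!: continuous_intros simp: abs_le_iff\<close>)
    qed (use z \<epsilon> in auto)
    then obtain \<sigma> where \<sigma>: "-\<epsilon> \<le> \<sigma>" "\<sigma> \<le> \<epsilon>" "\<psi> (z + \<sigma> *\<^sub>R w) = 0" by blast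
    have "\<sigma> \<noteq> \<epsilon>" "\<sigma> \<noteq> - \<epsilon>" using z \<sigma> by auto
    then have "\<bar>\<sigma>\<bar> < \<epsilon>" using \<sigma> by linarith
    moreover have "z + t *\<^sub>R w \<in> B \<and> (\<psi> (z + t *\<^sub>R w) = 0 \<longleftrightarrow> t = \<sigma>) \<and> (\<psi> (z + t *\<^sub>R w) < 0 \<longleftrightarrow> t < \<sigma>)"
      if t: "\<bar>t\<bar> \<le> \<epsilon>" for t
    proof -
      have "z + t *\<^sub>R w \<in> B" by (rule rB(1)[OF inr[OF z(1) t]])
      then show ?thesis
        using mono[OF z(1), of t \<sigma>] mono[OF z(1), of \<sigma> t] \<sigma> t
        by (cases t \<sigma> rule: linorder_cases) (auto simp: abs_le_iff)
    qed
    ultimately show "\<exists>\<sigma>. \<bar>\<sigma>\<bar> < \<epsilon> \<and> (\<forall>t. \<bar>t\<bar> \<le> \<epsilon> \<longrightarrow> z + t *\<^sub>R w \<in> B \<and>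
       (\<psi> (z + t *\<^sub>R w) = 0 \<longleftrightarrow> t = \<sigma>) \<and> (\<psi> (z + t *\<^sub>R w) < 0 \<longleftrightarrow> t < \<sigma>))" by blast
  qed
qed

section \<open>Level set and graph charts of M at interior and boundary points\<close>

locale translator =
  fixes v :: "'a::euclidean_space" and M bd :: "'a set"
  assumes v_unit: "norm v = 1"
    and transl: "compact_translator_with_boundary v M bd"
    and closed_bd: "closed bd"
begin

lemma vv: "v \<bullet> v = 1" using v_unit by (simp add: dot_square_norm)

lemma compact_M: "compact M" and bd_subset: "bd \<subseteq> M"
  using transl unfolding compact_translator_with_boundary_def by auto

text \<open>Boundary and interior points are treated alike: the choice \<open>\<phi> = -1\<close> serves interior points.\<close>

definition level_data where
  "level_data q R F g H \<phi> g\<phi> H\<phi> \<longleftrightarrow> 0 < R \<and> C2 (ball q R) F g H \<and> C2 (ball q R) \<phi> g\<phi> H\<phi> \<and>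
     (\<forall>z\<in>ball q R. g z \<noteq> 0 \<and> (z \<in> M \<longleftrightarrow> F z = 0 \<and> \<phi> z \<le> 0) \<and> (z \<in> bd \<longleftrightarrow> F z = 0 \<and> \<phi> z = 0) \<and>
        (z \<in> M \<longrightarrow> Eop v (g z) (H z) = 0)) \<and>
     (q \<notin> bd \<longrightarrow> (\<forall>z\<in>ball q R. \<phi> z < 0)) \<and>
     (q \<in> bd \<longrightarrow> (\<exists>w. g q \<bullet> w = 0 \<and> g\<phi> q \<bullet> w \<noteq> 0))"

text \<open>The translator equation holds in a separate chart at each point of M.
  \<open>Eop_eq_Qop\<close> carries it, point by point, to the defining function \<open>F\<close> of
  one chart around \<open>q\<close>, so that it holds for this \<open>F\<close> at all points of M
  nearby.\<close>

lemma level_data_exists: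
  assumes q: "q \<in> M"
  obtains R F g H \<phi> g\<phi> H\<phi> where "level_data q R F g H \<phi> g\<phi> H\<phi>"
proof -
  from transl obtain S where S: "smooth_hypersurface S" "M \<subseteq> S"
      and int: "\<forall>p\<in>M - bd. \<exists>r>0. S \<inter> ball p r \<subseteq> M"
      and bnd: "\<forall>p\<in>bd. \<exists>r>0. \<exists>\<phi> e \<Omega> u. graph_chart S p e \<Omega> u \<and> smooth_on (ball p r) \<phi> \<and>
            (\<exists>w. w \<bullet> chart_normal p e u = 0 \<and> frechet_derivative \<phi> (at p) w \<noteq> 0) \<and>
            M \<inter> ball p r = {q \<in> S \<inter> ball p r. \<phi> q \<le> 0} \<and>
            bd \<inter> ball p r = {q \<in> S \<inter> ball p r. \<phi> q = 0}"
      and tr: "\<forall>q\<in>M. translator_at v S q"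
    unfolding compact_translator_with_boundary_def by (elim conjE exE) (rule that)
  have qS: "q \<in> S" using q S by blast
  have chart: "\<exists>R1 F g H. 0 < R1 \<and> C2 (ball q R1) F g H \<and> g q = e - grad u q \<and> (\<forall>z\<in>ball q R1. g z \<noteq> 0 \<and>
      (z \<in> S \<longleftrightarrow> F z = 0) \<and> (z \<in> M \<longrightarrow> Eop v (g z) (H z) = 0))" if ch: "graph_chart S q e \<Omega> u" for e \<Omega> u
  proof -
    obtain H R where H: "C2 \<Omega> u (grad u) H" "cylindrical e \<Omega> u" "norm e = 1" "R > 0" "ball q R \<subseteq> \<Omega>"
      "\<And>z. z \<in> ball q R \<Longrightarrow> z \<in> S \<longleftrightarrow> z \<bullet> e = u z"
      by (rule graph_chart_D[OF ch qS]) (rule that)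
    define F where "F = (\<lambda>z. z \<bullet> e - u z)"
    define g where "g = (\<lambda>z. e - grad u z)"
    define HF where "HF = (\<lambda>z h. - H z h)"
    have CF: "C2 (ball q R) F g HF"
    proof -
      have "C2 (ball q R) u (grad u) H" by (rule C2_subset[OF H(1) open_ball H(5)])
      then show ?thesis unfolding C2_def F_def g_def HF_def
        by (auto intro!: derivative_eq_intros continuous_intros simp: fun_eq_iff inner_diff_left inner_diff_right inner_commute)
    qed
    have g0: "g z \<noteq> 0" if "z \<in> ball q R" for z
    proof -
      have "grad u z \<bullet> e = 0" using cylindrical_C2(1)[OF H(1,2)] that H(5) by blast
      then have "g z \<bullet> e = 1" using H(3) unfolding g_def by (simp add: inner_diff_left dot_square_norm)
      then show ?thesis by auto
    qed
    have FS: "z \<in> S \<longleftrightarrow> F z = 0" if "z \<in> ball q R" for z unfolding F_def using H(6)[OF that] by simp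
    have "Eop v (g z) (HF z) = 0" if z: "z \<in> ball q R" "z \<in> M" for z
    proof -
      have zS: "z \<in> S" using z S by blast
      obtain e' \<Omega>' u' H' R' where H': "C2 \<Omega>' u' (grad u') H'" "cylindrical e' \<Omega>' u'" "norm e' = 1" "R' > 0"
        "ball z R' \<subseteq> \<Omega>'" "\<And>y. y \<in> ball z R' \<Longrightarrow> y \<in> S \<longleftrightarrow> y \<bullet> e' = u' y" "Qop v e' (grad u' z) (H' z) = 0"
        by (rule translator_at_Qop[OF bspec[OF tr z(2)] zS]) (rule that)
      have zz: "z \<in> ball z R'" "z \<in> \<Omega>'" using H'(4,5) by auto
      have lz: "lift e' u' z = z" by (rule lift_self) (use H'(6)[OF zz(1)] zS in simp)
      define W where "W = \<Omega>' \<inter> lift e' u' -` ball z R'"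
      have oW: "open W" unfolding W_def
        by (rule continuous_open_preimage[OF continuous_on_lift[OF H'(1)] C2_D(1)[OF H'(1)] open_ball])
      have zW: "z \<in> W" unfolding W_def using zz lz by simp
      have zero: "F (lift e' u' y) = 0" if y: "y \<in> W" "y \<in> \<Omega>'" "lift e' u' y \<in> ball q R" for y
      proof -
        have "lift e' u' y \<in> ball z R'" using y W_def by simp
        moreover have "lift e' u' y \<bullet> e' = u' (lift e' u' y)"
          using lift_inner[OF H'(3)] cylindrical_lift(2)[OF H'(2) y(2)] by simp
        ultimately have "lift e' u' y \<in> S" using H'(6) by blast
        then show ?thesis using FS[OF y(3)] by blast
      qed
      have "Eop v (g (lift e' u' z)) (HF (lift e' u' z)) = 
          - ((g (lift e' u' z) \<bullet> e')^3 * Qop v e' (grad u' z) (H' z))"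
        by (rule Eop_eq_Qop(3)[OF H'(1,2,3) zz(2) CF _ oW zW zero]) (use lz z g0 in auto)
      then show ?thesis using H'(7) lz by simp
    qed
    then show ?thesis using H(4) CF g0 FS by (intro exI[of _ R] exI[of _ F] exI[of _ g] exI[of _ HF]) (auto simp: g_def)
  qed
  show ?thesis
  proof (cases "q \<in> bd")
    case False
    obtain e \<Omega> u where "graph_chart S q e \<Omega> u" using S(1) qS unfolding smooth_hypersurface_def by blast
    from chart[OF this] obtain R1 F g H where F: "0 < R1" "C2 (ball q R1) F g H"
      "\<And>z. z \<in> ball q R1 \<Longrightarrow> g z \<noteq> 0 \<and> (z \<in> S \<longleftrightarrow> F z = 0) \<and> (z \<in> M \<longrightarrow> Eop v (g z) (H z) = 0)" by blast
    obtain r where r: "r > 0" "S \<inter> ball q r \<subseteq> M" using bspec[OF int, of q] q False by blast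
    have "open (- bd)" "q \<in> - bd" using closed_bd False by auto
    then obtain r' where r': "r' > 0" "ball q r' \<subseteq> - bd" by (meson openE)
    define R where "R = min R1 (min r r')"
    have R: "0 < R" "ball q R \<subseteq> ball q R1" "ball q R \<subseteq> ball q r" "ball q R \<subseteq> ball q r'"
      unfolding R_def using F r r' by auto
    have iff: "z \<in> S \<longleftrightarrow> z \<in> M" if "z \<in> ball q R" for z using that R(3) r(2) S(2) by blast
    have "level_data q R F g H (\<lambda>z. -1) (\<lambda>z. 0) (\<lambda>z h. 0)"
      unfolding level_data_def
    proof (intro conjI ballI impI)
      show "C2 (ball q R) F g H" by (rule C2_subset[OF F(2) open_ball R(2)])
      show "C2 (ball q R) (\<lambda>z. -1) (\<lambda>z. 0) (\<lambda>z h. 0)"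
      proof -
        have "(\<bullet>) (0::'a) = (\<lambda>h. 0)" by (rule ext) simp
        then show ?thesis unfolding C2_def by simp
      qed
      fix z assume z: "z \<in> ball q R"
      have z1: "z \<in> ball q R1" "z \<notin> bd" using z R r' by auto
      show "z \<in> M \<longleftrightarrow> F z = 0 \<and> (-1::real) \<le> 0" "g z \<noteq> 0" using F(3)[OF z1(1)] iff[OF z] by auto
      show "z \<in> M \<Longrightarrow> Eop v (g z) (H z) = 0" using F(3)[OF z1(1)] by auto
      show "z \<in> bd \<longleftrightarrow> F z = 0 \<and> (-1::real) = 0" using z1 by simp
    qed (use R False in auto)
    then show ?thesis by (rule that)
  next
    case True
    then obtain r \<phi> e \<Omega> u w where r: "r > 0" and ch: "graph_chart S q e \<Omega> u" and \<phi>: "smooth_on (ball q r) \<phi>"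
      and w: "w \<bullet> chart_normal q e u = 0" "frechet_derivative \<phi> (at q) w \<noteq> 0"
      and M: "M \<inter> ball q r = {q' \<in> S \<inter> ball q r. \<phi> q' \<le> 0}"
      and bd: "bd \<inter> ball q r = {q' \<in> S \<inter> ball q r. \<phi> q' = 0}"
      using bspec[OF bnd True] by (elim exE conjE) (rule that)
    from chart[OF ch] obtain R1 F g H where F: "0 < R1" "C2 (ball q R1) F g H" "g q = e - grad u q"
      "\<And>z. z \<in> ball q R1 \<Longrightarrow> g z \<noteq> 0 \<and> (z \<in> S \<longleftrightarrow> F z = 0) \<and> (z \<in> M \<longrightarrow> Eop v (g z) (H z) = 0)" by blast
    obtain H\<phi> where H\<phi>: "C2 (ball q r) \<phi> (grad \<phi>) H\<phi>" by (rule smooth_on_C2[OF \<phi> open_ball]) (rule that)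
    obtain Hc Rc where Hc: "C2 \<Omega> u (grad u) Hc" "cylindrical e \<Omega> u" "Rc > 0" "ball q Rc \<subseteq> \<Omega>"
      by (rule graph_chart_D[OF ch qS]) (rule that)
    have q\<Omega>: "q \<in> \<Omega>" using Hc(3,4) by auto
    have "grad u (q - (q \<bullet> e) *\<^sub>R e) = grad u q"
      using cylindrical_C2(2)[OF Hc(1,2) q\<Omega>, of "- (q \<bullet> e)"] by simp
    \<comment> \<open>The chart normal is a positive multiple of \<open>g q\<close>, so the
      \<open>w\<close> of the definition is tangent to the hypersurface.\<close>
    then have "chart_normal q e u = g q /\<^sub>R gW u (q - (q \<bullet> e) *\<^sub>R e)"
      unfolding chart_normal_def Let_def F(3) by simp
    moreover have "gW u y > 0" for y unfolding gW_def by (simp add: add_pos_nonneg)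
    ultimately have gw: "g q \<bullet> w = 0" using w(1) by (simp add: inner_commute) (metis less_irrefl)
    have "(\<phi> has_derivative (\<lambda>h. grad \<phi> q \<bullet> h)) (at q)" using C2_D(2)[OF H\<phi>] r by simp
    from fun_cong[OF frechet_derivative_at[OF this], of w] have "grad \<phi> q \<bullet> w = frechet_derivative \<phi> (at q) w" .
    then have w\<phi>: "grad \<phi> q \<bullet> w \<noteq> 0" using w(2) by simp
    define R where "R = min R1 r"
    have R: "0 < R" "ball q R \<subseteq> ball q R1" "ball q R \<subseteq> ball q r" unfolding R_def using F r by auto
    have "level_data q R F g H \<phi> (grad \<phi>) H\<phi>"
      unfolding level_data_def
    proof (intro conjI ballI impI)
      show "C2 (ball q R) F g H" by (rule C2_subset[OF F(2) open_ball R(2)])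
      show "C2 (ball q R) \<phi> (grad \<phi>) H\<phi>" by (rule C2_subset[OF H\<phi> open_ball R(3)])
      fix z assume z: "z \<in> ball q R"
      have z1: "z \<in> ball q R1" "z \<in> ball q r" using z R by auto
      show "z \<in> M \<longleftrightarrow> F z = 0 \<and> \<phi> z \<le> 0" using M z1(2) F(4)[OF z1(1)] by blast
      show "z \<in> bd \<longleftrightarrow> F z = 0 \<and> \<phi> z = 0" using bd z1(2) F(4)[OF z1(1)] by blast
      show "g z \<noteq> 0" "z \<in> M \<Longrightarrow> Eop v (g z) (H z) = 0" using F(4)[OF z1(1)] by auto
    qed (use R True gw w\<phi> in auto)
    then show ?thesis by (rule that)
  qed
qed

text \<open>A nonzero normal of M. Its length and sign depend on the choice, so only conditions such
  as \<open>nu q \<bullet> a = 0\<close> or being parallel to a vector are meaningful.\<close>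

definition nu :: "'a \<Rightarrow> 'a" where
  "nu q = (SOME n. \<exists>R F g H \<phi> g\<phi> H\<phi>. level_data q R F g H \<phi> g\<phi> H\<phi> \<and> n = g q)"

lemma nu_level_data:
  assumes "q \<in> M"
  obtains R F g H \<phi> g\<phi> H\<phi> where "level_data q R F g H \<phi> g\<phi> H\<phi>" "nu q = g q"
proof -
  have "\<exists>n R F g H \<phi> g\<phi> H\<phi>. level_data q R F g H \<phi> g\<phi> H\<phi> \<and> n = g q"
    by (rule level_data_exists[OF assms]) blast
  from someI_ex[OF this] show ?thesis unfolding nu_def[symmetric] using that by blast
qed

lemma nu_nonzero: "q \<in> M \<Longrightarrow> nu q \<noteq> 0"
  by (erule nu_level_data) (auto simp: level_data_def)

text \<open>\<open>\<psi>\<close> is the boundary function moved to the parameter domain. That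
  \<open>nu\<close> is parallel to the chart normal is recorded where \<open>\<psi> z < 0\<close>,
  because there M fills the graph near \<open>z\<close> and two defining functions can be compared,
  and at \<open>q\<close> itself, where the chart comes from the defining function behind
  \<open>nu q\<close>.\<close>

definition graph_at where
  "graph_at q e R D u p H \<psi> g\<psi> H\<psi> \<longleftrightarrow> 0 < R \<and> norm e = 1 \<and> C2 D u p H \<and> cylindrical e D u \<and> q \<in> D \<and>
     C2 D \<psi> g\<psi> H\<psi> \<and> cylindrical e D \<psi> \<and>
     (\<forall>z\<in>D. lift e u z \<in> ball q R \<and> (lift e u z \<in> M \<longleftrightarrow> \<psi> z \<le> 0) \<and> (lift e u z \<in> bd \<longleftrightarrow> \<psi> z = 0) \<and>
        (lift e u z \<in> M \<longrightarrow> Qop v e (p z) (H z) = 0) \<and>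
        (\<psi> z < 0 \<longrightarrow> (\<exists>c. c \<noteq> 0 \<and> nu (lift e u z) = c *\<^sub>R (e - p z)))) \<and>
     (\<forall>z\<in>ball q R. z \<in> M \<longrightarrow> z \<in> D \<and> z \<bullet> e = u z) \<and>
     (\<exists>c. c \<noteq> 0 \<and> nu q = c *\<^sub>R (e - p q)) \<and>
     (q \<notin> bd \<longrightarrow> (\<forall>z\<in>D. \<psi> z < 0)) \<and> (q \<in> bd \<longrightarrow> g\<psi> q \<noteq> 0)"

lemma graph_at_exists:
  assumes q: "q \<in> M" and e: "norm e = 1" and ne: "nu q \<bullet> e \<noteq> 0"
  obtains R D u p H \<psi> g\<psi> H\<psi> where "graph_at q e R D u p H \<psi> g\<psi> H\<psi>"
proof -
  obtain R0 F g HF \<phi> g\<phi> H\<phi> where ld: "level_data q R0 F g HF \<phi> g\<phi> H\<phi>" "nu q = g q"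
    by (rule nu_level_data[OF q]) (rule that)
  have l: "0 < R0" "C2 (ball q R0) F g HF" "C2 (ball q R0) \<phi> g\<phi> H\<phi>"
    "\<And>z. z \<in> ball q R0 \<Longrightarrow> g z \<noteq> 0" "\<And>z. z \<in> ball q R0 \<Longrightarrow> z \<in> M \<longleftrightarrow> F z = 0 \<and> \<phi> z \<le> 0"
    "\<And>z. z \<in> ball q R0 \<Longrightarrow> z \<in> bd \<longleftrightarrow> F z = 0 \<and> \<phi> z = 0"
    "\<And>z. z \<in> ball q R0 \<Longrightarrow> z \<in> M \<Longrightarrow> Eop v (g z) (HF z) = 0"
    "q \<notin> bd \<Longrightarrow> z \<in> ball q R0 \<Longrightarrow> \<phi> z < 0" "q \<in> bd \<Longrightarrow> \<exists>w. g q \<bullet> w = 0 \<and> g\<phi> q \<bullet> w \<noteq> 0" for z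
    using ld(1) unfolding level_data_def by auto
  have Fq: "F q = 0" using l(1,5) q by simp
  have ne': "g q \<bullet> e \<noteq> 0" using ne ld(2) by simp
  obtain R D u p H where G: "0 < R" "R \<le> R0" "C2 D u p H" "cylindrical e D u" "q \<in> D"
    "\<And>z. z \<in> D \<Longrightarrow> lift e u z \<in> ball q R \<and> F (lift e u z) = 0"
    "\<And>z. z \<in> ball q R \<Longrightarrow> F z = 0 \<longleftrightarrow> z \<in> D \<and> z \<bullet> e = u z"
    "\<And>z. z \<in> ball q R \<Longrightarrow> g z \<bullet> e \<noteq> 0"
    by (rule graph_of_level_set[OF l(2,1) Fq e ne']) (rule that)
  have RR: "ball q R \<subseteq> ball q R0" using G(2) by auto
  have lin: "lift e u z \<in> ball q R0" if "z \<in> D" for z using G(6)[OF that] RR by blast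
  have oD: "open D" using C2_D(1)[OF G(3)] .
  have gg: "g (lift e u z) = (g (lift e u z) \<bullet> e) *\<^sub>R (e - p z)"
    "Eop v (g (lift e u z)) (HF (lift e u z)) = - ((g (lift e u z) \<bullet> e)^3 * Qop v e (p z) (H z))"
    if z: "z \<in> D" for z
    using Eop_eq_Qop(2,3)[OF G(3,4) e z l(2) lin[OF z] oD z] G(6) l(4)[OF lin[OF z]] by blast+
  have ge: "g (lift e u z) \<bullet> e \<noteq> 0" if "z \<in> D" for z using G(6,8) that by blast
  obtain H\<psi> where H\<psi>: "C2 D (\<lambda>z. \<phi> (lift e u z))
    (\<lambda>z. g\<phi> (lift e u z) - (g\<phi> (lift e u z) \<bullet> e) *\<^sub>R e + (g\<phi> (lift e u z) \<bullet> e) *\<^sub>R p z) H\<psi>"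
    by (rule C2_compose_lift[OF G(3) l(3) lin]) (assumption, rule that)
  have lq: "lift e u q = q" by (rule lift_self) (use G(7)[of q] G(1) Fq in simp)
  have parallel: "\<exists>c. c \<noteq> 0 \<and> nu (lift e u z) = c *\<^sub>R (e - p z)" if z: "z \<in> D" and \<psi>z: "\<phi> (lift e u z) < 0" for z
  proof -
    define y where "y = lift e u z"
    have yM: "y \<in> M" "y \<notin> bd" using l(5,6)[OF lin[OF z]] G(6)[OF z] \<psi>z unfolding y_def by auto
    obtain R1 F1 g1 H1 \<phi>1 g\<phi>1 H\<phi>1 where ld1: "level_data y R1 F1 g1 H1 \<phi>1 g\<phi>1 H\<phi>1" "nu y = g1 y"
      by (rule nu_level_data[OF yM(1)]) (rule that)
    have l1: "0 < R1" "C2 (ball y R1) F1 g1 H1" "g1 y \<noteq> 0"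
      "\<And>z. z \<in> ball y R1 \<Longrightarrow> z \<in> M \<Longrightarrow> F1 z = 0" using ld1(1) unfolding level_data_def by auto
    define W where "W = D \<inter> (\<lambda>z. \<phi> (lift e u z)) -` {..<0}"
    have oW: "open W" unfolding W_def by (rule continuous_open_preimage[OF C2_D(6)[OF H\<psi>] oD]) simp
    have zW: "z \<in> W" unfolding W_def using z \<psi>z by simp
    have zero: "F1 (lift e u t) = 0" if t: "t \<in> W" "t \<in> D" "lift e u t \<in> ball y R1" for t
      using l1(4)[OF t(3)] l(5)[OF lin[OF t(2)]] G(6)[OF t(2)] t(1) unfolding W_def by auto
    have "lift e u z \<in> ball y R1" using l1(1) y_def by simp
    note E = Eop_eq_Qop[OF G(3,4) e z l1(2) this oW zW zero]
    show ?thesis using E(1,2) l1(3) ld1(2) unfolding y_def by metis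
  qed
  have "graph_at q e R D u p H (\<lambda>z. \<phi> (lift e u z))
    (\<lambda>z. g\<phi> (lift e u z) - (g\<phi> (lift e u z) \<bullet> e) *\<^sub>R e + (g\<phi> (lift e u z) \<bullet> e) *\<^sub>R p z) H\<psi>"
    unfolding graph_at_def
  proof (intro conjI ballI impI)
    show "cylindrical e D (\<lambda>z. \<phi> (lift e u z))"
      using G(4) lift_shift[OF G(4) e] unfolding cylindrical_def by auto
    show "\<exists>c. c \<noteq> 0 \<and> nu q = c *\<^sub>R (e - p q)"
      using gg(1)[OF G(5)] ge[OF G(5)] ld(2) lq by metis
    show "g\<phi> (lift e u q) - (g\<phi> (lift e u q) \<bullet> e) *\<^sub>R e + (g\<phi> (lift e u q) \<bullet> e) *\<^sub>R p q \<noteq> 0" if qb: "q \<in> bd"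
    proof -
      obtain w where w: "g q \<bullet> w = 0" "g\<phi> q \<bullet> w \<noteq> 0" using l(9)[OF qb] by blast
      have "(e - p q) \<bullet> w = 0" using w(1) gg(1)[OF G(5)] ge[OF G(5)] unfolding lq
        by (metis inner_scaleR_left mult_eq_0_iff)
      then have "e \<bullet> w = p q \<bullet> w" by (simp add: inner_diff_left)
      then have "(g\<phi> q - (g\<phi> q \<bullet> e) *\<^sub>R e + (g\<phi> q \<bullet> e) *\<^sub>R p q) \<bullet> w = g\<phi> q \<bullet> w"
        by (simp add: inner_add_left inner_diff_left)
      then show ?thesis using w(2) unfolding lq by auto
    qed
    fix z assume z: "z \<in> D"
    show "lift e u z \<in> ball q R" "lift e u z \<in> M \<longleftrightarrow> \<phi> (lift e u z) \<le> 0" "lift e u z \<in> bd \<longleftrightarrow> \<phi> (lift e u z) = 0"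
      using G(6)[OF z] l(5,6)[OF lin[OF z]] by auto
    show "Qop v e (p z) (H z) = 0" if "lift e u z \<in> M"
      using gg(2)[OF z] l(7)[OF lin[OF z] that] ge[OF z] by simp
    show "\<exists>c. c \<noteq> 0 \<and> nu (lift e u z) = c *\<^sub>R (e - p z)" if "\<phi> (lift e u z) < 0" by (rule parallel[OF z that])
    show "\<phi> (lift e u z) < 0" if "q \<notin> bd" using l(8)[OF that lin[OF z]] .
  next
    fix z assume z: "z \<in> ball q R" "z \<in> M"
    then have "F z = 0" using l(5) RR by blast
    then show "z \<in> D" "z \<bullet> e = u z" using G(7)[OF z(1)] by auto
  qed (use G e H\<psi> in auto)
  then show ?thesis by (rule that)
qed

end

section \<open>Strictly convex symmetric boundary\<close>

lemma reflect_inner: "norm a = 1 \<Longrightarrow> reflect a t x \<bullet> a = 2 * t - x \<bullet> a"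
  by (simp add: reflect_def inner_diff_left dot_square_norm)

lemma reflect_alt: "reflect a t x = x + (2 * (t - x \<bullet> a)) *\<^sub>R a"
  by (simp add: reflect_def algebra_simps)

definition symmetric_body :: "'a::euclidean_space \<Rightarrow> 'a \<Rightarrow> real \<Rightarrow> real \<Rightarrow> 'a set \<Rightarrow> bool" where
  "symmetric_body v a b c K \<longleftrightarrow> compact K \<and> convex K \<and> affine hull K = hyperplane v c \<and>
     (\<forall>x\<in>K. \<forall>y\<in>K. x \<noteq> y \<longrightarrow> open_segment x y \<subseteq> rel_interior K) \<and>
     reflect a b ` rel_frontier K = rel_frontier K"

locale convex_body =
  fixes v a :: "'a::euclidean_space" and b c :: real and K :: "'a set"
  assumes body: "symmetric_body v a b c K" and a_unit: "norm a = 1" and av: "a \<bullet> v = 0"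
begin

lemma aa: "a \<bullet> a = 1" using a_unit by (simp add: dot_square_norm)

lemma K: "compact K" "convex K" "affine hull K = hyperplane v c" "K \<subseteq> hyperplane v c"
  "\<And>x y. x \<in> K \<Longrightarrow> y \<in> K \<Longrightarrow> x \<noteq> y \<Longrightarrow> open_segment x y \<subseteq> rel_interior K"
  using body hull_subset[of K affine] unfolding symmetric_body_def by auto

lemma frontier: "rel_frontier K = K - rel_interior K"
  by (simp add: rel_frontier_def closure_closed[OF compact_imp_closed[OF K(1)]])

lemma segment_in_interior:
  assumes "y \<in> K" "y + T *\<^sub>R w \<in> K" "0 < t" "t < T" "w \<noteq> 0"
  shows "y + t *\<^sub>R w \<in> rel_interior K"
proof -
  have "y + t *\<^sub>R w \<in> open_segment y (y + T *\<^sub>R w)"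
    unfolding in_segment using assms
    by (intro conjI exI[of _ "t/T"]) (auto simp: algebra_simps)
  then show ?thesis using K(5)[OF assms(1,2)] assms by auto
qed

lemma a0: "a \<noteq> 0" using a_unit by auto

lemma reflect_frontier: "x \<in> rel_frontier K \<Longrightarrow> reflect a b x \<in> rel_frontier K"
  using body unfolding symmetric_body_def by blast

text \<open>If the midpoint were off the mirror, the endpoint farther from it and the mirror image
  of that endpoint would have the other endpoint strictly between them; strict convexity would make
  that frontier point interior.\<close>

lemma frontier_chord:
  assumes x: "x \<in> rel_frontier K" and y: "y \<in> rel_frontier K" and xy: "x = y + s *\<^sub>R a" "s > 0"
  shows "x \<bullet> a + y \<bullet> a = 2 * b"
proof (rule ccontr)
  assume ne: "x \<bullet> a + y \<bullet> a \<noteq> 2 * b"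
  have xa: "x \<bullet> a = y \<bullet> a + s" using xy aa by (simp add: inner_add_left)
  show False
  proof (cases "x \<bullet> a + y \<bullet> a > 2 * b")
    case True
    have "x + s *\<^sub>R (-a) \<in> rel_interior K"
    proof (rule segment_in_interior)
      show "x + (2 * (x \<bullet> a - b)) *\<^sub>R (-a) \<in> K"
        using reflect_frontier[OF x] frontier unfolding reflect_alt by (simp add: algebra_simps)
      show "s < 2 * (x \<bullet> a - b)" using True unfolding xa by simp
    qed (use x frontier xy a0 in auto)
    then show False using y frontier xy by simp
  next
    case False
    have "y + s *\<^sub>R a \<in> rel_interior K"
    proof (rule segment_in_interior)
      show "y + (2 * (b - y \<bullet> a)) *\<^sub>R a \<in> K"
        using reflect_frontier[OF y] frontier unfolding reflect_alt by simp
      show "s < 2 * (b - y \<bullet> a)" using False ne unfolding xa by auto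
    qed (use y frontier xy a0 in auto)
    then show False using x frontier xy by simp
  qed
qed

lemma inner_chord:
  assumes x: "x \<in> rel_frontier K" and t: "0 < t" "t < 2 * (x \<bullet> a - b)"
  shows "x - t *\<^sub>R a \<in> rel_interior K"
proof -
  have "x + t *\<^sub>R (-a) \<in> rel_interior K"
  proof (rule segment_in_interior)
    show "x + (2 * (x \<bullet> a - b)) *\<^sub>R (-a) \<in> K"
      using reflect_frontier[OF x] frontier unfolding reflect_alt by (simp add: algebra_simps)
  qed (use t x frontier a0 in auto)
  then show ?thesis by simp
qed

lemma rel_interior_ball:
  assumes "y \<in> rel_interior K"
  obtains \<rho> where "\<rho> > 0" "\<And>z. z \<in> ball y \<rho> \<Longrightarrow> z \<bullet> v = c \<Longrightarrow> z \<in> rel_interior K"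
proof -
  have "openin (top_of_set (affine hull K)) (rel_interior K)" by (rule openin_rel_interior)
  then obtain \<rho> where "\<rho> > 0" "ball y \<rho> \<inter> affine hull K \<subseteq> rel_interior K"
    using assms unfolding openin_contains_ball by blast
  then show ?thesis using that unfolding K(3) hyperplane_def by blast
qed

text \<open>For \<open>k\<close> near \<open>a\<close> the point
  \<open>x - \<delta> *\<^sub>R k\<close> is close to the interior point
  \<open>x - \<delta> *\<^sub>R a\<close> on the mirror, hence interior. With
  \<open>x + s *\<^sub>R k\<close> in \<open>K\<close>, the frontier point \<open>x\<close> would
  lie strictly between two points of \<open>K\<close>.\<close>

lemma outward_not_tangent:
  assumes x: "x \<in> rel_frontier K" and xa: "x \<bullet> a > b"
  obtains \<eta> where "\<eta> > 0" "\<And>s k. s > 0 \<Longrightarrow> norm (k - a) < \<eta> \<Longrightarrow> x + s *\<^sub>R k \<notin> K"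
proof -
  define \<delta> where "\<delta> = x \<bullet> a - b"
  have \<delta>: "\<delta> > 0" using xa \<delta>_def by simp
  have "x - \<delta> *\<^sub>R a \<in> rel_interior K" by (rule inner_chord[OF x]) (use \<delta> in \<open>auto simp: \<delta>_def\<close>)
  then obtain \<rho> where \<rho>: "\<rho> > 0" "\<And>z. z \<in> ball (x - \<delta> *\<^sub>R a) \<rho> \<Longrightarrow> z \<bullet> v = c \<Longrightarrow> z \<in> rel_interior K"
    by (rule rel_interior_ball) (rule that)
  have xK: "x \<in> K" "x \<notin> rel_interior K" "x \<bullet> v = c" using x frontier K(4) by (auto simp: hyperplane_def)
  show ?thesis
  proof
    show "\<rho> / \<delta> > 0" using \<rho> \<delta> by simp
    fix s :: real and k assume s: "s > 0" and k: "norm (k - a) < \<rho> / \<delta>"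
    show "x + s *\<^sub>R k \<notin> K"
    proof
      assume zK: "x + s *\<^sub>R k \<in> K"
      then have kv: "k \<bullet> v = 0" using K(4) xK(3) s by (auto simp: hyperplane_def inner_add_left)
      have "\<delta> * norm (k - a) < \<rho>" using k \<delta> by (simp add: pos_less_divide_eq mult.commute)
      then have "norm (\<delta> *\<^sub>R (k - a)) < \<rho>" using \<delta> by simp
      moreover have "(x - \<delta> *\<^sub>R a) - (x - \<delta> *\<^sub>R k) = \<delta> *\<^sub>R (k - a)" by (simp add: algebra_simps)
      ultimately have "x - \<delta> *\<^sub>R k \<in> ball (x - \<delta> *\<^sub>R a) \<rho>"
        by (simp only: mem_ball dist_norm)
      then have y: "x - \<delta> *\<^sub>R k \<in> rel_interior K"
        by (rule \<rho>(2)) (use xK kv in \<open>simp add: inner_diff_left\<close>)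
      then have yK: "x - \<delta> *\<^sub>R k \<in> K" using rel_interior_subset by blast
      show False
      proof (cases "k = 0")
        case True
        then show False using y xK by simp
      next
        case False
        have "(x - \<delta> *\<^sub>R k) + \<delta> *\<^sub>R k \<in> rel_interior K"
          by (rule segment_in_interior[OF yK, of "\<delta> + s"]) (use zK \<delta> s False in \<open>auto simp: algebra_simps\<close>)
        then show False using xK by simp
      qed
    qed
  qed
qed

lemma frontier_on_line:
  assumes p: "p + s *\<^sub>R a \<in> K" and q: "p + t *\<^sub>R a \<notin> K" and st: "s < t" and v: "p \<bullet> v = c"
  obtains \<alpha> where "s \<le> \<alpha>" "\<alpha> < t" "p + \<alpha> *\<^sub>R a \<in> rel_frontier K"
proof -
  define S where "S = {s..t} \<inter> (\<lambda>\<alpha>. p + \<alpha> *\<^sub>R a) -` K"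
  have "closed S" unfolding S_def
    by (intro continuous_closed_preimage compact_imp_closed K(1) continuous_intros) auto
  moreover have "bounded S" unfolding S_def by (rule bounded_subset[OF bounded_closed_interval, of _ s t]) auto
  ultimately have "compact S" using compact_eq_bounded_closed by blast
  moreover have "S \<noteq> {}" unfolding S_def using p st by force
  ultimately obtain \<alpha> where \<alpha>: "\<alpha> \<in> S" "\<And>\<beta>. \<beta> \<in> S \<Longrightarrow> \<beta> \<le> \<alpha>" using compact_attains_sup[of S] by blast
  have \<alpha>': "s \<le> \<alpha>" "\<alpha> \<le> t" "p + \<alpha> *\<^sub>R a \<in> K" using \<alpha>(1) S_def by auto
  then have lt: "\<alpha> < t" using q by (cases "\<alpha> = t") auto
  have "p + \<alpha> *\<^sub>R a \<notin> rel_interior K"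
  proof
    assume "p + \<alpha> *\<^sub>R a \<in> rel_interior K"
    then obtain \<rho> where \<rho>: "\<rho> > 0" "\<And>z. z \<in> ball (p + \<alpha> *\<^sub>R a) \<rho> \<Longrightarrow> z \<bullet> v = c \<Longrightarrow> z \<in> rel_interior K"
      by (rule rel_interior_ball) (rule that)
    define h where "h = min (\<rho>/2) (t - \<alpha>)"
    have h: "0 < h" "h < \<rho>" "\<alpha> + h \<le> t" unfolding h_def using \<rho> lt by auto
    have "p + (\<alpha> + h) *\<^sub>R a \<in> rel_interior K"
      by (rule \<rho>(2)) (use h a_unit v av in \<open>auto simp: dist_norm algebra_simps inner_add_left\<close>)
    then have "\<alpha> + h \<in> S" unfolding S_def using rel_interior_subset h \<alpha>' by auto
    then show False using \<alpha>(2) h by fastforce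
  qed
  then show ?thesis using that \<alpha>' lt frontier by blast
qed

text \<open>Dimension at least 3 gives a horizontal unit vector \<open>w\<close> orthogonal to
  \<open>a\<close>. The frontier has points near \<open>x\<close> over both x + \<beta> w and x -
  \<beta> w. If neither had smaller \<open>a\<close> component, their midpoint would be an interior
  point x + \<mu> a with \<mu> \<ge> 0, which contradicts \<open>x\<close> being a frontier point or
  \<open>outward_not_tangent\<close>.\<close>

lemma frontier_lower_point:
  assumes dim: "DIM('a) \<ge> 3" and x: "x \<in> rel_frontier K" and xa: "x \<bullet> a > b" and \<delta>: "\<delta> > 0"
  obtains z where "z \<in> rel_frontier K" "z \<in> ball x \<delta>" "z \<bullet> a < x \<bullet> a"
proof -
  have "\<exists>w. w \<noteq> 0 \<and> w \<bullet> a = 0 \<and> w \<bullet> v = 0"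
  proof -
    have "dim {a, v} < DIM('a)" using dim_le_card[of "{a,v}"] card_insert_le_m1[of 2 "{v}" a] dim
      by (smt (verit) card.empty card_insert_if dim_le_card' finite.emptyI finite.insertI insert_absorb le_trans less_le_trans not_less numeral_3_eq_3 numeral_2_eq_2 order.refl le_simps)
    then have "span {a, v} \<noteq> UNIV" by (metis dim_eq_full less_irrefl)
    then show ?thesis using span_not_UNIV_orthogonal[of "{a, v}"] 
      by (metis inner_commute insertCI span_base)
  qed
  then obtain w0 where w0: "w0 \<noteq> 0" "w0 \<bullet> a = 0" "w0 \<bullet> v = 0" by blast
  define w where "w = w0 /\<^sub>R norm w0"
  have w: "norm w = 1" "w \<bullet> a = 0" "w \<bullet> v = 0" unfolding w_def using w0 by auto
  have xK: "x \<in> K" "x \<notin> rel_interior K" "x \<bullet> v = c" using x frontier K(4) by (auto simp: hyperplane_def)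
  define \<epsilon> where "\<epsilon> = min (\<delta> / 2) (x \<bullet> a - b)"
  have \<epsilon>: "\<epsilon> > 0" "\<epsilon> \<le> \<delta> / 2" "\<epsilon> < 2 * (x \<bullet> a - b)"
    unfolding \<epsilon>_def using \<delta> xa by (auto simp: min_def)
  have "x - \<epsilon> *\<^sub>R a \<in> rel_interior K" by (rule inner_chord[OF x]) (use \<epsilon> in auto)
  then obtain \<rho>1 where \<rho>1: "\<rho>1 > 0" "\<And>z. z \<in> ball (x - \<epsilon> *\<^sub>R a) \<rho>1 \<Longrightarrow> z \<bullet> v = c \<Longrightarrow> z \<in> rel_interior K"
    by (rule rel_interior_ball) (rule that)
  obtain \<eta> where \<eta>: "\<eta> > 0" "\<And>s k. s > 0 \<Longrightarrow> norm (k - a) < \<eta> \<Longrightarrow> x + s *\<^sub>R k \<notin> K"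
    using outward_not_tangent[OF x xa] by blast
  have "x + \<epsilon> *\<^sub>R a \<in> - K" using \<eta>(2)[of \<epsilon> a] \<epsilon> \<eta>(1) by simp
  then obtain \<rho>2 where \<rho>2: "\<rho>2 > 0" "ball (x + \<epsilon> *\<^sub>R a) \<rho>2 \<subseteq> - K"
    using K(1) compact_imp_closed by (metis open_Compl openE)
  define \<beta> where "\<beta> = min (\<delta>/2) (min \<rho>1 \<rho>2) / 2"
  have \<beta>: "\<beta> > 0" "\<beta> < \<delta>/2" "\<beta> < \<rho>1" "\<beta> < \<rho>2" unfolding \<beta>_def using \<delta> \<rho>1 \<rho>2 by auto
  \<comment> \<open>On the line through \<open>x\<close> there is an interior point below and an
    outer point above; both properties survive a shift by \<beta> along \<open>w\<close>, so the
    shifted line meets the frontier in between.\<close>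
  have ex: "\<exists>\<alpha>. \<bar>\<alpha>\<bar> \<le> \<epsilon> \<and> x + \<theta> *\<^sub>R w + \<alpha> *\<^sub>R a \<in> rel_frontier K" if \<theta>: "\<bar>\<theta>\<bar> = \<beta>" for \<theta>
  proof -
    have "x + \<theta> *\<^sub>R w + (-\<epsilon>) *\<^sub>R a \<in> rel_interior K"
    proof (rule \<rho>1(2))
      have "norm (\<theta> *\<^sub>R w) = \<beta>" using \<theta> w by simp
      then have "dist (x - \<epsilon> *\<^sub>R a) (x - \<epsilon> *\<^sub>R a + \<theta> *\<^sub>R w) < \<rho>1" using \<beta> by (simp add: dist_norm)
      then show "x + \<theta> *\<^sub>R w + (-\<epsilon>) *\<^sub>R a \<in> ball (x - \<epsilon> *\<^sub>R a) \<rho>1" by (simp add: algebra_simps)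
      show "(x + \<theta> *\<^sub>R w + (-\<epsilon>) *\<^sub>R a) \<bullet> v = c" using xK w av by (simp add: inner_add_left inner_diff_left)
    qed
    then have 1: "x + \<theta> *\<^sub>R w + (-\<epsilon>) *\<^sub>R a \<in> K" using rel_interior_subset by blast
    have "norm (\<theta> *\<^sub>R w) = \<beta>" using \<theta> w by simp
    then have "dist (x + \<epsilon> *\<^sub>R a) (x + \<epsilon> *\<^sub>R a + \<theta> *\<^sub>R w) < \<rho>2" using \<beta> by (simp add: dist_norm)
    then have "x + \<theta> *\<^sub>R w + \<epsilon> *\<^sub>R a \<in> ball (x + \<epsilon> *\<^sub>R a) \<rho>2" by (simp add: algebra_simps)
    then have 2: "x + \<theta> *\<^sub>R w + \<epsilon> *\<^sub>R a \<notin> K" using \<rho>2(2) by blast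
    have "(x + \<theta> *\<^sub>R w) \<bullet> v = c" using xK w by (simp add: inner_add_left)
    from frontier_on_line[OF 1 2 _ this] \<epsilon> obtain \<alpha> where "-\<epsilon> \<le> \<alpha>" "\<alpha> < \<epsilon>"
      "x + \<theta> *\<^sub>R w + \<alpha> *\<^sub>R a \<in> rel_frontier K" by auto
    then show ?thesis by (intro exI[of _ \<alpha>]) auto
  qed
  have near: "x + \<theta> *\<^sub>R w + \<alpha> *\<^sub>R a \<in> ball x \<delta>" if "\<bar>\<theta>\<bar> = \<beta>" "\<bar>\<alpha>\<bar> \<le> \<epsilon>" for \<theta> \<alpha>
  proof -
    have "norm (\<theta> *\<^sub>R w + \<alpha> *\<^sub>R a) \<le> \<bar>\<theta>\<bar> + \<bar>\<alpha>\<bar>"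
      using norm_triangle_ineq[of "\<theta> *\<^sub>R w" "\<alpha> *\<^sub>R a"] w a_unit by simp
    also have "\<dots> < \<delta>" using that \<beta> \<epsilon> by linarith
    finally have "dist x (x + (\<theta> *\<^sub>R w + \<alpha> *\<^sub>R a)) < \<delta>"
      by (metis add_diff_cancel_left' dist_commute dist_norm)
    then show ?thesis by (simp add: add.assoc)
  qed
  obtain \<alpha>1 where \<alpha>1: "\<bar>\<alpha>1\<bar> \<le> \<epsilon>" "x + \<beta> *\<^sub>R w + \<alpha>1 *\<^sub>R a \<in> rel_frontier K" using ex[of \<beta>] \<beta> by auto
  obtain \<alpha>2 where \<alpha>2: "\<bar>\<alpha>2\<bar> \<le> \<epsilon>" "x + (-\<beta>) *\<^sub>R w + \<alpha>2 *\<^sub>R a \<in> rel_frontier K" using ex[of "-\<beta>"] \<beta> by auto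
  have "\<alpha>1 < 0 \<or> \<alpha>2 < 0"
  proof (rule ccontr)
    assume "\<not> (\<alpha>1 < 0 \<or> \<alpha>2 < 0)"
    then have nn: "\<alpha>1 \<ge> 0" "\<alpha>2 \<ge> 0" by auto
    define y where "y = x + (-\<beta>) *\<^sub>R w + \<alpha>2 *\<^sub>R a"
    define d where "d = (2 * \<beta>) *\<^sub>R w + (\<alpha>1 - \<alpha>2) *\<^sub>R a"
    have "d \<bullet> w = 2 * \<beta>" unfolding d_def using w by (simp add: inner_add_left inner_add_right dot_square_norm inner_commute)
    then have d0: "d \<noteq> 0" using \<beta> by auto
    have "y + (1/2) *\<^sub>R d \<in> rel_interior K"
    proof (rule segment_in_interior[of _ 1])
      show "y \<in> K" using \<alpha>2 frontier y_def by simp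
      have "y + 1 *\<^sub>R d = x + \<beta> *\<^sub>R w + \<alpha>1 *\<^sub>R a" unfolding y_def d_def by (simp add: algebra_simps scaleR_2[symmetric])
      then show "y + 1 *\<^sub>R d \<in> K" using \<alpha>1 frontier by simp
    qed (use d0 in auto)
    moreover define \<mu> where "\<mu> = (\<alpha>1 + \<alpha>2) / 2"
    have \<mu>: "\<mu> \<ge> 0" "\<alpha>1 - \<alpha>2 = 2 * (\<mu> - \<alpha>2)" unfolding \<mu>_def using nn by auto
    have "y + (1/2) *\<^sub>R d = x + \<mu> *\<^sub>R a"
      unfolding y_def d_def \<mu>(2) by (simp add: algebra_simps)
    ultimately have m: "x + \<mu> *\<^sub>R a \<in> rel_interior K" by simp
    show False
    proof (cases "\<mu> = 0")
      case True then show False using m xK by simp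
    next
      case False
      then have "\<mu> > 0" using \<mu> by simp
      then show False using \<eta>(2)[of \<mu> a] \<eta>(1) m rel_interior_subset by auto
    qed
  qed
  then show ?thesis
  proof
    assume "\<alpha>1 < 0"
    then show ?thesis using that[OF \<alpha>1(2)] near[of \<beta>] \<alpha>1(1) \<beta> w aa by (simp add: inner_add_left)
  next
    assume "\<alpha>2 < 0"
    then show ?thesis using that[OF \<alpha>2(2)] near[of "-\<beta>"] \<alpha>2(1) \<beta> w aa by (simp add: inner_add_left inner_diff_left)
  qed
qed

end

section \<open>Geometry of M along the boundary of the slab\<close>

locale symmetric_slab = translator v M "\<Gamma>1 \<union> \<Gamma>2" for v :: "'a::euclidean_space" and M \<Gamma>1 \<Gamma>2 +
  fixes a :: 'a and b c1 c2 :: real and K1 K2 :: "'a set"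
  assumes dim: "DIM('a) \<ge> 3" and c12: "c1 < c2"
    and a_unit: "norm a = 1" and av: "a \<bullet> v = 0"
    and body1: "symmetric_body v a b c1 K1" and \<Gamma>1: "\<Gamma>1 = rel_frontier K1"
    and body2: "symmetric_body v a b c2 K2" and \<Gamma>2: "\<Gamma>2 = rel_frontier K2"
    and slab: "x \<in> M \<Longrightarrow> c1 \<le> x \<bullet> v \<and> x \<bullet> v \<le> c2"
begin

abbreviation "bd \<equiv> \<Gamma>1 \<union> \<Gamma>2"

sublocale B1: convex_body v a b c1 K1 by unfold_locales (use body1 a_unit av in auto)
sublocale B2: convex_body v a b c2 K2 by unfold_locales (use body2 a_unit av in auto)

lemma aa: "a \<bullet> a = 1" by (rule B1.aa)
lemma va: "v \<bullet> a = 0" using av by (simp add: inner_commute)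

lemma \<Gamma>1_height: "x \<in> \<Gamma>1 \<Longrightarrow> x \<bullet> v = c1" and \<Gamma>2_height: "x \<in> \<Gamma>2 \<Longrightarrow> x \<bullet> v = c2"
  using B1.K(4) B1.frontier B2.K(4) B2.frontier \<Gamma>1 \<Gamma>2 by (auto simp: hyperplane_def)

text \<open>\<open>vs = \<plusminus>v\<close> is the direction pointing into the slab at the boundary point \<open>x\<close>.\<close>

lemma boundary_point:
  assumes x: "x \<in> bd"
  obtains K c vs R where "convex_body v a b c K" "x \<in> rel_frontier K" "R > 0"
    "\<And>z. z \<in> bd \<Longrightarrow> z \<in> ball x R \<Longrightarrow> z \<in> rel_frontier K"
    "vs = v \<and> x \<in> \<Gamma>1 \<or> vs = -v \<and> x \<in> \<Gamma>2" "\<And>z. z \<in> M \<Longrightarrow> 0 \<le> (z - x) \<bullet> vs"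
    "\<And>z. z \<bullet> v = x \<bullet> v \<longleftrightarrow> (z - x) \<bullet> vs = 0" "x \<bullet> v = c"
    "\<And>z. c1 \<le> z \<bullet> v \<Longrightarrow> z \<bullet> v \<le> c2 \<Longrightarrow> 0 \<le> (z - x) \<bullet> vs"
proof -
  have far: "c2 - c1 \<le> norm (z - x)" if "z \<bullet> v = c2 \<and> x \<bullet> v = c1 \<or> z \<bullet> v = c1 \<and> x \<bullet> v = c2" for z
  proof -
    have "c2 - c1 \<le> \<bar>(z - x) \<bullet> v\<bar>" using that c12 by (auto simp: inner_diff_left)
    also have "\<dots> \<le> norm (z - x) * norm v" by (rule Cauchy_Schwarz_ineq2)
    finally show ?thesis using v_unit by simp
  qed
  show ?thesis
  proof (cases "x \<in> \<Gamma>1")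
    case True
    have h: "x \<bullet> v = c1" by (rule \<Gamma>1_height[OF True])
    show ?thesis
    proof (rule that[of c1 K1 "c2 - c1" v])
      fix z assume z: "z \<in> bd" "z \<in> ball x (c2 - c1)"
      show "z \<in> rel_frontier K1"
        using z far[of z] h \<Gamma>2_height[of z] \<Gamma>1 by (auto simp: dist_norm norm_minus_commute)
    qed (use True h c12 slab \<Gamma>1 B1.convex_body_axioms in \<open>auto simp: inner_diff_left\<close>)
  next
    case False
    then have x2: "x \<in> \<Gamma>2" using x by simp
    have h: "x \<bullet> v = c2" by (rule \<Gamma>2_height[OF x2])
    show ?thesis
    proof (rule that[of c2 K2 "c2 - c1" "-v"])
      fix z assume z: "z \<in> bd" "z \<in> ball x (c2 - c1)"
      show "z \<in> rel_frontier K2"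
        using z far[of z] h \<Gamma>1_height[of z] \<Gamma>2 by (auto simp: dist_norm norm_minus_commute)
    qed (use x2 h c12 slab \<Gamma>2 B2.convex_body_axioms in \<open>auto simp: inner_diff_left\<close>)
  qed
qed

lemma graph_at_D:
  assumes "graph_at q e R D u p H \<psi> g\<psi> H\<psi>"
  shows "0 < R" "norm e = 1" "C2 D u p H" "cylindrical e D u" "q \<in> D" "C2 D \<psi> g\<psi> H\<psi>" "cylindrical e D \<psi>"
    "z \<in> D \<Longrightarrow> lift e u z \<in> ball q R" "z \<in> D \<Longrightarrow> lift e u z \<in> M \<longleftrightarrow> \<psi> z \<le> 0"
    "z \<in> D \<Longrightarrow> lift e u z \<in> bd \<longleftrightarrow> \<psi> z = 0"
    "z \<in> D \<Longrightarrow> lift e u z \<in> M \<Longrightarrow> Qop v e (p z) (H z) = 0"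
    "z \<in> D \<Longrightarrow> \<psi> z < 0 \<Longrightarrow> \<exists>c. c \<noteq> 0 \<and> nu (lift e u z) = c *\<^sub>R (e - p z)"
    "z \<in> ball q R \<Longrightarrow> z \<in> M \<Longrightarrow> z \<in> D \<and> z \<bullet> e = u z"
    "\<exists>c. c \<noteq> 0 \<and> nu q = c *\<^sub>R (e - p q)" "q \<notin> bd \<Longrightarrow> z \<in> D \<Longrightarrow> \<psi> z < 0" "q \<in> bd \<Longrightarrow> g\<psi> q \<noteq> 0"
    "z \<in> ball q R \<Longrightarrow> z \<in> M \<Longrightarrow> lift e u z = z"
  using assms unfolding graph_at_def by (auto intro: lift_self)

text \<open>Secants of the zero set of \<open>\<psi>\<close> live in the parameter domain. Lifting
  them to M changes the height by a term of higher order only, because the gradient at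
  \<open>q\<close> vanishes.\<close>

lemma tangent_boundary_points:
  assumes g: "graph_at q e R D u p H \<psi> g\<psi> H\<psi>" and q: "q \<in> bd" and p: "p q = 0"
    and \<tau>: "\<tau> \<bullet> e = 0" "\<tau> \<bullet> g\<psi> q = 0" and \<eta>: "\<eta> > 0"
  obtains s0 where "s0 > 0" "\<And>s. 0 < s \<Longrightarrow> s < s0 \<Longrightarrow> \<exists>k. norm (k - \<tau>) < \<eta> \<and> q + s *\<^sub>R k \<in> bd"
proof -
  note G = graph_at_D[OF g]
  have qM: "q \<in> M" using q bd_subset by blast
  have qq: "q \<in> ball q R" using G(1) by simp
  have lq: "lift e u q = q" by (rule G(17)[OF qq qM])
  have uq: "u q = q \<bullet> e" using G(13)[OF qq qM] by simp
  have \<psi>q: "\<psi> q = 0" using G(10)[OF G(5)] q lq by simp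
  \<comment> \<open>A third each for the secant direction, the height change and the
    \<open>e\<close> component of \<open>k\<close>.\<close>
  define \<eta>' where "\<eta>' = min 1 (\<eta> / 3)"
  have \<eta>': "\<eta>' > 0" "\<eta>' \<le> \<eta> / 3" "\<eta>' \<le> 1" unfolding \<eta>'_def using \<eta> by auto
  define B where "B = norm \<tau> + 1"
  have B: "B > 0" unfolding B_def by (simp add: add_nonneg_pos)
  obtain s1 where s1: "s1 > 0" "\<And>s. 0 < s \<Longrightarrow> s < s1 \<Longrightarrow> \<exists>k. norm (k - \<tau>) < \<eta>' \<and> q + s *\<^sub>R k \<in> D \<and> \<psi> (q + s *\<^sub>R k) = 0"
    by (rule zero_set_tangent[OF G(6,5) \<psi>q G(16)[OF q] \<tau>(2) \<eta>'(1)]) (rule that)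
  have "\<eta>' / B > 0" using \<eta>' B by simp
  then obtain d where d: "d > 0" "\<And>y. norm (y - q) < d \<Longrightarrow> norm (u y - u q - p q \<bullet> (y - q)) \<le> \<eta>' / B * norm (y - q)"
    using C2_D(2)[OF G(3,5)] unfolding has_derivative_at_alt by metis
  show ?thesis
  proof
    show "min s1 (d / B) > 0" using s1 d B by simp
    fix s assume s: "0 < s" "s < min s1 (d / B)"
    then obtain k where k: "norm (k - \<tau>) < \<eta>'" "q + s *\<^sub>R k \<in> D" "\<psi> (q + s *\<^sub>R k) = 0" using s1(2)[of s] by auto
    have kB: "norm k \<le> B" unfolding B_def using k(1) \<eta>' norm_triangle_sub[of k \<tau>] by linarith
    have "norm (s *\<^sub>R k) \<le> s * B" using kB s by simp
    moreover have "s * B < d" using s B by (simp add: pos_less_divide_eq)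
    ultimately have "norm (u (q + s *\<^sub>R k) - u q) \<le> \<eta>' / B * norm (s *\<^sub>R k)"
      using d(2)[of "q + s *\<^sub>R k"] p by simp
    also have "\<dots> \<le> \<eta>' / B * (s * B)" using \<open>norm (s *\<^sub>R k) \<le> s * B\<close> \<eta>' B by (intro mult_left_mono) auto
    also have "\<dots> = \<eta>' * s" using B by simp
    finally have du: "\<bar>u (q + s *\<^sub>R k) - u q\<bar> \<le> \<eta>' * s" by simp
    define \<mu> where "\<mu> = (u (q + s *\<^sub>R k) - u q) / s"
    have \<mu>: "\<bar>\<mu>\<bar> \<le> \<eta>'" "u (q + s *\<^sub>R k) = u q + s * \<mu>" unfolding \<mu>_def using du s by (auto simp: pos_divide_le_eq)
    define k' where "k' = k + (\<mu> - k \<bullet> e) *\<^sub>R e"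
    have "lift e u (q + s *\<^sub>R k) = q + s *\<^sub>R k'"
      unfolding lift_def k'_def \<mu>(2) uq by (simp add: inner_add_left algebra_simps)
    then have "q + s *\<^sub>R k' \<in> bd" using G(10)[OF k(2)] k(3) by simp
    moreover have "norm (k' - \<tau>) < \<eta>"
    proof -
      have "k \<bullet> e = (k - \<tau>) \<bullet> e" using \<tau> by (simp add: inner_diff_left)
      also have "\<bar>\<dots>\<bar> \<le> norm (k - \<tau>) * norm e" by (rule Cauchy_Schwarz_ineq2)
      finally have ke: "\<bar>k \<bullet> e\<bar> < \<eta>'" using k(1) G(2) by simp
      have "norm (k' - \<tau>) \<le> norm (k - \<tau>) + norm ((\<mu> - k \<bullet> e) *\<^sub>R e)"
        unfolding k'_def using norm_triangle_ineq[of "k - \<tau>" "(\<mu> - k \<bullet> e) *\<^sub>R e"] by (simp add: algebra_simps)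
      also have "\<dots> < \<eta>' + (\<eta>' + \<eta>')" using k(1) \<mu>(1) ke G(2) by (auto simp: abs_le_iff abs_less_iff)
      finally show ?thesis using \<eta>' by linarith
    qed
    ultimately show "\<exists>k. norm (k - \<tau>) < \<eta> \<and> q + s *\<^sub>R k \<in> bd" by blast
  qed
qed

lemma horizontal_gradient:
  assumes g: "graph_at q e R D u p H \<psi> g\<psi> H\<psi>" and n: "nu q = c *\<^sub>R e"
  shows "p q = 0"
proof -
  note G = graph_at_D[OF g]
  obtain d where d: "d \<noteq> 0" "nu q = d *\<^sub>R (e - p q)" using G(14) by blast
  have "p q \<bullet> e = 0" by (rule cylindrical_C2(1)[OF G(3,4,5)])
  then have pe: "e \<bullet> p q = 0" by (simp add: inner_commute)
  have "nu q \<bullet> p q = 0" unfolding n using pe by simp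
  moreover have "nu q \<bullet> p q = - d * (p q \<bullet> p q)" unfolding d(2) using pe by (simp add: inner_diff_left)
  ultimately show ?thesis using d(1) by simp
qed

text \<open>Otherwise \<open>a\<close> would be tangent to the boundary at \<open>x\<close>, and
  secants of the boundary with directions arbitrarily close to \<open>a\<close> would end in the
  convex body, against \<open>outward_not_tangent\<close>.\<close>

lemma boundary_gradient_transversal:
  assumes g: "graph_at x e R D u p H \<psi> g\<psi> H\<psi>" and x: "x \<in> bd" "x \<bullet> a > b" and p: "p x = 0" and ae: "a \<bullet> e = 0"
  shows "a \<bullet> g\<psi> x \<noteq> 0"
proof
  assume a\<psi>: "a \<bullet> g\<psi> x = 0"
  obtain K c vs R0 where B: "convex_body v a b c K" "x \<in> rel_frontier K" "R0 > 0"
    "\<And>z. z \<in> bd \<Longrightarrow> z \<in> ball x R0 \<Longrightarrow> z \<in> rel_frontier K"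
    by (rule boundary_point[OF x(1)]) (rule that)
  interpret B: convex_body v a b c K by (rule B(1))
  obtain \<eta> where \<eta>: "\<eta> > 0" "\<And>s k. s > 0 \<Longrightarrow> norm (k - a) < \<eta> \<Longrightarrow> x + s *\<^sub>R k \<notin> K"
    using B.outward_not_tangent[OF B(2) x(2)] by blast
  obtain s0 where s0: "s0 > 0" "\<And>s. 0 < s \<Longrightarrow> s < s0 \<Longrightarrow> \<exists>k. norm (k - a) < \<eta> \<and> x + s *\<^sub>R k \<in> bd"
    by (rule tangent_boundary_points[OF g x(1) p ae a\<psi> \<eta>(1)]) (rule that)
  define s where "s = min (s0/2) (R0 / (2 * (1 + \<eta>)))"
  have s: "0 < s" "s < s0" "s \<le> R0 / (2 * (1 + \<eta>))" unfolding s_def using s0 B(3) \<eta>(1) by auto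
  obtain k where k: "norm (k - a) < \<eta>" "x + s *\<^sub>R k \<in> bd" using s0(2)[OF s(1,2)] by blast
  have "norm k \<le> 1 + \<eta>" using k(1) a_unit norm_triangle_sub[of k a] by linarith
  then have "s * norm k \<le> R0 / (2 * (1 + \<eta>)) * (1 + \<eta>)" using s \<eta>(1) B(3) by (intro mult_mono) auto
  then have "norm (s *\<^sub>R k) \<le> R0 / (2 * (1 + \<eta>)) * (1 + \<eta>)" using s(1) by simp
  also have "\<dots> < R0" using \<eta>(1) B(3) by (simp add: divide_simps)
  finally have "x + s *\<^sub>R k \<in> ball x R0" by (simp add: dist_norm)
  then have "x + s *\<^sub>R k \<in> K" using B(4) k(2) B.frontier by blast
  then show False using \<eta>(2)[OF s(1) k(1)] by simp
qed

text \<open>The boundary is horizontal and, by strict convexity and symmetry, transversal to \<open>a\<close>; with \<open>a\<close> it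
  spans the horizontal hyperplane.\<close>

lemma boundary_normal_vertical:
  assumes x: "x \<in> bd" "x \<bullet> a > b" and na: "nu x \<bullet> a = 0"
  obtains c where "c \<noteq> 0" "nu x = c *\<^sub>R v"
proof -
  have xM: "x \<in> M" using x bd_subset by blast
  have n0: "nu x \<noteq> 0" by (rule nu_nonzero[OF xM])
  define e where "e = nu x /\<^sub>R norm (nu x)"
  have e: "norm e = 1" "nu x = norm (nu x) *\<^sub>R e" "nu x \<bullet> e \<noteq> 0" using n0 by (auto simp: e_def dot_square_norm)
  have ae: "a \<bullet> e = 0" unfolding e_def using na by (simp add: inner_commute)
  have ee: "e \<bullet> e = 1" using e(1) by (simp add: dot_square_norm)
  obtain R D u p H \<psi> g\<psi> H\<psi> where g: "graph_at x e R D u p H \<psi> g\<psi> H\<psi>"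
    by (rule graph_at_exists[OF xM e(1,3)]) (rule that)
  note G = graph_at_D[OF g]
  have p: "p x = 0" by (rule horizontal_gradient[OF g e(2)])
  define \<gamma> where "\<gamma> = g\<psi> x"
  have \<gamma>e: "\<gamma> \<bullet> e = 0" unfolding \<gamma>_def by (rule cylindrical_C2(1)[OF G(6,7,5)])
  have \<gamma>0: "\<gamma> \<noteq> 0" "a \<bullet> \<gamma> \<noteq> 0"
    using boundary_gradient_transversal[OF g x p ae] unfolding \<gamma>_def by auto
  obtain K c vs R0 where B: "convex_body v a b c K" "x \<in> rel_frontier K" "R0 > 0"
    "\<And>z. z \<in> bd \<Longrightarrow> z \<in> ball x R0 \<Longrightarrow> z \<in> rel_frontier K"
    by (rule boundary_point[OF x(1)]) (rule that)
  interpret B: convex_body v a b c K by (rule B(1))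
  define l where "l = (v \<bullet> \<gamma>) / (\<gamma> \<bullet> \<gamma>)"
  \<comment> \<open>Projection of \<open>v\<close> to the tangent space of the boundary, the
    complement of \<open>e\<close> and \<gamma>. Secants of the boundary near \<open>x\<close> are
    horizontal, hence so is \<tau>, and |\<tau>|^2 = \<tau> . v = 0.\<close>
  define \<tau> where "\<tau> = v - (v \<bullet> e) *\<^sub>R e - l *\<^sub>R \<gamma>"
  have \<tau>e: "\<tau> \<bullet> e = 0" unfolding \<tau>_def using ee \<gamma>e by (simp add: inner_diff_left)
  have \<tau>\<gamma>: "\<tau> \<bullet> \<gamma> = 0" unfolding \<tau>_def l_def using \<gamma>0 \<gamma>e by (simp add: inner_diff_left inner_commute[of e \<gamma>])
  have "\<bar>\<tau> \<bullet> v\<bar> \<le> \<eta>" if \<eta>: "\<eta> > 0" for \<eta>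
  proof -
    obtain s0 where s0: "s0 > 0" "\<And>s. 0 < s \<Longrightarrow> s < s0 \<Longrightarrow> \<exists>k. norm (k - \<tau>) < \<eta> \<and> x + s *\<^sub>R k \<in> bd"
      by (rule tangent_boundary_points[OF g x(1) p \<tau>e _ \<eta>]) (use \<tau>\<gamma> \<gamma>_def that in auto)
    define B where "B = norm \<tau> + \<eta>"
    have Bp: "B > 0" unfolding B_def using \<eta> by (simp add: add_nonneg_pos)
    define s where "s = min (s0/2) (R0 / (2 * B))"
    have s: "0 < s" "s < s0" "s \<le> R0 / (2 * B)" unfolding s_def using s0 B(3) Bp by auto
    obtain k where k: "norm (k - \<tau>) < \<eta>" "x + s *\<^sub>R k \<in> bd" using s0(2)[OF s(1,2)] by blast
    have "norm k \<le> B" unfolding B_def using k(1) norm_triangle_sub[of k \<tau>] by linarith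
    then have "s * norm k \<le> R0 / (2 * B) * B" using s Bp B(3) by (intro mult_mono) auto
    then have "norm (s *\<^sub>R k) \<le> R0 / (2 * B) * B" using s(1) by simp
    also have "\<dots> < R0" using Bp B(3) by simp
    finally have "x + s *\<^sub>R k \<in> ball x R0" by (simp add: dist_norm)
    then have "x + s *\<^sub>R k \<in> K" "x \<in> K" using B(2,4) k(2) B.frontier by blast+
    then have "(x + s *\<^sub>R k) \<bullet> v = c" "x \<bullet> v = c" using B.K(4) by (auto simp: hyperplane_def)
    then have "k \<bullet> v = 0" using s(1) by (simp add: inner_add_left)
    then have "\<tau> \<bullet> v = - ((k - \<tau>) \<bullet> v)" by (simp add: inner_diff_left)
    also have "\<bar>\<dots>\<bar> \<le> norm (k - \<tau>) * norm v" using Cauchy_Schwarz_ineq2[of "k - \<tau>" v] by simp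
    finally show ?thesis using k(1) v_unit by simp
  qed
  then have "\<tau> \<bullet> v = 0" by (meson abs_le_zero_iff field_le_epsilon add_0 zero_less_abs_iff dense_le not_le)
  moreover have "\<tau> \<bullet> \<tau> = \<tau> \<bullet> v" using \<tau>e \<tau>\<gamma> by (subst (2) \<tau>_def) (simp add: inner_diff_right)
  ultimately have "\<tau> = 0" by simp
  then have v: "v = (v \<bullet> e) *\<^sub>R e + l *\<^sub>R \<gamma>" unfolding \<tau>_def by (simp add: algebra_simps)
  \<comment> \<open>Now \<open>v\<close> lies in the span of \<open>e\<close> and \<gamma>. As
    \<open>a\<close> is orthogonal to \<open>v\<close> and \<open>e\<close> but not to \<gamma>, the
    \<gamma> part must vanish.\<close>
  have "0 = a \<bullet> v" using av by simp
  also have "\<dots> = l * (a \<bullet> \<gamma>)" by (subst v) (simp add: inner_add_right ae)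
  finally have "l = 0" using \<gamma>0 by simp
  then have v': "v = (v \<bullet> e) *\<^sub>R e" using v by simp
  then have "v \<bullet> v = (v \<bullet> e) * (v \<bullet> e)" by (metis inner_scaleR_right)
  then have "e = (v \<bullet> e) *\<^sub>R v" using v' vv by (metis scaleR_one scaleR_scaleR)
  then have "nu x = (norm (nu x) * (v \<bullet> e)) *\<^sub>R v" using e(2) by (metis scaleR_scaleR)
  then show ?thesis using n0 by (intro that[of "norm (nu x) * (v \<bullet> e)"]) auto
qed

end

section \<open>Charts at boundary points\<close>

lemma C2_directional_decrease:
  assumes \<psi>: "C2 B \<psi> g H" and x: "x \<in> B" and w: "g x \<bullet> w < 0"
  obtains e where "e > 0" "\<And>s. 0 < s \<Longrightarrow> s < e \<Longrightarrow> x + s *\<^sub>R w \<in> B \<and> \<psi> (x + s *\<^sub>R w) < \<psi> x"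
proof -
  note C = C2_D[OF \<psi>]
  have "((\<lambda>t. \<psi> (x + t *\<^sub>R w)) has_real_derivative g x \<bullet> w) (at 0)"
    by (rule DERIV_along_line) (use C(2)[OF x] in simp)
  from DERIV_neg_dec_right[OF this w] obtain d where d: "d > 0"
    "\<And>h. 0 < h \<Longrightarrow> h < d \<Longrightarrow> \<psi> (x + h *\<^sub>R w) < \<psi> x" by auto
  obtain r where r: "r > 0" "ball x r \<subseteq> B" using C(1) x openE by blast
  have w0: "w \<noteq> 0" using w by auto
  show ?thesis
  proof
    show "min d (r / norm w) > 0" using d r w0 by simp
    fix s assume s: "0 < s" "s < min d (r / norm w)"
    then have "norm (s *\<^sub>R w) < r" using w0 by (simp add: pos_less_divide_eq)
    then have "x + s *\<^sub>R w \<in> ball x r" by (simp add: dist_norm)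
    then show "x + s *\<^sub>R w \<in> B \<and> \<psi> (x + s *\<^sub>R w) < \<psi> x" using d s r by auto
  qed
qed

text \<open>A semidefinite form that vanishes on the complement of \<gamma> has no cross terms with
  \<gamma> either, so only the coefficient along \<gamma> is left; the trace makes it
  positive.\<close>

lemma psd_rank_one_pos:
  assumes l: "linear L" and nn: "\<And>h. 0 \<le> L h \<bullet> h" and \<gamma>: "\<gamma> \<noteq> 0" and z: "\<And>\<tau>. \<tau> \<bullet> \<gamma> = 0 \<Longrightarrow> L \<tau> \<bullet> \<tau> = 0"
    and t: "tr L = 1" and a: "a \<bullet> \<gamma> \<noteq> 0"
  shows "L a \<bullet> a > 0"
proof -
  have q: "L \<gamma> \<bullet> \<gamma> = (norm \<gamma>)\<^sup>2" using tr_eq_normal_part[OF l z, of \<gamma>] t by simp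
  define q where "q = L \<gamma> \<bullet> \<gamma>"
  have q0: "q > 0" unfolding q_def q using \<gamma> by simp
  define k where "k = (a \<bullet> \<gamma>) / (\<gamma> \<bullet> \<gamma>)"
  have k0: "k \<noteq> 0" unfolding k_def using a \<gamma> by simp
  define \<tau> where "\<tau> = a - k *\<^sub>R \<gamma>"
  have \<tau>: "L \<tau> \<bullet> \<tau> = 0" by (rule z) (use \<gamma> in \<open>simp add: \<tau>_def k_def inner_diff_left\<close>)
  define cr where "cr = L \<tau> \<bullet> \<gamma> + L \<gamma> \<bullet> \<tau>"
  have ex: "L (\<tau> + t *\<^sub>R \<gamma>) \<bullet> (\<tau> + t *\<^sub>R \<gamma>) = t * cr + t\<^sup>2 * q" for t
    unfolding cr_def q_def using \<tau>
    by (simp add: linear_add[OF l] linear_scale[OF l] inner_add_left inner_add_right power2_eq_square algebra_simps)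
  \<comment> \<open>Value at the vertex of the parabola t cr + t^2 q.\<close>
  have "0 \<le> (- cr / (2*q)) * cr + (- cr / (2*q))\<^sup>2 * q" using nn ex by metis
  also have "\<dots> = - (cr\<^sup>2 / (4 * q))" using q0 by (simp add: power2_eq_square field_simps)
  finally have "cr\<^sup>2 / (4 * q) \<le> 0" by simp
  then have "cr = 0" using q0 by (simp add: divide_le_0_iff)
  moreover have "a = \<tau> + k *\<^sub>R \<gamma>" unfolding \<tau>_def by simp
  ultimately show ?thesis using ex[of k] k0 q0 by simp
qed

context symmetric_slab begin

lemma near_boundary_height:
  assumes g: "graph_at x e R D u p H \<psi> g\<psi> H\<psi>" and x: "x \<in> bd"
  obtains W where "open W" "x \<in> W" "W \<subseteq> D" "\<And>z. z \<in> W \<Longrightarrow> \<psi> z = 0 \<Longrightarrow> lift e u z \<bullet> v = x \<bullet> v"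
proof -
  note G = graph_at_D[OF g]
  obtain K c vs R0 where B: "convex_body v a b c K" "x \<in> rel_frontier K" "R0 > 0"
    "\<And>z. z \<in> bd \<Longrightarrow> z \<in> ball x R0 \<Longrightarrow> z \<in> rel_frontier K" "x \<bullet> v = c"
    by (rule boundary_point[OF x]) (rule that)
  interpret B: convex_body v a b c K by (rule B(1))
  have lx: "lift e u x = x" by (rule G(17)) (use G(1) x bd_subset in auto)
  define W where "W = D \<inter> lift e u -` ball x R0"
  show ?thesis
  proof (rule that[of W])
    show "open W" unfolding W_def
      by (rule continuous_open_preimage[OF continuous_on_lift[OF G(3)] C2_D(1)[OF G(3)] open_ball])
    show "x \<in> W" unfolding W_def using G(5) lx B(3) by simp
    show "W \<subseteq> D" unfolding W_def by blast
    fix z assume z: "z \<in> W" "\<psi> z = 0"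
    then have "lift e u z \<in> bd" "lift e u z \<in> ball x R0" using G(10) unfolding W_def by auto
    then show "lift e u z \<bullet> v = x \<bullet> v" using B(4,5) B.K(4) B.frontier unfolding hyperplane_def by blast
  qed
qed

text \<open>The chart direction is horizontal, so lifting keeps heights, and near a boundary point
  the zeros of \<open>\<psi>\<close> lie in one horizontal plane. \<open>\<psi>\<close> changes sign
  across that plane, and its negative side faces the slab because M lies there.\<close>

lemma graph_over_slab:
  assumes g: "graph_at x a R D u p H \<psi> g\<psi> H\<psi>" and xM: "x \<in> M"
  obtains \<rho> where "\<rho> > 0" "ball x \<rho> \<subseteq> D"
    "\<And>z. z \<in> ball x \<rho> \<Longrightarrow> c1 \<le> z \<bullet> v \<Longrightarrow> z \<bullet> v \<le> c2 \<Longrightarrow> lift a u z \<in> M"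
proof (cases "x \<in> bd")
  case False
  note G = graph_at_D[OF g]
  obtain \<rho> where \<rho>: "\<rho> > 0" "ball x \<rho> \<subseteq> D" using G(5) C2_D(1)[OF G(3)] openE by blast
  have "lift a u z \<in> M" if "z \<in> ball x \<rho>" for z
  proof -
    have "z \<in> D" using that \<rho> by blast
    then show ?thesis using G(9)[of z] G(15)[of z] False by simp
  qed
  then show ?thesis by (intro that[OF \<rho>])
next
  case x: True
  note G = graph_at_D[OF g]
  obtain K c vs R0 where B: "vs = v \<and> x \<in> \<Gamma>1 \<or> vs = -v \<and> x \<in> \<Gamma>2" "\<And>z. z \<in> M \<Longrightarrow> 0 \<le> (z - x) \<bullet> vs"
    "\<And>z. z \<bullet> v = x \<bullet> v \<longleftrightarrow> (z - x) \<bullet> vs = 0" "\<And>z. c1 \<le> z \<bullet> v \<Longrightarrow> z \<bullet> v \<le> c2 \<Longrightarrow> 0 \<le> (z - x) \<bullet> vs"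
    by (rule boundary_point[OF x]) (rule that)
  have vsvs: "vs \<bullet> vs = 1" and avs: "a \<bullet> vs = 0" using B(1) vv av by auto
  obtain W where W: "open W" "x \<in> W" "W \<subseteq> D" "\<And>z. z \<in> W \<Longrightarrow> \<psi> z = 0 \<Longrightarrow> lift a u z \<bullet> v = x \<bullet> v"
    by (rule near_boundary_height[OF g x]) (rule that)
  have lift_vs: "(lift a u z - x) \<bullet> vs = (z - x) \<bullet> vs" for z
    unfolding lift_def using avs by (simp add: inner_diff_left inner_add_left)
  have lx: "lift a u x = x" by (rule G(17)) (use G(1) xM in auto)
  have \<psi>x: "\<psi> x = 0" using G(10)[OF G(5)] lx x by simp
  have \<psi>W: "C2 W \<psi> g\<psi> H\<psi>" by (rule C2_subset[OF G(6) W(1,3)])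
  have zero: "(z - x) \<bullet> vs = 0" if "z \<in> W" "\<psi> z = 0" for z
    using W(4)[OF that] B(3) lift_vs by metis
  define \<gamma> where "\<gamma> = g\<psi> x"
  have side: "0 \<le> w \<bullet> vs" if w: "\<gamma> \<bullet> w < 0" for w
  proof -
    obtain e where e: "e > 0" "\<And>s. 0 < s \<Longrightarrow> s < e \<Longrightarrow> x + s *\<^sub>R w \<in> D \<and> \<psi> (x + s *\<^sub>R w) < \<psi> x"
      by (rule C2_directional_decrease[OF G(6,5), of w]) (use w \<gamma>_def that in auto)
    define s where "s = e / 2"
    have s: "0 < s" "s < e" unfolding s_def using e by auto
    have "lift a u (x + s *\<^sub>R w) \<in> M" using e(2)[OF s] G(9) \<psi>x by auto
    then have "0 \<le> s * (w \<bullet> vs)" using B(2) lift_vs by fastforce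
    then show ?thesis using s by (simp add: zero_le_mult_iff)
  qed
  have \<gamma>vs: "\<gamma> \<bullet> vs < 0"
  proof (rule ccontr)
    assume n: "\<not> \<gamma> \<bullet> vs < 0"
    have "\<gamma> \<bullet> \<gamma> > 0" using G(16)[OF x] \<gamma>_def by simp
    \<comment> \<open>This direction would lower \<open>\<psi>\<close>, hence lead into M, while
      leaving the slab.\<close>
    then have "\<gamma> \<bullet> (- \<gamma> - vs) < 0" using n unfolding inner_diff_right inner_minus_right by linarith
    from side[OF this] show False using n vsvs by (simp add: inner_diff_left)
  qed
  then have gvs: "g\<psi> x \<bullet> (- vs) > 0" unfolding \<gamma>_def by simp
  obtain \<epsilon> \<delta> where T: "0 < \<epsilon>" "\<delta> > 0"
    "\<And>z. z \<in> ball x \<delta> \<Longrightarrow> \<exists>\<sigma>. \<bar>\<sigma>\<bar> < \<epsilon> \<and> (\<forall>t. \<bar>t\<bar> \<le> \<epsilon> \<longrightarrow> z + t *\<^sub>R (-vs) \<in> W \<and>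
       (\<psi> (z + t *\<^sub>R (-vs)) = 0 \<longleftrightarrow> t = \<sigma>) \<and> (\<psi> (z + t *\<^sub>R (-vs)) < 0 \<longleftrightarrow> t < \<sigma>))"
    by (rule transversal_zero[OF \<psi>W W(2) \<psi>x gvs zero_less_one]) (rule that)
  show ?thesis
  proof (rule that[OF T(2)])
    have inW: "z \<in> W" if zz: "z \<in> ball x \<delta>" for z
    proof -
      obtain \<sigma> where "\<forall>t. \<bar>t\<bar> \<le> \<epsilon> \<longrightarrow> z + t *\<^sub>R (-vs) \<in> W \<and>
         (\<psi> (z + t *\<^sub>R (-vs)) = 0 \<longleftrightarrow> t = \<sigma>) \<and> (\<psi> (z + t *\<^sub>R (-vs)) < 0 \<longleftrightarrow> t < \<sigma>)"
        using T(3)[OF zz] by blast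
      from spec[OF this, of 0] T(1) show ?thesis by simp
    qed
    then show "ball x \<delta> \<subseteq> D" using W(3) by blast
    fix z assume z: "z \<in> ball x \<delta>" "c1 \<le> z \<bullet> v" "z \<bullet> v \<le> c2"
    obtain \<sigma> where \<sigma>: "\<bar>\<sigma>\<bar> < \<epsilon>" and \<sigma>2: "\<And>t. \<bar>t\<bar> \<le> \<epsilon> \<Longrightarrow> z + t *\<^sub>R (-vs) \<in> W \<and>
       (\<psi> (z + t *\<^sub>R (-vs)) = 0 \<longleftrightarrow> t = \<sigma>) \<and> (\<psi> (z + t *\<^sub>R (-vs)) < 0 \<longleftrightarrow> t < \<sigma>)"
      using T(3)[OF z(1)] by blast
    have "\<psi> z \<le> 0"
    proof (rule ccontr)
      assume "\<not> \<psi> z \<le> 0"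
      then have neg: "\<sigma> < 0" using \<sigma>2[of 0] T(1) by auto
      have "z + \<sigma> *\<^sub>R (-vs) \<in> W" "\<psi> (z + \<sigma> *\<^sub>R (-vs)) = 0" using \<sigma>2[of \<sigma>] \<sigma> by auto
      then have "(z + \<sigma> *\<^sub>R (-vs) - x) \<bullet> vs = 0" by (rule zero)
      then have "(z - x) \<bullet> vs = \<sigma>" using vsvs by (simp add: inner_diff_left inner_add_left)
      then show False using neg B(4)[OF z(2,3)] by simp
    qed
    then show "lift a u z \<in> M" using G(9) inW[OF z(1)] W(3) by blast
  qed
qed

text \<open>Profile of M over a horizontal segment across the boundary. Strict growth from height
  \<open>c1\<close> excludes two points of equal height; continuity allows the intermediate value
  theorem to produce a point of given height.\<close>

definition rising_line where
  "rising_line D u p \<psi> w \<epsilon> z \<sigma> \<longleftrightarrow> \<bar>\<sigma>\<bar> < \<epsilon> \<and> u (z + \<sigma> *\<^sub>R w) = c1 \<and>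
    (\<forall>t. \<bar>t\<bar> \<le> \<epsilon> \<longrightarrow> z + t *\<^sub>R w \<in> D \<and> (\<psi> (z + t *\<^sub>R w) = (0::real) \<longleftrightarrow> t = \<sigma>) \<and>
       (\<psi> (z + t *\<^sub>R w) \<le> 0 \<longleftrightarrow> \<sigma> \<le> t) \<and> (\<sigma> < t \<longrightarrow> 0 < p (z + t *\<^sub>R w) \<bullet> w)) \<and>
    (\<forall>t1 t2. \<sigma> \<le> t1 \<longrightarrow> t1 < t2 \<longrightarrow> t2 \<le> \<epsilon> \<longrightarrow> u (z + t1 *\<^sub>R w) < u (z + t2 *\<^sub>R w)) \<and>
    continuous_on {-\<epsilon>..\<epsilon>} (\<lambda>t. u (z + t *\<^sub>R w))"

text \<open>A boundary point where \<open>M\<close> is tangent to \<open>a\<close>: it lies on the lower curve, and \<open>M\<close> is a graph over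
  the plane of that curve, on the side into which \<open>\<theta> a\<close> points (\<open>\<theta> = 1\<close>: outside, \<open>\<theta> = -1\<close>: inside
  \<open>\<Gamma>1\<close>, when \<open>x \<bullet> a > b\<close>).\<close>

definition tangential where
  "tangential x \<theta> R D u p H \<psi> g\<psi> H\<psi> \<longleftrightarrow> x \<in> \<Gamma>1 \<and> graph_at x v R D u p H \<psi> g\<psi> H\<psi> \<and> p x = 0 \<and> \<bar>\<theta>\<bar> = (1::real) \<and>
    (\<forall>\<epsilon>0>0. \<exists>\<epsilon> \<delta>. 0 < \<epsilon> \<and> \<epsilon> \<le> \<epsilon>0 \<and> \<delta> > 0 \<and> (\<forall>z\<in>ball x \<delta>. \<exists>\<sigma>. rising_line D u p \<psi> (\<theta> *\<^sub>R a) \<epsilon> z \<sigma>))"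

text \<open>Along the boundary \<open>u\<close> is constant and its gradient vanishes at
  \<open>x\<close>, so the Hessian form is zero on boundary tangents, while the equation gives it
  trace 1. The coefficient along the conormal \<gamma> is therefore positive. On the upper curve
  this would push M above the slab. Positivity along \<open>a\<close> follows because
  \<open>a\<close> is transversal to the boundary.\<close>

lemma tangential_boundary_hessian:
  assumes x: "x \<in> bd" "x \<bullet> a > b" and g: "graph_at x v R D u p H \<psi> g\<psi> H\<psi>" and p: "p x = 0"
  shows "x \<in> \<Gamma>1" "H x a \<bullet> a > 0"
proof -
  note G = graph_at_D[OF g]
  note Cu = C2_D[OF G(3)]
  have xM: "x \<in> M" using x bd_subset by blast
  have xR: "x \<in> ball x R" using G(1) by simp
  have lx: "lift v u x = x" by (rule G(17)[OF xR xM])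
  have ux: "u x = x \<bullet> v" using G(13)[OF xR xM] by simp
  have \<psi>x: "\<psi> x = 0" using G(10)[OF G(5)] lx x by simp
  define \<gamma> where "\<gamma> = g\<psi> x"
  have \<gamma>0: "\<gamma> \<noteq> 0" unfolding \<gamma>_def by (rule G(16)[OF x(1)])
  have \<gamma>v: "\<gamma> \<bullet> v = 0" unfolding \<gamma>_def by (rule cylindrical_C2(1)[OF G(6,7,5)])
  have \<gamma>a: "a \<bullet> \<gamma> \<noteq> 0" unfolding \<gamma>_def by (rule boundary_gradient_transversal[OF g x p av])
  have lin: "linear (H x)" by (rule Cu(5)[OF G(5)])
  have Q: "Qop v v (p x) (H x) = 0" by (rule G(11)[OF G(5)]) (simp add: lx xM)
  then have tr1: "tr (H x) = 1" unfolding Qop_def Aop_def p using vv by (simp add: linear_0[OF lin])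
  obtain K c vs R0 where B: "vs = v \<and> x \<in> \<Gamma>1 \<or> vs = -v \<and> x \<in> \<Gamma>2" "\<And>z. z \<in> M \<Longrightarrow> 0 \<le> (z - x) \<bullet> vs"
    by (rule boundary_point[OF x(1)]) (rule that)
  obtain W where W: "open W" "x \<in> W" "W \<subseteq> D" "\<And>z. z \<in> W \<Longrightarrow> \<psi> z = 0 \<Longrightarrow> lift v u z \<bullet> v = x \<bullet> v"
    by (rule near_boundary_height[OF g x(1)]) (rule that)
  have \<psi>W: "C2 W \<psi> g\<psi> H\<psi>" by (rule C2_subset[OF G(6) W(1,3)])
  have lu: "lift v u z \<bullet> v = u z" for z by (rule lift_inner[OF v_unit])
  have null: "H x \<tau> \<bullet> \<tau> = 0" if \<tau>: "\<tau> \<bullet> \<gamma> = 0" for \<tau>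
  proof -
    have bound: "\<bar>H x \<tau> \<bullet> \<tau>\<bar> \<le> \<eta>" if \<eta>: "\<eta> > 0" for \<eta>
    proof -
      have "continuous_on UNIV (\<lambda>k. H x k \<bullet> k)"
        using linear_continuous_on[OF linear_conv_bounded_linear[THEN iffD1, OF lin]] by (intro continuous_intros)
      then have "isCont (\<lambda>k. H x k \<bullet> k) \<tau>" by (simp add: continuous_on_eq_continuous_at)
      then obtain \<kappa> where \<kappa>: "\<kappa> > 0" "\<And>k. norm (k - \<tau>) < \<kappa> \<Longrightarrow> \<bar>H x k \<bullet> k - H x \<tau> \<bullet> \<tau>\<bar> < \<eta> / 2"
        unfolding continuous_at_eps_delta dist_norm using \<eta> by (metis half_gt_zero real_norm_def)
      define B where "B = norm \<tau> + min 1 \<kappa>"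
      have Bp: "B > 0" unfolding B_def using \<kappa> by (simp add: add_nonneg_pos)
      \<comment> \<open>\<open>B\<close> bounds the secant directions \<open>k\<close>, so the
        Taylor expansion yields |H k . k| \<le> \<eta>/2; the other half of \<eta> pays for
        replacing \<open>k\<close> by \<tau>.\<close>
      define \<epsilon> where "\<epsilon> = \<eta> / (4 * B\<^sup>2)"
      have \<epsilon>: "\<epsilon> > 0" unfolding \<epsilon>_def using \<eta> Bp by simp
      obtain \<delta> where \<delta>: "\<delta> > 0" "\<And>h. norm h < \<delta> \<Longrightarrow> \<bar>u (x+h) - u x - p x \<bullet> h - (H x h \<bullet> h)/2\<bar> \<le> \<epsilon> * (norm h)\<^sup>2"
        by (rule C2_gradient_expansion[OF G(3,5) \<epsilon>]) (rule that)
      have mk: "min 1 \<kappa> > 0" using \<kappa> by simp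
      have \<tau>': "\<tau> \<bullet> g\<psi> x = 0" using \<tau> \<gamma>_def by simp
      obtain s0 where s0: "s0 > 0" "\<And>s. 0 < s \<Longrightarrow> s < s0 \<Longrightarrow> \<exists>k. norm (k - \<tau>) < min 1 \<kappa> \<and> x + s *\<^sub>R k \<in> W \<and> \<psi> (x + s *\<^sub>R k) = 0"
        by (rule zero_set_tangent[OF \<psi>W W(2) \<psi>x _ \<tau>' mk]) (use \<gamma>0 \<gamma>_def in simp, rule that)
      define s where "s = min (s0/2) (\<delta> / (2 * B))"
      have s: "0 < s" "s < s0" "s \<le> \<delta> / (2 * B)" unfolding s_def using s0 \<delta> Bp by auto
      obtain k where k: "norm (k - \<tau>) < min 1 \<kappa>" "x + s *\<^sub>R k \<in> W" "\<psi> (x + s *\<^sub>R k) = 0" using s0(2)[OF s(1,2)] by blast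
      have kB: "norm k \<le> B" unfolding B_def using k(1) norm_triangle_sub[of k \<tau>] by linarith
      then have "s * norm k \<le> \<delta> / (2 * B) * B" using s Bp \<delta> by (intro mult_mono) auto
      also have "\<dots> < \<delta>" using Bp \<delta> by simp
      finally have "norm (s *\<^sub>R k) < \<delta>" using s by simp
      from \<delta>(2)[OF this] have "\<bar>u (x + s *\<^sub>R k) - u x - (s * s) * (H x k \<bullet> k) / 2\<bar> \<le> \<epsilon> * (s * s * (norm k)\<^sup>2)"
        using p s by (simp add: linear_scale[OF lin] power_mult_distrib power2_eq_square mult_ac)
      moreover have "u (x + s *\<^sub>R k) = u x" using W(4)[OF k(2,3)] lu ux by simp
      ultimately have "(s * s) * (\<bar>H x k \<bullet> k\<bar> / 2) \<le> (s * s) * (\<epsilon> * (norm k)\<^sup>2)"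
        by (simp add: abs_mult mult.left_commute mult.assoc)
      then have 1: "\<bar>H x k \<bullet> k\<bar> / 2 \<le> \<epsilon> * (norm k)\<^sup>2" using s(1) by (simp add: mult_le_cancel_left_pos)
      have "(norm k)\<^sup>2 \<le> B\<^sup>2" using kB by (intro power_mono) auto
      then have "\<epsilon> * (norm k)\<^sup>2 \<le> \<epsilon> * B\<^sup>2" using \<epsilon> by (intro mult_left_mono) auto
      also have "\<epsilon> * B\<^sup>2 = \<eta> / 4" unfolding \<epsilon>_def using Bp by simp
      finally have "\<bar>H x k \<bullet> k\<bar> \<le> \<eta> / 2" using 1 by linarith
      moreover have "\<bar>H x k \<bullet> k - H x \<tau> \<bullet> \<tau>\<bar> < \<eta> / 2" using \<kappa>(2) k(1) by simp
      ultimately show ?thesis by linarith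
    qed
    show ?thesis
    proof (rule ccontr)
      assume "H x \<tau> \<bullet> \<tau> \<noteq> 0"
      then show False using bound[of "\<bar>H x \<tau> \<bullet> \<tau>\<bar> / 2"] by simp
    qed
  qed
  have q: "H x \<gamma> \<bullet> \<gamma> = (norm \<gamma>)\<^sup>2" using tr_eq_normal_part[OF lin null] tr1 by simp
  have small: "\<exists>s. 0 < s \<and> s < e \<and> lift v u (x + s *\<^sub>R w) \<in> M" if "\<gamma> \<bullet> w < 0" "e > 0" for w e
  proof -
    obtain e' where e: "e' > 0" "\<And>s. 0 < s \<Longrightarrow> s < e' \<Longrightarrow> x + s *\<^sub>R w \<in> D \<and> \<psi> (x + s *\<^sub>R w) < \<psi> x"
      by (rule C2_directional_decrease[OF G(6,5), of w]) (use \<open>\<gamma> \<bullet> w < 0\<close> \<gamma>_def in simp, rule that)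
    define s where "s = min e e' / 2"
    have s: "0 < s" "s < e" "s < e'" unfolding s_def using e(1) \<open>e > 0\<close> by auto
    have "lift v u (x + s *\<^sub>R w) \<in> M" using e(2)[OF s(1,3)] G(9) \<psi>x by auto
    then show ?thesis using s by blast
  qed
  have vs: "vs = v \<and> x \<in> \<Gamma>1"
  proof (rule ccontr)
    assume "\<not> (vs = v \<and> x \<in> \<Gamma>1)"
    then have vs: "vs = -v" using B(1) by auto
    have "0 \<le> - H x (- \<gamma>) \<bullet> (- \<gamma>)"
    proof (rule C2_second_order_nonneg[OF C2_const_minus[OF G(3), of 0] G(5)])
      show "- p x \<bullet> (- \<gamma>) = 0" using p by simp
      fix e :: real assume "e > 0"
      then obtain s where s: "0 < s" "s < e" "lift v u (x + s *\<^sub>R (-\<gamma>)) \<in> M" using small[of "-\<gamma>" e] \<gamma>0 by auto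
      have "u (x + s *\<^sub>R (-\<gamma>)) \<le> u x" using B(2)[OF s(3)] vs lu ux by (simp add: inner_diff_left)
      then show "\<exists>s>0. s < e \<and> 0 - u x \<le> 0 - u (x + s *\<^sub>R - \<gamma>)" using s by auto
    qed
    then have "H x \<gamma> \<bullet> \<gamma> \<le> 0" by (simp add: linear_neg[OF lin])
    then show False using q \<gamma>0 by simp
  qed
  then show "x \<in> \<Gamma>1" by simp
  have half: "0 \<le> H x w \<bullet> w" if w: "\<gamma> \<bullet> w < 0" for w
  proof (rule C2_second_order_nonneg[OF G(3,5)])
    show "p x \<bullet> w = 0" using p by simp
    fix e :: real assume "e > 0"
    then obtain s where s: "0 < s" "s < e" "lift v u (x + s *\<^sub>R w) \<in> M" using small[OF w, of e] by auto
    then show "\<exists>s>0. s < e \<and> u x \<le> u (x + s *\<^sub>R w)" using B(2)[OF s(3)] vs lu ux by (auto simp: inner_diff_left)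
  qed
  have nn: "0 \<le> H x w \<bullet> w" for w
  proof (cases "\<gamma> \<bullet> w" "0::real" rule: linorder_cases)
    case less then show ?thesis by (rule half)
  next
    case equal then show ?thesis using null[of w] by (simp add: inner_commute)
  next
    case greater
    then have "0 \<le> H x (-w) \<bullet> (-w)" by (intro half) simp
    then show ?thesis by (simp add: linear_neg[OF lin])
  qed
  show "H x a \<bullet> a > 0" by (rule psd_rank_one_pos[OF lin nn \<gamma>0 null tr1 \<gamma>a])
qed

text \<open>The sign \<theta> makes \<theta> a point into M. Near \<open>x\<close> the function
  \<open>u\<close> is strictly convex along \<open>a\<close>, at least \<open>c1\<close> where it
  parametrises M, and equal to \<open>c1\<close> where the line crosses the boundary. This forces
  strict growth from the crossing on.\<close>

lemma tangential_exists:
  assumes x: "x \<in> bd" "x \<bullet> a > b" and na: "nu x \<bullet> a = 0"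
  obtains \<theta> R D u p H \<psi> g\<psi> H\<psi> where "tangential x \<theta> R D u p H \<psi> g\<psi> H\<psi>"
proof -
  have xM: "x \<in> M" using x bd_subset by blast
  obtain c where c: "c \<noteq> 0" "nu x = c *\<^sub>R v" by (rule boundary_normal_vertical[OF x na]) (rule that)
  obtain R D u p H \<psi> g\<psi> H\<psi> where g: "graph_at x v R D u p H \<psi> g\<psi> H\<psi>"
    by (rule graph_at_exists[OF xM v_unit, of thesis]) (use c vv that in auto)
  note G = graph_at_D[OF g]
  note Cu = C2_D[OF G(3)]
  have p: "p x = 0" by (rule horizontal_gradient[OF g c(2)])
  have \<Gamma>: "x \<in> \<Gamma>1" and Haa: "H x a \<bullet> a > 0" by (rule tangential_boundary_hessian[OF x g p])+
  have \<gamma>a: "a \<bullet> g\<psi> x \<noteq> 0" by (rule boundary_gradient_transversal[OF g x p av])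
  define \<theta> :: real where "\<theta> = - sgn (g\<psi> x \<bullet> a)"
  have \<theta>: "\<bar>\<theta>\<bar> = 1" "\<theta> * \<theta> = 1" unfolding \<theta>_def using \<gamma>a by (auto simp: inner_commute sgn_if)
  define w where "w = \<theta> *\<^sub>R a"
  have gw: "g\<psi> x \<bullet> w < 0" unfolding w_def \<theta>_def using \<gamma>a by (simp add: inner_commute sgn_if split: if_splits)
  have wn: "norm w = 1" unfolding w_def using \<theta> a_unit by simp
  have lx: "lift v u x = x" by (rule G(17)) (use G(1) xM in auto)
  have \<psi>x: "\<psi> x = 0" using G(10)[OF G(5)] lx x by simp
  obtain W where W: "open W" "x \<in> W" "W \<subseteq> D" "\<And>z. z \<in> W \<Longrightarrow> \<psi> z = 0 \<Longrightarrow> lift v u z \<bullet> v = x \<bullet> v"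
    by (rule near_boundary_height[OF g x(1)]) (rule that)
  have "open (D \<inter> (\<lambda>z. H z a \<bullet> a) -` {0<..})"
    by (intro continuous_open_preimage continuous_intros Cu(1,4) open_greaterThan)
  then have "open (W \<inter> (D \<inter> (\<lambda>z. H z a \<bullet> a) -` {0<..}))" using W(1) by blast
  moreover have "x \<in> W \<inter> (D \<inter> (\<lambda>z. H z a \<bullet> a) -` {0<..})" using W(2) G(5) Haa by simp
  ultimately obtain V where V: "open V" "x \<in> V" "V \<subseteq> W" "\<And>z. z \<in> V \<Longrightarrow> 0 < H z a \<bullet> a" by blast
  have VD: "V \<subseteq> D" using V W by blast
  have \<psi>V: "C2 V \<psi> g\<psi> H\<psi>" by (rule C2_subset[OF G(6) V(1) VD])
  have gw': "g\<psi> x \<bullet> (-w) > 0" using gw by simp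
  have lu: "lift v u z \<bullet> v = u z" for z by (rule lift_inner[OF v_unit])
  have main: "\<exists>\<epsilon> \<delta>. 0 < \<epsilon> \<and> \<epsilon> \<le> \<epsilon>0 \<and> \<delta> > 0 \<and> (\<forall>z\<in>ball x \<delta>. \<exists>\<sigma>. rising_line D u p \<psi> w \<epsilon> z \<sigma>)"
    if \<epsilon>0: "\<epsilon>0 > 0" for \<epsilon>0 :: real
  proof -
    obtain \<epsilon> \<delta> where T: "0 < \<epsilon>" "\<epsilon> \<le> \<epsilon>0" "\<delta> > 0"
      "\<And>z. z \<in> ball x \<delta> \<Longrightarrow> \<exists>\<sigma>. \<bar>\<sigma>\<bar> < \<epsilon> \<and> (\<forall>t. \<bar>t\<bar> \<le> \<epsilon> \<longrightarrow> z + t *\<^sub>R (-w) \<in> V \<and>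
       (\<psi> (z + t *\<^sub>R (-w)) = 0 \<longleftrightarrow> t = \<sigma>) \<and> (\<psi> (z + t *\<^sub>R (-w)) < 0 \<longleftrightarrow> t < \<sigma>))"
      by (rule transversal_zero[OF \<psi>V V(2) \<psi>x gw' \<epsilon>0]) (rule that)
    have "\<exists>\<sigma>. rising_line D u p \<psi> w \<epsilon> z \<sigma>" if z: "z \<in> ball x \<delta>" for z
    proof -
      obtain \<sigma>' where \<sigma>': "\<bar>\<sigma>'\<bar> < \<epsilon>" and \<sigma>2: "\<And>t. \<bar>t\<bar> \<le> \<epsilon> \<Longrightarrow> z + t *\<^sub>R (-w) \<in> V \<and>
         (\<psi> (z + t *\<^sub>R (-w)) = 0 \<longleftrightarrow> t = \<sigma>') \<and> (\<psi> (z + t *\<^sub>R (-w)) < 0 \<longleftrightarrow> t < \<sigma>')" using T(4)[OF z] by blast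
      define \<sigma> where "\<sigma> = - \<sigma>'"
      have \<sigma>: "\<bar>\<sigma>\<bar> < \<epsilon>" using \<sigma>' \<sigma>_def by simp
      have line: "z + t *\<^sub>R w \<in> V" "\<psi> (z + t *\<^sub>R w) = 0 \<longleftrightarrow> t = \<sigma>" "\<psi> (z + t *\<^sub>R w) < 0 \<longleftrightarrow> \<sigma> < t" if "\<bar>t\<bar> \<le> \<epsilon>" for t
        using \<sigma>2[of "-t"] that unfolding \<sigma>_def by auto
      have DER: "((\<lambda>t. u (z + t *\<^sub>R w)) has_real_derivative p (z + t *\<^sub>R w) \<bullet> w) (at t)" if "\<bar>t\<bar> \<le> \<epsilon>" for t
        by (rule DERIV_along_line) (use Cu(2) line(1)[OF that] VD in blast)
      have DER2: "((\<lambda>t. p (z + t *\<^sub>R w) \<bullet> w) has_real_derivative H (z + t *\<^sub>R w) w \<bullet> w) (at t)" if "\<bar>t\<bar> \<le> \<epsilon>" for t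
      proof -
        have "(p has_derivative H (z + t *\<^sub>R w)) (at (z + t *\<^sub>R w))" using Cu(3) line(1)[OF that] VD by blast
        moreover have "linear (H (z + t *\<^sub>R w))" using Cu(5) line(1)[OF that] VD by blast
        ultimately have "((\<lambda>t. p (z + t *\<^sub>R w)) has_vector_derivative H (z + t *\<^sub>R w) w) (at t)"
          unfolding has_vector_derivative_def
          by (intro has_derivative_eq_rhs[OF has_derivative_compose[of "\<lambda>t. z + t *\<^sub>R w" "\<lambda>s. s *\<^sub>R w" t UNIV p "H (z + t *\<^sub>R w)"]])
             (auto intro!: derivative_eq_intros simp: linear_scale)
        then have "((\<lambda>t. p (z + t *\<^sub>R w) \<bullet> w) has_derivative (\<lambda>s. (s *\<^sub>R H (z + t *\<^sub>R w) w) \<bullet> w)) (at t)"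
          unfolding has_vector_derivative_def by (rule has_derivative_inner_left)
        then show ?thesis unfolding has_field_derivative_def by (simp add: mult.commute[of _ "H (z + t *\<^sub>R w) w \<bullet> w"])
      qed
      have Hw: "0 < H (z + t *\<^sub>R w) w \<bullet> w" if "\<bar>t\<bar> \<le> \<epsilon>" for t
      proof -
        have "linear (H (z + t *\<^sub>R w))" using Cu(5) line(1)[OF that] VD by blast
        then have "H (z + t *\<^sub>R w) w \<bullet> w = (\<theta> * \<theta>) * (H (z + t *\<^sub>R w) a \<bullet> a)"
          unfolding w_def by (simp add: linear_scale mult.assoc)
        then show ?thesis using V(4)[OF line(1)[OF that]] \<theta>(2) by simp
      qed
      have height: "c1 \<le> u (z + t *\<^sub>R w)" if "\<bar>t\<bar> \<le> \<epsilon>" "\<sigma> \<le> t" for t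
      proof -
        have "\<psi> (z + t *\<^sub>R w) \<le> 0" using line(2,3)[OF that(1)] that(2) by linarith
        then have "lift v u (z + t *\<^sub>R w) \<in> M" using G(9) line(1)[OF that(1)] VD by blast
        then show ?thesis using slab lu by metis
      qed
      have us: "u (z + \<sigma> *\<^sub>R w) = c1"
      proof -
        have "z + \<sigma> *\<^sub>R w \<in> W" "\<psi> (z + \<sigma> *\<^sub>R w) = 0" using line[of \<sigma>] \<sigma> V(3) by auto
        then show ?thesis using W(4) lu \<Gamma>1_height[OF \<Gamma>] by metis
      qed
      have pos: "0 < p (z + t *\<^sub>R w) \<bullet> w" if t: "\<bar>t\<bar> \<le> \<epsilon>" "\<sigma> < t" for t
      proof (rule ccontr)
        assume n: "\<not> 0 < p (z + t *\<^sub>R w) \<bullet> w"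
        \<comment> \<open>By convexity a nonpositive slope at \<open>t\<close> is preceded by
          negative slopes, so \<open>u\<close> would drop below its boundary value
          \<open>c1\<close>.\<close>
        have neg: "p (z + s *\<^sub>R w) \<bullet> w < 0" if s: "\<sigma> \<le> s" "s < t" for s
        proof -
          have "p (z + s *\<^sub>R w) \<bullet> w < p (z + t *\<^sub>R w) \<bullet> w"
          proof (rule DERIV_pos_imp_increasing[OF s(2)])
            fix r assume "s \<le> r" "r \<le> t"
            then have "\<bar>r\<bar> \<le> \<epsilon>" using s t \<sigma> by linarith
            then show "\<exists>y. DERIV (\<lambda>t. p (z + t *\<^sub>R w) \<bullet> w) r :> y \<and> 0 < y" using DER2 Hw by blast
          qed
          then show ?thesis using n by linarith
        qed
        have "u (z + t *\<^sub>R w) < u (z + \<sigma> *\<^sub>R w)"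
        proof (rule DERIV_neg_imp_decreasing_open[OF t(2)])
          show "\<exists>y. DERIV (\<lambda>t. u (z + t *\<^sub>R w)) s :> y \<and> y < 0" if "\<sigma> < s" "s < t" for s
          proof -
            have "\<bar>s\<bar> \<le> \<epsilon>" using that \<sigma> t by linarith
            then show ?thesis using DER neg[of s] that by (intro exI[of _ "p (z + s *\<^sub>R w) \<bullet> w"]) simp
          qed
          show "continuous_on {\<sigma>..t} (\<lambda>t. u (z + t *\<^sub>R w))"
            by (rule DERIV_continuous_on[OF has_field_derivative_at_within[OF DER]]) (use \<sigma> t in auto)
        qed
        then show False using height[OF t(1)] t(2) us by simp
      qed
      have cont: "continuous_on {-\<epsilon>..\<epsilon>} (\<lambda>t. u (z + t *\<^sub>R w))"
        by (rule DERIV_continuous_on[OF has_field_derivative_at_within[OF DER]]) auto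
      have mono: "u (z + t1 *\<^sub>R w) < u (z + t2 *\<^sub>R w)" if t: "\<sigma> \<le> t1" "t1 < t2" "t2 \<le> \<epsilon>" for t1 t2
      proof (rule DERIV_pos_imp_increasing_open[OF t(2)])
        fix r assume r: "t1 < r" "r < t2"
        then have "\<bar>r\<bar> \<le> \<epsilon>" "\<sigma> < r" using t \<sigma> by linarith+
        then show "\<exists>y. DERIV (\<lambda>t. u (z + t *\<^sub>R w)) r :> y \<and> 0 < y" using DER pos by blast
      next
        show "continuous_on {t1..t2} (\<lambda>t. u (z + t *\<^sub>R w))"
          by (rule continuous_on_subset[OF cont]) (use t \<sigma> in auto)
      qed
      have le: "\<psi> (z + t *\<^sub>R w) \<le> 0 \<longleftrightarrow> \<sigma> \<le> t" if "\<bar>t\<bar> \<le> \<epsilon>" for t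
        using line[OF that] by linarith
      show ?thesis unfolding rising_line_def using \<sigma> us line(1,2) VD pos le mono cont by blast
    qed
    then show ?thesis using T(1,2,3) by blast
  qed
  have "tangential x \<theta> R D u p H \<psi> g\<psi> H\<psi>"
    unfolding tangential_def using \<Gamma> g p \<theta>(1) main unfolding w_def by blast
  then show ?thesis by (rule that)
qed

end

section \<open>Pairs of points on lines orthogonal to the mirror\<close>

context symmetric_slab begin

text \<open>Over the tangent plane at \<open>q\<close> the function -(z . w) has a local minimum, so
  w = l e and the form of - l Hess u is semidefinite. The equation gives Hess u the trace v . e at
  \<open>q\<close>, whence v . w = l (v . e) \<le> 0.\<close>

lemma extremum_interior:
  assumes q: "q \<in> M" "q \<notin> bd" and V: "open V" "q \<in> V" and mx: "\<And>z. z \<in> M \<Longrightarrow> z \<in> V \<Longrightarrow> z \<bullet> w \<le> q \<bullet> w"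
  shows "\<exists>k. w = k *\<^sub>R nu q" "v \<bullet> w \<le> 0"
proof -
  have n0: "nu q \<noteq> 0" by (rule nu_nonzero[OF q(1)])
  define e where "e = nu q /\<^sub>R norm (nu q)"
  have e: "norm e = 1" "nu q = norm (nu q) *\<^sub>R e" "nu q \<bullet> e \<noteq> 0" using n0 by (auto simp: e_def dot_square_norm)
  have ee: "e \<bullet> e = 1" using e(1) by (simp add: dot_square_norm)
  obtain R D u p H \<psi> g\<psi> H\<psi> where g: "graph_at q e R D u p H \<psi> g\<psi> H\<psi>"
    by (rule graph_at_exists[OF q(1) e(1,3)]) (rule that)
  note G = graph_at_D[OF g]
  note Cu = C2_D[OF G(3)]
  have p: "p q = 0" by (rule horizontal_gradient[OF g e(2)])
  have lq: "lift e u q = q" by (rule G(17)) (use G(1) q in auto)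
  have lM: "lift e u z \<in> M" if "z \<in> D" for z using G(9,15) q(2) that by fastforce
  define l where "l = w \<bullet> e"
  define h where "h = (\<lambda>z. - (lift e u z \<bullet> w))"
  have hC: "C2 D h (\<lambda>z. l *\<^sub>R e - w - l *\<^sub>R p z) (\<lambda>z k. - (l *\<^sub>R H z k))"
    unfolding C2_def
  proof (intro conjI ballI allI)
    fix z assume z: "z \<in> D"
    have "(h has_derivative (\<lambda>k. - ((k - (k \<bullet> e) *\<^sub>R e + (p z \<bullet> k) *\<^sub>R e) \<bullet> w))) (at z)"
      unfolding h_def by (intro has_derivative_minus has_derivative_inner_left has_derivative_lift Cu(2)[OF z])
    then show "(h has_derivative (\<bullet>) (l *\<^sub>R e - w - l *\<^sub>R p z)) (at z)"
      by (rule has_derivative_eq_rhs)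
         (auto simp: fun_eq_iff l_def inner_add_left inner_diff_left inner_commute algebra_simps)
    show "((\<lambda>z. l *\<^sub>R e - w - l *\<^sub>R p z) has_derivative (\<lambda>k. - (l *\<^sub>R H z k))) (at z)"
      by (auto intro!: derivative_eq_intros Cu(3)[OF z])
  qed (auto intro!: continuous_intros Cu(1,4))
  define W where "W = D \<inter> lift e u -` V"
  have oW: "open W" unfolding W_def
    by (rule continuous_open_preimage[OF continuous_on_lift[OF G(3)] Cu(1) V(1)])
  have qW: "q \<in> W" "W \<subseteq> D" unfolding W_def using G(5) lq V(2) by auto
  have "h q \<le> h z" if "z \<in> W" for z
    unfolding h_def using mx[of "lift e u z"] lM[of z] that lq unfolding W_def by auto
  note lm = C2_local_min[OF hC G(5) qW(2) oW qW(1) this]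
  have w: "w = l *\<^sub>R e" using lm(1) p by simp
  then have "w = (l / norm (nu q)) *\<^sub>R nu q" using n0 by (subst e(2)) simp
  then show "\<exists>k. w = k *\<^sub>R nu q" by blast
  have lin: "linear (H q)" by (rule Cu(5)[OF G(5)])
  have "0 \<le> Aop 0 (\<lambda>k. - (l *\<^sub>R H q k))"
    by (rule Aop_nonneg[OF C2_D(5)[OF hC G(5)] lm(2)])
  then have "l * tr (H q) \<le> 0" unfolding Aop_def tr_minus tr_scale by (simp add: linear_0[OF lin])
  moreover have "Qop v e (p q) (H q) = 0" by (rule G(11)[OF G(5)]) (simp add: lq q)
  then have "tr (H q) = v \<bullet> e" unfolding Qop_def Aop_def p by (simp add: linear_0[OF lin])
  ultimately show "v \<bullet> w \<le> 0" by (subst w) simp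
qed

text \<open>An interior point at the top would be a maximum for w = v, where v . w = 1.\<close>

lemma no_interior_top: "x \<in> M \<Longrightarrow> x \<notin> bd \<Longrightarrow> x \<bullet> v \<noteq> c2"
  using extremum_interior(2)[of x UNIV v] slab vv by auto

lemma interior_bottom_horizontal:
  assumes "x \<in> M" "x \<notin> bd" "x \<bullet> v = c1"
  obtains c where "c \<noteq> 0" "nu x = c *\<^sub>R v"
proof -
  have "\<exists>k. - v = k *\<^sub>R nu x"
    by (rule extremum_interior(1)[OF assms(1,2), of UNIV]) (use slab assms in auto)
  then obtain k where k: "- v = k *\<^sub>R nu x" by blast
  then have k0: "k \<noteq> 0" using v_unit by auto
  have "nu x = (1/k) *\<^sub>R (k *\<^sub>R nu x)" using k0 by simp
  then have "nu x = (-1/k) *\<^sub>R v" unfolding k[symmetric] by simp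
  then show ?thesis using k0 by (intro that[of "-1/k"]) auto
qed

text \<open>Limits of pairs of distinct points of \<open>M\<close> on a line in direction \<open>a\<close> may be double points: interior
  points at which \<open>M\<close> is tangent to \<open>a\<close>. They count as pairs with \<open>s = 0\<close>.\<close>

definition bad_pair :: "real \<Rightarrow> 'a \<Rightarrow> 'a \<Rightarrow> bool" where
  "bad_pair s x y \<longleftrightarrow> x \<in> M \<and> y \<in> M \<and> x = y + s *\<^sub>R a \<and> 0 \<le> s \<and> (s = 0 \<longrightarrow> y \<notin> bd \<and> nu y \<bullet> a = 0)"

lemma tangential_lines:
  assumes "tangential x \<theta> R D u p H \<psi> g\<psi> H\<psi>" "\<epsilon>0 > 0"
  obtains \<epsilon> \<delta> where "0 < \<epsilon>" "\<epsilon> \<le> \<epsilon>0" "\<delta> > 0" "\<And>z. z \<in> ball x \<delta> \<Longrightarrow> \<exists>\<sigma>. rising_line D u p \<psi> (\<theta> *\<^sub>R a) \<epsilon> z \<sigma>"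
  using assms unfolding tangential_def by blast

text \<open>Either M is a graph in direction \<open>a\<close> near \<open>x\<close>, or
  \<open>x\<close> is tangential and heights rise strictly along lines in direction
  \<open>a\<close>, whereas the points of a pair have equal height. Hence sequences of pairs cannot
  collapse at such an \<open>x\<close>.\<close>

lemma no_bad_pair_nearby:
  assumes x: "x \<in> M" and c: "x \<in> bd \<and> b < x \<bullet> a \<or> nu x \<bullet> a \<noteq> 0"
  obtains \<rho> where "\<rho> > 0" "\<And>s z y. bad_pair s z y \<Longrightarrow> z \<in> ball x \<rho> \<Longrightarrow> y \<in> ball x \<rho> \<Longrightarrow> False"
proof (cases "nu x \<bullet> a = 0")
  case False
  obtain R D u p H \<psi> g\<psi> H\<psi> where g: "graph_at x a R D u p H \<psi> g\<psi> H\<psi>"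
    by (rule graph_at_exists[OF x a_unit False]) (rule that)
  note G = graph_at_D[OF g]
  show ?thesis
  proof (rule that[OF G(1)])
    fix s z y assume bp: "bad_pair s z y" and z: "z \<in> ball x R" and y: "y \<in> ball x R"
    have M: "z \<in> M" "y \<in> M" "z = y + s *\<^sub>R a" using bp unfolding bad_pair_def by auto
    have zu: "z \<bullet> a = u z" and yu: "y \<bullet> a = u y" "y \<in> D" using G(13)[OF z M(1)] G(13)[OF y M(2)] by auto
    have "u z = u y" using G(4) yu(2) M(3) unfolding cylindrical_def by simp
    then have "s = 0" using zu yu M(3) aa by (simp add: inner_add_left)
    then have v: "y \<notin> bd" "nu y \<bullet> a = 0" using bp unfolding bad_pair_def by auto
    have ly: "lift a u y = y" by (rule G(17)[OF y M(2)])
    have "\<psi> y < 0" using G(9,10)[OF yu(2)] ly M(2) v(1) by force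
    then obtain d where d: "d \<noteq> 0" "nu y = d *\<^sub>R (a - p y)" using G(12)[OF yu(2)] ly by auto
    have "p y \<bullet> a = 0" by (rule cylindrical_C2(1)[OF G(3,4) yu(2)])
    then show False using v(2) d aa by (simp add: inner_diff_left)
  qed
next
  case na: True
  then have xb: "x \<in> bd" "x \<bullet> a > b" using c by auto
  obtain \<theta> R D u p H \<psi> g\<psi> H\<psi> where t: "tangential x \<theta> R D u p H \<psi> g\<psi> H\<psi>"
    by (rule tangential_exists[OF xb na]) (rule that)
  have g: "graph_at x v R D u p H \<psi> g\<psi> H\<psi>" and \<theta>: "\<bar>\<theta>\<bar> = 1" using t unfolding tangential_def by auto
  have \<theta>2: "\<theta> * \<theta> = 1" using \<theta> by (metis abs_mult_self_eq mult_1)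
  note G = graph_at_D[OF g]
  define w where "w = \<theta> *\<^sub>R a"
  obtain \<epsilon> \<delta> where E: "0 < \<epsilon>" "\<epsilon> \<le> 1" "\<delta> > 0"
    "\<And>z. z \<in> ball x \<delta> \<Longrightarrow> \<exists>\<sigma>. rising_line D u p \<psi> w \<epsilon> z \<sigma>"
    by (rule tangential_lines[OF t zero_less_one, folded w_def]) (rule that)
  define \<rho> where "\<rho> = min (min R \<delta>) (\<epsilon> / 2)"
  have \<rho>: "\<rho> > 0" "\<rho> \<le> R" "\<rho> \<le> \<delta>" "2 * \<rho> \<le> \<epsilon>" unfolding \<rho>_def using G(1) E by auto
  show ?thesis
  proof (rule that[OF \<rho>(1)])
    fix s z y assume bp: "bad_pair s z y" and z: "z \<in> ball x \<rho>" and y: "y \<in> ball x \<rho>"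
    have M: "z \<in> M" "y \<in> M" "z = y + s *\<^sub>R a" "0 \<le> s" using bp unfolding bad_pair_def by auto
    have zR: "z \<in> ball x R" and yR: "y \<in> ball x R" and y\<delta>: "y \<in> ball x \<delta>" using z y \<rho> by auto
    have "norm (z - y) = s" using M a_unit by simp
    moreover have "norm (z - y) \<le> dist x z + dist x y" by (metis dist_commute dist_norm dist_triangle2)
    ultimately have s\<epsilon>: "s \<le> \<epsilon>" using z y \<rho>(4) by auto
    have zw: "z = y + (s * \<theta>) *\<^sub>R w" unfolding w_def using M(3) \<theta>2 by (simp add: mult.assoc)
    have s\<theta>: "\<bar>s * \<theta>\<bar> \<le> \<epsilon>" using s\<epsilon> M(4) \<theta> by (simp add: abs_mult)
    obtain \<sigma> where \<sigma>: "\<bar>\<sigma>\<bar> < \<epsilon>" and T: "\<And>t. \<bar>t\<bar> \<le> \<epsilon> \<Longrightarrow> y + t *\<^sub>R w \<in> D \<and> (\<psi> (y + t *\<^sub>R w) = 0 \<longleftrightarrow> t = \<sigma>) \<and>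
          (\<psi> (y + t *\<^sub>R w) \<le> 0 \<longleftrightarrow> \<sigma> \<le> t) \<and> (\<sigma> < t \<longrightarrow> 0 < p (y + t *\<^sub>R w) \<bullet> w)"
      and mono: "\<And>t1 t2. \<sigma> \<le> t1 \<Longrightarrow> t1 < t2 \<Longrightarrow> t2 \<le> \<epsilon> \<Longrightarrow> u (y + t1 *\<^sub>R w) < u (y + t2 *\<^sub>R w)"
      using E(4)[OF y\<delta>] unfolding rising_line_def by blast
    have ly: "lift v u y = y" and lz: "lift v u z = z" using G(17) yR zR M by auto
    have yz: "y \<in> D" "z \<in> D" "u y = y \<bullet> v" "u z = z \<bullet> v" using G(13) yR zR M(1,2) by auto
    have "\<sigma> \<le> 0" using T[of 0] E(1) G(9)[OF yz(1)] ly M(2) by simp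
    moreover have "\<sigma> \<le> s * \<theta>" using T[OF s\<theta>] G(9)[OF yz(2)] lz M(1) zw by simp
    moreover have "u z = u y" using yz(3,4) M(3) av by (simp add: inner_add_left)
    ultimately have "s * \<theta> = 0" using mono[of 0 "s * \<theta>"] mono[of "s * \<theta>" 0] s\<theta> E(1) zw
      by (cases "s * \<theta>" "0::real" rule: linorder_cases) (auto simp: abs_le_iff)
    then have "s = 0" using \<theta> by auto
    then have vy: "y \<notin> bd" "nu y \<bullet> a = 0" using bp unfolding bad_pair_def by auto
    have \<psi>y: "\<psi> y < 0" using G(9,10)[OF yz(1)] ly M(2) vy(1) by force
    then obtain d where d: "d \<noteq> 0" "nu y = d *\<^sub>R (v - p y)" using G(12)[OF yz(1)] ly by auto
    have "p y \<bullet> a = 0" using vy(2) d va by (simp add: inner_diff_left)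
    moreover have "\<sigma> < 0" using T[of 0] E(1) \<psi>y by (cases "\<sigma> = 0") auto
    then have "0 < p y \<bullet> w" using T[of 0] E(1) by simp
    ultimately show False unfolding w_def by simp
  qed
qed

text \<open>In the graph case the point sought is \<open>lift a u z\<close>. At a tangential point
  the height over the line starts at \<open>c1\<close> and at the far end exceeds the height of
  every \<open>z\<close> near \<open>x\<close>, so it equals the height of \<open>z\<close> in
  between. The resulting points are candidates for mirror images.\<close>

lemma open_projection:
  assumes x: "x \<in> M" and c: "x \<in> bd \<and> b < x \<bullet> a \<or> nu x \<bullet> a \<noteq> 0" and \<epsilon>0: "\<epsilon>0 > 0"
  obtains \<delta> where "\<delta> > 0" "\<And>z. z \<in> ball x \<delta> \<Longrightarrow> c1 \<le> z \<bullet> v \<Longrightarrow> z \<bullet> v \<le> c2 \<Longrightarrow> \<exists>\<sigma>. \<bar>\<sigma>\<bar> < \<epsilon>0 \<and> z + \<sigma> *\<^sub>R a \<in> M"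
proof (cases "nu x \<bullet> a = 0")
  case False
  obtain R D u p H \<psi> g\<psi> H\<psi> where g: "graph_at x a R D u p H \<psi> g\<psi> H\<psi>"
    by (rule graph_at_exists[OF x a_unit False]) (rule that)
  note G = graph_at_D[OF g]
  obtain \<rho> where \<rho>: "\<rho> > 0" "ball x \<rho> \<subseteq> D"
    "\<And>z. z \<in> ball x \<rho> \<Longrightarrow> c1 \<le> z \<bullet> v \<Longrightarrow> z \<bullet> v \<le> c2 \<Longrightarrow> lift a u z \<in> M"
    by (rule graph_over_slab[OF g x]) (rule that)
  define W where "W = D \<inter> (\<lambda>z. u z - z \<bullet> a) -` {-\<epsilon>0<..<\<epsilon>0}"
  have "open W" unfolding W_def
    by (rule continuous_open_preimage[OF _ C2_D(1)[OF G(3)] open_greaterThanLessThan])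
       (intro continuous_intros C2_D(6)[OF G(3)])
  moreover have "x \<in> W" unfolding W_def using G(5) G(13)[of x] G(1) x \<epsilon>0 by auto
  ultimately obtain \<rho>' where \<rho>': "\<rho>' > 0" "ball x \<rho>' \<subseteq> W" using openE by blast
  show ?thesis
  proof (rule that[of "min \<rho> \<rho>'"])
    show "min \<rho> \<rho>' > 0" using \<rho> \<rho>' by simp
    fix z assume z: "z \<in> ball x (min \<rho> \<rho>')" "c1 \<le> z \<bullet> v" "z \<bullet> v \<le> c2"
    have "lift a u z \<in> M" using \<rho>(3) z by simp
    moreover have "lift a u z = z + (u z - z \<bullet> a) *\<^sub>R a" unfolding lift_def by (simp add: algebra_simps)
    moreover have "z \<in> W" using \<rho>'(2) z by auto
    then have "\<bar>u z - z \<bullet> a\<bar> < \<epsilon>0" unfolding W_def by auto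
    ultimately show "\<exists>\<sigma>. \<bar>\<sigma>\<bar> < \<epsilon>0 \<and> z + \<sigma> *\<^sub>R a \<in> M" by metis
  qed
next
  case na: True
  then have xb: "x \<in> bd" "x \<bullet> a > b" using c by auto
  obtain \<theta> R D u p H \<psi> g\<psi> H\<psi> where t: "tangential x \<theta> R D u p H \<psi> g\<psi> H\<psi>"
    by (rule tangential_exists[OF xb na]) (rule that)
  have g: "graph_at x v R D u p H \<psi> g\<psi> H\<psi>" and \<theta>: "\<bar>\<theta>\<bar> = 1" and \<Gamma>: "x \<in> \<Gamma>1" using t unfolding tangential_def by auto
  note G = graph_at_D[OF g]
  define w where "w = \<theta> *\<^sub>R a"
  have wv: "w \<bullet> v = 0" unfolding w_def using av by simp
  obtain \<epsilon> \<delta> where E: "0 < \<epsilon>" "\<epsilon> \<le> \<epsilon>0 / 2" "\<delta> > 0"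
    "\<And>z. z \<in> ball x \<delta> \<Longrightarrow> \<exists>\<sigma>. rising_line D u p \<psi> w \<epsilon> z \<sigma>"
    by (rule tangential_lines[OF t half_gt_zero[OF \<epsilon>0], folded w_def]) (rule that)
  have inD: "z + \<epsilon> *\<^sub>R w \<in> D" if "z \<in> ball x \<delta>" for z using E(4)[OF that] E(1) unfolding rising_line_def by (metis abs_of_pos order_refl)
  define W where "W = ball x \<delta> \<inter> (\<lambda>z. u (z + \<epsilon> *\<^sub>R w) - z \<bullet> v) -` {0<..}"
  have "continuous_on (ball x \<delta>) (\<lambda>z. u (z + \<epsilon> *\<^sub>R w))"
    by (rule continuous_on_compose2[OF C2_D(6)[OF G(3)]]) (use inD in \<open>auto intro!: continuous_intros\<close>)
  then have "open W" unfolding W_def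
    by (intro continuous_open_preimage continuous_intros open_ball open_greaterThan)
  moreover have "x \<in> W"
  proof -
    have xd: "x \<in> ball x \<delta>" using E(3) by simp
    obtain \<sigma> where \<sigma>: "\<bar>\<sigma>\<bar> < \<epsilon>" "u (x + \<sigma> *\<^sub>R w) = c1"
      and mono: "\<And>t1 t2. \<sigma> \<le> t1 \<Longrightarrow> t1 < t2 \<Longrightarrow> t2 \<le> \<epsilon> \<Longrightarrow> u (x + t1 *\<^sub>R w) < u (x + t2 *\<^sub>R w)"
      using E(4)[OF xd] unfolding rising_line_def by blast
    have "c1 < u (x + \<epsilon> *\<^sub>R w)" using mono[of \<sigma> \<epsilon>] \<sigma> by auto
    then show ?thesis unfolding W_def using xd \<Gamma>1_height[OF \<Gamma>] by simp
  qed
  ultimately obtain \<rho> where \<rho>: "\<rho> > 0" "ball x \<rho> \<subseteq> W" using openE by blast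
  show ?thesis
  proof (rule that[OF \<rho>(1)])
    fix z assume z: "z \<in> ball x \<rho>" "c1 \<le> z \<bullet> v" "z \<bullet> v \<le> c2"
    have zd: "z \<in> ball x \<delta>" "z \<bullet> v < u (z + \<epsilon> *\<^sub>R w)" using \<rho>(2) z unfolding W_def by auto
    obtain \<sigma> where \<sigma>: "\<bar>\<sigma>\<bar> < \<epsilon>" "u (z + \<sigma> *\<^sub>R w) = c1"
      and T: "\<And>t. \<bar>t\<bar> \<le> \<epsilon> \<Longrightarrow> z + t *\<^sub>R w \<in> D \<and> (\<psi> (z + t *\<^sub>R w) \<le> 0 \<longleftrightarrow> \<sigma> \<le> t)"
      and cont: "continuous_on {-\<epsilon>..\<epsilon>} (\<lambda>t. u (z + t *\<^sub>R w))"
      using E(4)[OF zd(1)] unfolding rising_line_def by blast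
    have "\<exists>t\<ge>\<sigma>. t \<le> \<epsilon> \<and> u (z + t *\<^sub>R w) = z \<bullet> v"
    proof (rule IVT')
      show "continuous_on {\<sigma>..\<epsilon>} (\<lambda>t. u (z + t *\<^sub>R w))" by (rule continuous_on_subset[OF cont]) (use \<sigma> in auto)
    qed (use \<sigma> z zd in auto)
    then obtain t where t: "\<sigma> \<le> t" "t \<le> \<epsilon>" "u (z + t *\<^sub>R w) = z \<bullet> v" by blast
    have ta: "\<bar>t\<bar> \<le> \<epsilon>" using t \<sigma> by linarith
    have "lift v u (z + t *\<^sub>R w) = z + t *\<^sub>R w"
      by (rule lift_self) (use t(3) wv in \<open>simp add: inner_add_left\<close>)
    then have "z + t *\<^sub>R w \<in> M" using T[OF ta] t(1) G(9) by metis
    then have "z + (t * \<theta>) *\<^sub>R a \<in> M" unfolding w_def by simp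
    moreover have "\<bar>t * \<theta>\<bar> < \<epsilon>0" using ta E(1,2) \<theta> by (simp add: abs_mult)
    ultimately show "\<exists>\<sigma>. \<bar>\<sigma>\<bar> < \<epsilon>0 \<and> z + \<sigma> *\<^sub>R a \<in> M" by blast
  qed
qed

text \<open>If the lower point of a pair is a double point, moving along \<open>M\<close> in direction \<open>a\<close> from it moves the
  partner only to second order, so the midpoint can be increased.\<close>

lemma raise_midpoint:
  assumes y: "y \<in> M" "y \<notin> bd" "nu y \<bullet> a = 0" and x: "x \<in> M" "x = y + s *\<^sub>R a" "s > 0" and nx: "nu x \<bullet> a \<noteq> 0"
  obtains s' x' y' where "bad_pair s' x' y'" "x \<bullet> a + y \<bullet> a < x' \<bullet> a + y' \<bullet> a"
proof -
  obtain R0 F g HF \<phi> g\<phi> H\<phi> where ld: "level_data y R0 F g HF \<phi> g\<phi> H\<phi>" "nu y = g y"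
    by (rule nu_level_data[OF y(1)]) (rule that)
  have F: "0 < R0" "C2 (ball y R0) F g HF" "g y \<noteq> 0" "F y = 0"
    "\<And>z. z \<in> ball y R0 \<Longrightarrow> F z = 0 \<Longrightarrow> z \<in> M"
    using ld(1) y unfolding level_data_def by (auto intro: less_imp_le)
  obtain R D u p H \<psi> g\<psi> H\<psi> where gr: "graph_at x a R D u p H \<psi> g\<psi> H\<psi>"
    by (rule graph_at_exists[OF x(1) a_unit nx]) (rule that)
  note G = graph_at_D[OF gr]
  obtain \<rho> where \<rho>: "\<rho> > 0" "ball x \<rho> \<subseteq> D"
    "\<And>z. z \<in> ball x \<rho> \<Longrightarrow> c1 \<le> z \<bullet> v \<Longrightarrow> z \<bullet> v \<le> c2 \<Longrightarrow> lift a u z \<in> M"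
    by (rule graph_over_slab[OF gr x(1)]) (rule that)
  have ux: "u x = x \<bullet> a" using G(13)[of x] G(1) x(1) by simp
  have pa: "p x \<bullet> a = 0" by (rule cylindrical_C2(1)[OF G(3,4,5)])
  \<comment> \<open>For secant directions \<open>k\<close> within \<eta> of \<open>a\<close>, the
    derivative of \<open>u\<close> along \<open>k\<close> equals
    \<open>p x \<bullet> (k - a)\<close> and is at most 1/4 in absolute value.\<close>
  define \<eta> where "\<eta> = 1 / (4 * (1 + norm (p x)))"
  have \<eta>: "\<eta> > 0" "\<eta> \<le> 1/4" "norm (p x) * \<eta> \<le> 1/4"
    unfolding \<eta>_def by (auto simp: add_pos_nonneg divide_simps)
  obtain d where d: "d > 0" "\<And>z. norm (z - x) < d \<Longrightarrow> norm (u z - u x - p x \<bullet> (z - x)) \<le> 1/8 * norm (z - x)"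
    using C2_D(2)[OF G(3,5)] unfolding has_derivative_at_alt by (metis zero_less_divide_1_iff zero_less_numeral)
  have ag: "a \<bullet> g y = 0" using y(3) ld(2) by (simp add: inner_commute)
  have yb: "y \<in> ball y R0" using F(1) by simp
  obtain s0 where s0: "s0 > 0" "\<And>t. 0 < t \<Longrightarrow> t < s0 \<Longrightarrow> \<exists>k. norm (k - a) < \<eta> \<and> y + t *\<^sub>R k \<in> ball y R0 \<and> F (y + t *\<^sub>R k) = 0"
    by (rule zero_set_tangent[OF F(2) yb F(4,3) ag \<eta>(1)]) (rule that)
  \<comment> \<open>The bound \<open>3 * t < s\<close> keeps the two new points distinct and in the
    same order.\<close>
  define t where "t = min (s0/2) (min (min \<rho> d / 3) (s / 4))"
  have t: "0 < t" "t < s0" "2 * t < \<rho>" "2 * t < d" "3 * t < s" unfolding t_def using s0 \<rho> d x(3) by auto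
  obtain k where k: "norm (k - a) < \<eta>" "y + t *\<^sub>R k \<in> ball y R0" "F (y + t *\<^sub>R k) = 0" using s0(2)[OF t(1,2)] by blast
  have k2: "norm k \<le> 5/4" using k(1) \<eta>(2) a_unit norm_triangle_sub[of k a] by linarith
  have ka: "\<bar>k \<bullet> a - 1\<bar> \<le> 1/4"
  proof -
    have "k \<bullet> a - 1 = (k - a) \<bullet> a" using aa by (simp add: inner_diff_left)
    also have "\<bar>\<dots>\<bar> \<le> norm (k - a) * norm a" by (rule Cauchy_Schwarz_ineq2)
    finally show ?thesis using k(1) \<eta>(2) a_unit by simp
  qed
  define y' where "y' = y + t *\<^sub>R k"
  have y'M: "y' \<in> M" unfolding y'_def by (rule F(5)[OF k(2,3)])
  define z where "z = x + t *\<^sub>R k"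
  have "norm (z - x) = t * norm k" unfolding z_def using t by simp
  also have "\<dots> \<le> t * (5/4)" using k2 t by (intro mult_left_mono) auto
  finally have zx: "norm (z - x) \<le> t * (5/4)" .
  have z\<rho>: "z \<in> ball x \<rho>" using zx t by (simp add: dist_norm norm_minus_commute)
  have zy: "z = y' + s *\<^sub>R a" unfolding z_def y'_def x(2) by simp
  have zv: "z \<bullet> v = y' \<bullet> v" unfolding zy using av by (simp add: inner_add_left)
  define x' where "x' = lift a u z"
  have x'M: "x' \<in> M" unfolding x'_def by (rule \<rho>(3)[OF z\<rho>]) (use zv slab[OF y'M] in auto)
  have x'a: "x' \<bullet> a = u z" unfolding x'_def by (rule lift_inner[OF a_unit])
  have "norm (u z - u x - p x \<bullet> (z - x)) \<le> 1/8 * norm (z - x)" by (rule d(2)) (use zx t in linarith)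
  moreover have "\<bar>p x \<bullet> (z - x)\<bar> \<le> t * (1/4)"
  proof -
    have "p x \<bullet> (z - x) = t * (p x \<bullet> (k - a))" unfolding z_def using pa by (simp add: inner_diff_right)
    also have "\<bar>\<dots>\<bar> = t * \<bar>p x \<bullet> (k - a)\<bar>" using t by (simp add: abs_mult)
    also have "\<bar>p x \<bullet> (k - a)\<bar> \<le> norm (p x) * norm (k - a)" by (rule Cauchy_Schwarz_ineq2)
    also have "\<dots> \<le> norm (p x) * \<eta>" using k(1) by (intro mult_left_mono) auto
    also have "\<dots> \<le> 1/4" by (rule \<eta>(3))
    finally show ?thesis using t by simp
  qed
  \<comment> \<open>The \<open>a\<close> component of the upper point changes by at most t/4 +
    (1/8)(5/4) t < t/2, that of the lower point grows by at least 3t/4; the sum gains at least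
    t/4.\<close>
  ultimately have uz: "\<bar>u z - u x\<bar> \<le> t / 2" using zx unfolding real_norm_def by linarith
  have y'a: "y' \<bullet> a = y \<bullet> a + t * (k \<bullet> a)" unfolding y'_def by (simp add: inner_add_left)
  have tk: "t * (3/4) \<le> t * (k \<bullet> a)" "t * (k \<bullet> a) \<le> t * (5/4)"
  proof -
    have "3/4 \<le> k \<bullet> a" "k \<bullet> a \<le> 5/4" using ka by linarith+
    then show "t * (3/4) \<le> t * (k \<bullet> a)" "t * (k \<bullet> a) \<le> t * (5/4)" using t(1) by (auto intro!: mult_left_mono)
  qed
  have xa: "x \<bullet> a = y \<bullet> a + s" unfolding x(2) using aa by (simp add: inner_add_left)
  define s' where "s' = x' \<bullet> a - y' \<bullet> a"
  have "s' > 0" unfolding s'_def x'a y'a using uz ux xa tk t by linarith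
  moreover have "x' = y' + s' *\<^sub>R a"
  proof -
    have e1: "x' = z + (u z - z \<bullet> a) *\<^sub>R a" unfolding x'_def lift_def by (simp add: algebra_simps)
    have e2: "z \<bullet> a = y' \<bullet> a + s" unfolding zy using aa by (simp add: inner_add_left)
    have "z + (r - (q + s)) *\<^sub>R a = y' + (r - q) *\<^sub>R a" for r q
      unfolding zy by (simp add: algebra_simps)
    then show ?thesis unfolding s'_def x'a using e1 e2 by simp
  qed
  ultimately have "bad_pair s' x' y'" unfolding bad_pair_def using x'M y'M by auto
  moreover have "x \<bullet> a + y \<bullet> a < x' \<bullet> a + y' \<bullet> a"
    unfolding x'a y'a using uz ux tk(1) t(1) by linarith
  ultimately show ?thesis by (rule that)
qed

end

section \<open>The moving plane\<close>

lemma reflect_diff: "reflect a t x - reflect a t y = reflect a 0 (x - y)"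
  by (simp add: reflect_def inner_diff_left algebra_simps)

lemma reflect_dist:
  assumes "norm a = 1"
  shows "dist (reflect a t x) (reflect a t y) = dist x y"
proof -
  have "(reflect a 0 h) \<bullet> (reflect a 0 h) = h \<bullet> h" for h
  proof -
    have "a \<bullet> a = 1" using assms by (simp add: dot_square_norm)
    then show ?thesis unfolding reflect_def
      by (simp add: inner_diff_left inner_diff_right inner_commute[of a h] algebra_simps)
  qed
  then have "norm (reflect a 0 (x - y)) = norm (x - y)" by (simp add: norm_eq_sqrt_inner)
  then show ?thesis by (simp add: dist_norm reflect_diff)
qed

lemma reflect_reflect: "norm a = 1 \<Longrightarrow> reflect a t (reflect a t x) = x"
  by (simp add: reflect_def inner_diff_left dot_square_norm algebra_simps)

lemma reflect0_inner: "reflect a 0 x \<bullet> y = x \<bullet> reflect a 0 y"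
  by (simp add: reflect_def inner_diff_left inner_diff_right inner_commute algebra_simps)

lemma norm_reflect0: "norm a = 1 \<Longrightarrow> norm (reflect a 0 x) = norm x"
  using reflect_dist[of a 0 x 0] by (simp add: reflect_def)

lemma continuous_on_reflect: "continuous_on S (reflect a t)"
  unfolding reflect_def by (intro continuous_intros)

lemma has_derivative_reflect: "(reflect a t has_derivative reflect a 0) (at x)"
  unfolding reflect_def[abs_def] by (auto intro!: derivative_eq_intros)

lemma C2_reflect:
  assumes u: "C2 U u p H"
  shows "C2 (reflect a t -` U) (\<lambda>z. u (reflect a t z)) (\<lambda>z. reflect a 0 (p (reflect a t z)))
    (\<lambda>z h. reflect a 0 (H (reflect a t z) (reflect a 0 h)))"
proof -
  note C = C2_D[OF u]
  show ?thesis
    unfolding C2_def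
  proof (intro conjI ballI allI)
    show "open (reflect a t -` U)" by (rule open_vimage[OF C(1) continuous_on_reflect])
    fix z assume "z \<in> reflect a t -` U"
    then have z: "reflect a t z \<in> U" by simp
    have "((\<lambda>z. u (reflect a t z)) has_derivative (\<lambda>h. p (reflect a t z) \<bullet> reflect a 0 h)) (at z)"
      by (rule has_derivative_compose[OF has_derivative_reflect C(2)[OF z]])
    then show "((\<lambda>z. u (reflect a t z)) has_derivative (\<bullet>) (reflect a 0 (p (reflect a t z)))) (at z)"
      by (rule has_derivative_eq_rhs) (auto simp: fun_eq_iff reflect0_inner)
    have 1: "((\<lambda>z. p (reflect a t z)) has_derivative (\<lambda>h. H (reflect a t z) (reflect a 0 h))) (at z)"
      by (rule has_derivative_compose[OF has_derivative_reflect C(3)[OF z]])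
    show "((\<lambda>z. reflect a 0 (p (reflect a t z))) has_derivative (\<lambda>h. reflect a 0 (H (reflect a t z) (reflect a 0 h)))) (at z)"
      by (rule has_derivative_compose[OF 1 has_derivative_reflect])
  next
    fix h
    show "continuous_on (reflect a t -` U) (\<lambda>z. reflect a 0 (H (reflect a t z) (reflect a 0 h)))"
      by (rule continuous_on_compose2[OF continuous_on_reflect[of UNIV]
            continuous_on_compose2[OF C(4) continuous_on_reflect]]) auto
  qed
qed

lemma tr_reflect:
  assumes a: "norm a = 1" and l: "linear L"
  shows "tr (\<lambda>h. reflect a 0 (L (reflect a 0 h))) = tr L"
proof -
  have aa: "a \<bullet> a = 1" using a by (simp add: dot_square_norm)
  have "tr (\<lambda>h. reflect a 0 (L (reflect a 0 h))) = (\<Sum>i\<in>Basis. L (reflect a 0 i) \<bullet> reflect a 0 i)"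
    unfolding tr_def by (simp add: reflect0_inner)
  also have "\<dots> = (\<Sum>i\<in>Basis. L i \<bullet> i - 2 * (((a \<bullet> i) *\<^sub>R L i) \<bullet> a) - 2 * ((a \<bullet> i) * (L a \<bullet> i)) + 4 * ((a \<bullet> i) * (a \<bullet> i)) * (L a \<bullet> a))"
    unfolding reflect_def
    by (intro sum.cong refl)
       (simp add: linear_diff[OF l] linear_scale[OF l] inner_diff_left inner_diff_right inner_commute[of a] algebra_simps)
  also have "\<dots> = tr L - 2 * ((\<Sum>i\<in>Basis. (a \<bullet> i) *\<^sub>R L i) \<bullet> a) - 2 * (\<Sum>i\<in>Basis. (a \<bullet> i) * (L a \<bullet> i))
      + 4 * (\<Sum>i\<in>Basis. (a \<bullet> i) * (a \<bullet> i)) * (L a \<bullet> a)"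
    unfolding tr_def inner_sum_left by (simp add: sum.distrib sum_subtractf sum_distrib_left sum_distrib_right mult.assoc)
  also have "\<dots> = tr L"
    unfolding tr_compose_inner[OF l] euclidean_inner[symmetric] using aa by (simp add: inner_commute)
  finally show ?thesis .
qed

text \<open>The linear reflection fixes \<open>v\<close> and \<open>e\<close>, and it preserves
  norm, trace and the value of the Hessian form on the gradient.\<close>

lemma Qop_reflect:
  assumes a: "norm a = 1" and l: "linear L" and v: "v \<bullet> a = 0" and e: "e \<bullet> a = 0"
  shows "Qop v e (reflect a 0 p) (\<lambda>h. reflect a 0 (L (reflect a 0 h))) = Qop v e p L"
proof -
  have "reflect a 0 v = v" using v by (simp add: reflect_def)
  then have "v \<bullet> reflect a 0 p = v \<bullet> p" by (metis reflect0_inner)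
  moreover have "reflect a 0 (L (reflect a 0 (reflect a 0 p))) \<bullet> reflect a 0 p = L p \<bullet> p"
    by (simp add: reflect_reflect[OF a] reflect0_inner)
  ultimately show ?thesis
    unfolding Qop_def Aop_def tr_reflect[OF a l] norm_reflect0[OF a] by (simp add: inner_diff_right)
qed

text \<open>Once 2 \<rho> L < m, the gradient of \<open>\<psi>\<close> outweighs its quadratic
  remainder on a ball of radius \<rho> touching the zero set from inside, with one \<rho> for all
  zeros near \<open>x\<close>. The last clause puts each centre into the ball at \<open>x\<close>,
  so that coincidence of two graphs passes from that ball to its neighbours.\<close>

lemma uniform_interior_ball:
  assumes \<psi>: "C2 U \<psi> g H" and x: "x \<in> U" and g0: "g x \<noteq> 0" and R: "R > 0"
  obtains \<rho> \<delta> where "\<rho> > 0" "\<delta> > 0"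
    "\<And>z. z \<in> ball x \<delta> \<Longrightarrow> \<psi> z = 0 \<Longrightarrow> g z \<noteq> 0 \<and> cball (z - (\<rho> / norm (g z)) *\<^sub>R g z) \<rho> \<subseteq> ball x R \<and>
       (\<forall>y\<in>ball (z - (\<rho> / norm (g z)) *\<^sub>R g z) \<rho>. y \<in> U \<and> \<psi> y < 0) \<and>
       dist (z - (\<rho> / norm (g z)) *\<^sub>R g z) (x - (\<rho> / norm (g x)) *\<^sub>R g x) < \<rho>"
proof -
  note C = C2_D[OF \<psi>]
  obtain r L where B: "r > 0" "L > 0" "cball x r \<subseteq> U"
    "\<And>z w. z \<in> cball x r \<Longrightarrow> w \<in> cball x r \<Longrightarrow> \<bar>\<psi> w - \<psi> z - g z \<bullet> (w - z)\<bar> \<le> L * (norm (w - z))\<^sup>2"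
    by (rule C2_locally_bounded[OF \<psi> x]) (rule that)
  define m where "m = norm (g x) / 2"
  have m: "m > 0" unfolding m_def using g0 by simp
  define \<rho> where "\<rho> = min (m / (4 * L)) (min r R / 4)"
  have \<rho>: "\<rho> > 0" "4 * \<rho> \<le> r" "4 * \<rho> \<le> R" "2 * \<rho> * L < m"
  proof -
    show "\<rho> > 0" "4 * \<rho> \<le> r" "4 * \<rho> \<le> R" unfolding \<rho>_def using m B(1,2) R by auto
    have "\<rho> * (4 * L) \<le> m" unfolding \<rho>_def using B(2) by (simp add: min_def divide_simps split: if_splits)
    moreover have "\<rho> * L > 0" using \<open>\<rho> > 0\<close> B(2) by simp
    ultimately show "2 * \<rho> * L < m" by linarith
  qed
  define V where "V = U \<inter> (\<lambda>z. norm (g z)) -` {m<..}"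
  have oV: "open V" unfolding V_def
    by (intro continuous_open_preimage continuous_intros C(1,7) open_greaterThan)
  have xV: "x \<in> V" unfolding V_def m_def using x g0 by simp
  define c where "c = (\<lambda>z. z - (\<rho> / norm (g z)) *\<^sub>R g z)"
  have "continuous_on V c" unfolding c_def
    by (intro continuous_intros continuous_on_subset[OF C(7)]) (use m in \<open>auto simp: V_def\<close>)
  then have "open (V \<inter> c -` ball (c x) \<rho>)" by (rule continuous_open_preimage[OF _ oV open_ball])
  moreover have "x \<in> V \<inter> c -` ball (c x) \<rho>" using xV \<rho>(1) by simp
  ultimately obtain \<delta>1 where \<delta>1: "\<delta>1 > 0" "ball x \<delta>1 \<subseteq> V \<inter> c -` ball (c x) \<rho>" using openE by blast
  show ?thesis
  proof (rule that[OF \<rho>(1), of "min \<delta>1 \<rho>"])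
    show "min \<delta>1 \<rho> > 0" using \<delta>1 \<rho> by simp
    fix z assume zb: "z \<in> ball x (min \<delta>1 \<rho>)" and \<psi>z: "\<psi> z = 0"
    have zV: "z \<in> V" "dist (c x) (c z) < \<rho>" using zb \<delta>1 by auto
    have gz: "norm (g z) > m" using zV(1) V_def by simp
    then have gz0: "g z \<noteq> 0" using m by auto
    have zc: "norm (z - c z) = \<rho>" unfolding c_def using gz0 \<rho> by simp
    have near: "dist x y < 3 * \<rho>" if y: "y \<in> cball (c z) \<rho>" for y
    proof -
      have "dist x y \<le> dist x z + dist z (c z) + dist (c z) y" by (metric)
      also have "\<dots> < 3 * \<rho>" using zb zc y by (simp add: dist_norm)
      finally show ?thesis .
    qed
    have "\<psi> y < 0" if y: "y \<in> ball (c z) \<rho>" for y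
    proof -
      define w where "w = y - z"
      define n where "n = g z /\<^sub>R norm (g z)"
      have n: "n \<bullet> n = 1" "g z = norm (g z) *\<^sub>R n" unfolding n_def using gz0 by (auto simp: dot_square_norm power2_eq_square)
      have cz: "c z = z - \<rho> *\<^sub>R n" unfolding c_def n_def by (simp add: divide_inverse)
      have "norm (w + \<rho> *\<^sub>R n) < \<rho>"
        using y unfolding w_def cz by (simp add: dist_norm norm_minus_commute algebra_simps)
      then have "(norm (w + \<rho> *\<^sub>R n))\<^sup>2 < \<rho>\<^sup>2" by (intro power_strict_mono) auto
      moreover have "(norm (w + \<rho> *\<^sub>R n))\<^sup>2 = (norm w)\<^sup>2 + 2 * \<rho> * (n \<bullet> w) + \<rho>\<^sup>2"
        unfolding power2_norm_eq_inner using n(1)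
        by (simp add: inner_add_left inner_add_right inner_commute power2_eq_square algebra_simps)
      ultimately have wn: "(norm w)\<^sup>2 < - 2 * \<rho> * (n \<bullet> w)" by simp
      have "0 \<le> (norm w)\<^sup>2" by simp
      then have "\<rho> * (n \<bullet> w) < 0" using wn by linarith
      then have nw: "n \<bullet> w < 0" using \<rho>(1) by (simp add: mult_less_0_iff)
      have "z \<in> cball x r" "y \<in> cball x r" using zb near[of y] y \<rho> by auto
      from B(4)[OF this] have "\<psi> y \<le> g z \<bullet> w + L * (norm w)\<^sup>2" using \<psi>z unfolding w_def by linarith
      also have "g z \<bullet> w = norm (g z) * (n \<bullet> w)" by (subst n(2)) simp
      also have "L * (norm w)\<^sup>2 \<le> L * (- 2 * \<rho> * (n \<bullet> w))" using wn B(2) by (intro mult_left_mono) auto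
      also have "norm (g z) * (n \<bullet> w) + L * (- 2 * \<rho> * (n \<bullet> w)) = (norm (g z) - 2 * \<rho> * L) * (n \<bullet> w)"
        by (simp add: algebra_simps)
      also have "\<dots> < 0" using gz \<rho>(4) nw by (intro mult_pos_neg) auto
      finally show ?thesis by simp
    qed
    moreover have "y \<in> U" if "y \<in> ball (c z) \<rho>" for y
      using near[of y] that \<rho> B(1,3) by (auto simp: subset_iff)
    moreover have "cball (c z) \<rho> \<subseteq> ball x R" using near \<rho> by force
    ultimately show "g z \<noteq> 0 \<and> cball (z - (\<rho> / norm (g z)) *\<^sub>R g z) \<rho> \<subseteq> ball x R \<and>
       (\<forall>y\<in>ball (z - (\<rho> / norm (g z)) *\<^sub>R g z) \<rho>. y \<in> U \<and> \<psi> y < 0) \<and>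
       dist (z - (\<rho> / norm (g z)) *\<^sub>R g z) (x - (\<rho> / norm (g x)) *\<^sub>R g x) < \<rho>"
      using gz0 zV(2) unfolding c_def by (simp add: dist_commute)
  qed
qed

section \<open>Contact of M with its mirror image in the extremal hyperplane\<close>

locale moving_plane = symmetric_slab +
  fixes t0 :: real
  assumes t0: "b < t0" and mx: "bad_pair s x y \<Longrightarrow> x \<bullet> a + y \<bullet> a \<le> 2 * t0"
begin

abbreviation "rf \<equiv> reflect a t0"

lemma rf: "rf x \<bullet> a = 2 * t0 - x \<bullet> a" "rf x \<bullet> v = x \<bullet> v" "rf (rf x) = x" "rf x = x + (2 * (t0 - x \<bullet> a)) *\<^sub>R a"
  "dist (rf x) (rf y) = dist x y"
proof -
  show "rf x \<bullet> v = x \<bullet> v" unfolding reflect_alt by (simp add: inner_add_left av)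
qed (rule reflect_inner[OF a_unit] reflect_reflect[OF a_unit] reflect_alt reflect_dist[OF a_unit])+

lemma beyond_not_tangent: "x \<in> M \<Longrightarrow> x \<notin> bd \<Longrightarrow> t0 < x \<bullet> a \<Longrightarrow> nu x \<bullet> a \<noteq> 0"
  using mx[of 0 x x] unfolding bad_pair_def by auto

lemma bad_pair_rf:
  assumes "x \<in> M" "rf x \<in> M" "t0 < x \<bullet> a"
  shows "bad_pair (2 * (x \<bullet> a - t0)) x (rf x)"
  using assms unfolding bad_pair_def rf(4) by (auto simp: algebra_simps)

lemma not_both_boundary:
  assumes x: "x \<in> bd" "t0 < x \<bullet> a" shows "rf x \<notin> bd"
proof
  assume y: "rf x \<in> bd"
  have xy: "x = rf x + (2 * (x \<bullet> a - t0)) *\<^sub>R a" unfolding rf(4) by (simp add: algebra_simps)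
  have s: "2 * (x \<bullet> a - t0) > 0" using x by simp
  have "x \<in> \<Gamma>1 \<and> rf x \<in> \<Gamma>1 \<or> x \<in> \<Gamma>2 \<and> rf x \<in> \<Gamma>2"
    using x(1) y \<Gamma>1_height \<Gamma>2_height rf(2)[of x] c12 by force
  then have "x \<bullet> a + rf x \<bullet> a = 2 * b"
  proof
    assume "x \<in> \<Gamma>1 \<and> rf x \<in> \<Gamma>1"
    then show ?thesis using B1.frontier_chord[OF _ _ xy s] \<Gamma>1 by blast
  next
    assume "x \<in> \<Gamma>2 \<and> rf x \<in> \<Gamma>2"
    then show ?thesis using B2.frontier_chord[OF _ _ xy s] \<Gamma>2 by blast
  qed
  then show False using rf(1) t0 by simp
qed

text \<open>The pair of \<open>x\<close> and \<open>rf x\<close> already has its midpoint at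
  \<open>t0\<close>, so \<open>raise_midpoint\<close> would exceed the bound.\<close>

lemma lower_not_tangent:
  assumes x: "x \<in> M" "rf x \<in> M" "t0 < x \<bullet> a" and nx: "nu x \<bullet> a \<noteq> 0" and y: "rf x \<notin> bd"
  shows "nu (rf x) \<bullet> a \<noteq> 0"
proof
  assume ny: "nu (rf x) \<bullet> a = 0"
  have xy: "x = rf x + (2 * (x \<bullet> a - t0)) *\<^sub>R a" unfolding rf(4) by (simp add: algebra_simps)
  have s: "2 * (x \<bullet> a - t0) > 0" using x by simp
  obtain s' x' y' where "bad_pair s' x' y'" "x \<bullet> a + rf x \<bullet> a < x' \<bullet> a + y' \<bullet> a"
    by (rule raise_midpoint[OF x(2) y ny x(1) xy s nx]) (rule that)
  then show False using mx rf(1)[of x] by fastforce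
qed

text \<open>If the mirror image lay on the lower curve, \<open>x\<close> would be an interior point
  of least height, with vertical normal, hence tangent to \<open>a\<close> beyond the mirror. If it
  lay on the upper curve, \<open>x\<close> would touch the top.\<close>

lemma interior_pair:
  assumes x: "x \<in> M" "rf x \<in> M" "t0 < x \<bullet> a" "x \<notin> bd"
  shows "rf x \<notin> bd" "nu x \<bullet> a \<noteq> 0" "nu (rf x) \<bullet> a \<noteq> 0"
proof -
  show nx: "nu x \<bullet> a \<noteq> 0" using beyond_not_tangent x by blast
  show y: "rf x \<notin> bd"
  proof
    assume "rf x \<in> bd"
    then show False
    proof
      assume "rf x \<in> \<Gamma>1"
      then have "x \<bullet> v = c1" using \<Gamma>1_height rf(2) by metis
      then obtain c where "nu x = c *\<^sub>R v" using interior_bottom_horizontal[OF x(1,4)] by blast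
      then show False using nx va by simp
    next
      assume "rf x \<in> \<Gamma>2"
      then have "x \<bullet> v = c2" using \<Gamma>2_height rf(2) by metis
      then show False using no_interior_top x by blast
    qed
  qed
  show "nu (rf x) \<bullet> a \<noteq> 0" by (rule lower_not_tangent[OF x(1-3) nx y])
qed

text \<open>Both sheets are graphs in direction \<open>a\<close> over the same hyperplane, and
  reflection turns the lower one into \<open>2 * t0 - u2\<close>. The bound \<open>mx\<close> keeps
  \<open>u1\<close> below it; equality at \<open>x\<close> spreads by the strong maximum
  principle.\<close>

lemma contact_open_interior:
  assumes x: "x \<in> M" "rf x \<in> M" "t0 < x \<bullet> a" "x \<notin> bd"
  obtains \<rho> where "\<rho> > 0" "\<And>z. z \<in> M \<Longrightarrow> z \<in> ball x \<rho> \<Longrightarrow> rf z \<in> M"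
proof -
  note ip = interior_pair[OF x]
  define y where "y = rf x"
  have y: "y \<in> M" "y \<notin> bd" "nu y \<bullet> a \<noteq> 0" using x ip unfolding y_def by auto
  obtain R1 D1 u1 p1 H1 \<psi>1 g\<psi>1 H\<psi>1 where g1: "graph_at x a R1 D1 u1 p1 H1 \<psi>1 g\<psi>1 H\<psi>1"
    by (rule graph_at_exists[OF x(1) a_unit ip(2)]) (rule that)
  obtain R2 D2 u2 p2 H2 \<psi>2 g\<psi>2 H\<psi>2 where g2: "graph_at y a R2 D2 u2 p2 H2 \<psi>2 g\<psi>2 H\<psi>2"
    by (rule graph_at_exists[OF y(1) a_unit y(3)]) (rule that)
  note G1 = graph_at_D[OF g1] and G2 = graph_at_D[OF g2]
  have ux: "u1 x = x \<bullet> a" "u2 y = y \<bullet> a" using G1(13)[of x] G2(13)[of y] G1(1) G2(1) x y by auto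
  have xy: "x = y + (2 * (x \<bullet> a - t0)) *\<^sub>R a" unfolding y_def rf(4) by (simp add: algebra_simps)
  have xD2: "x \<in> D2" "u2 x = y \<bullet> a"
    using G2(4,5) ux(2) xy unfolding cylindrical_def by metis+
  have ya: "y \<bullet> a = 2 * t0 - x \<bullet> a" unfolding y_def by (rule rf(1))
  \<comment> \<open>Where \<open>u1\<close> exceeds \<open>u2\<close> the two lifts are distinct, so
    they form a pair to which \<open>mx\<close> applies.\<close>
  define V where "V = (D1 \<inter> D2) \<inter> (\<lambda>z. u1 z - u2 z) -` {0<..}"
  have oD: "open (D1 \<inter> D2)" using C2_D(1)[OF G1(3)] C2_D(1)[OF G2(3)] by blast
  have C1: "C2 (D1 \<inter> D2) u1 p1 H1" and C2': "C2 (D1 \<inter> D2) u2 p2 H2"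
    by (rule C2_subset[OF G1(3) oD], blast, rule C2_subset[OF G2(3) oD], blast)
  have oV: "open V" unfolding V_def
    by (intro continuous_open_preimage continuous_intros C2_D(6)[OF C1] C2_D(6)[OF C2'] oD open_greaterThan)
  have xV: "x \<in> V" unfolding V_def using G1(5) xD2 ux ya x(3) by simp
  have VD: "V \<subseteq> D1" "V \<subseteq> D2" unfolding V_def by auto
  have U1: "C2 V u1 p1 H1" by (rule C2_subset[OF G1(3) oV VD(1)])
  have U2: "C2 V (\<lambda>z. 2 * t0 - u2 z) (\<lambda>z. - p2 z) (\<lambda>z h. - H2 z h)"
    by (rule C2_const_minus[OF C2_subset[OF G2(3) oV VD(2)]])
  have M1: "lift a u1 z \<in> M" if "z \<in> V" for z using G1(9)[of z] G1(15)[of z] x(4) VD that by (auto intro: less_imp_le)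
  have M2: "lift a u2 z \<in> M" if "z \<in> V" for z using G2(9)[of z] G2(15)[of z] y(2) VD that by (auto intro: less_imp_le)
  have Q1: "Qop v a (p1 z) (H1 z) = 0" if "z \<in> V" for z using G1(11) M1[OF that] VD that by blast
  have Q2: "Qop v a (- p2 z) (\<lambda>h. - H2 z h) = 0" if z: "z \<in> V" for z
  proof -
    have "Qop v a (p2 z) (H2 z) = 0" using G2(11) M2[OF z] VD z by blast
    moreover have "linear (H2 z)" using C2_D(5)[OF G2(3)] VD z by blast
    ultimately show ?thesis unfolding Qop_def Aop_def tr_minus
      by (simp add: linear_neg va inner_diff_right algebra_simps)
  qed
  have le: "u1 z \<le> 2 * t0 - u2 z" if z: "z \<in> V" for z
  proof -
    have "bad_pair (u1 z - u2 z) (lift a u1 z) (lift a u2 z)"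
      unfolding bad_pair_def using M1[OF z] M2[OF z] z V_def by (auto simp: lift_def algebra_simps)
    from mx[OF this] show ?thesis by (simp add: lift_inner[OF a_unit])
  qed
  have eqx: "u1 x = 2 * t0 - u2 x" using ux xD2 ya by simp
  obtain R where R: "R > 0" "ball x R \<subseteq> V"
    "\<forall>c \<rho>. 0 < \<rho> \<and> cball c \<rho> \<subseteq> ball x R \<and> ordered_solutions v a c \<rho> u1 p1 H1 (\<lambda>z. 2 * t0 - u2 z) (\<lambda>z. - p2 z) (\<lambda>z h. - H2 z h)
      \<longrightarrow> contact_alternative c \<rho> u1 p1 (\<lambda>z. 2 * t0 - u2 z) (\<lambda>z. - p2 z)"
    by (rule translator_comparison[OF U1 U2 xV v_unit a_unit]) (rule that)
  define \<rho> where "\<rho> = R / 2"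
  have \<rho>: "\<rho> > 0" "cball x \<rho> \<subseteq> ball x R" unfolding \<rho>_def using R(1) by auto
  have sub: "z \<in> V" if "z \<in> ball x \<rho>" for z
  proof -
    have "z \<in> ball x R" using that \<rho> ball_subset_cball by blast
    then show ?thesis using R(2) by blast
  qed
  have "contact_alternative x \<rho> u1 p1 (\<lambda>z. 2 * t0 - u2 z) (\<lambda>z. - p2 z)"
    by (rule R(3)[rule_format]) (use \<rho> Q1 Q2 le sub in \<open>auto simp: ordered_solutions_def\<close>)
  then have eq: "u1 z = 2 * t0 - u2 z" if "z \<in> ball x \<rho>" for z
    using that eqx \<rho>(1) unfolding contact_alternative_def by (metis centre_in_ball less_irrefl)
  show ?thesis
  proof (rule that[of "min \<rho> R1"])
    show "min \<rho> R1 > 0" using \<rho> G1(1) by simp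
    fix z assume z: "z \<in> M" "z \<in> ball x (min \<rho> R1)"
    have z1: "z \<in> ball x \<rho>" "z \<in> ball x R1" using z(2) by auto
    have "z \<bullet> a = u1 z" using G1(13)[OF z1(2) z(1)] by simp
    then have "u2 z = 2 * t0 - z \<bullet> a" using eq[OF z1(1)] by simp
    then have "u2 z - z \<bullet> a = 2 * (t0 - z \<bullet> a)" by simp
    moreover have "lift a u2 z = z + (u2 z - z \<bullet> a) *\<^sub>R a" unfolding lift_def by (simp add: algebra_simps)
    ultimately have "lift a u2 z = rf z" unfolding rf(4) by simp
    then show "rf z \<in> M" using M2[OF sub[OF z1(1)]] by simp
  qed
qed

lemma bottom_graph:
  assumes y: "y \<in> M" "y \<notin> bd" "y \<bullet> v = c1"
  obtains R D u p H \<psi> g\<psi> H\<psi> where "graph_at y v R D u p H \<psi> g\<psi> H\<psi>" "p y = 0" "u y = c1" "y \<in> D"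
    "\<And>z. z \<in> D \<Longrightarrow> lift v u z \<in> M \<and> c1 \<le> u z"
proof -
  obtain c where c: "c \<noteq> 0" "nu y = c *\<^sub>R v" by (rule interior_bottom_horizontal[OF y]) (rule that)
  have nv: "nu y \<bullet> v \<noteq> 0" using c vv by simp
  obtain R D u p H \<psi> g\<psi> H\<psi> where g: "graph_at y v R D u p H \<psi> g\<psi> H\<psi>"
    by (rule graph_at_exists[OF y(1) v_unit nv]) (rule that)
  note G = graph_at_D[OF g]
  have lM: "lift v u z \<in> M" if "z \<in> D" for z using G(9)[OF that] G(15)[OF y(2) that] by simp
  show ?thesis
  proof (rule that[OF g])
    show "p y = 0" by (rule horizontal_gradient[OF g c(2)])
    show "u y = c1" using G(13)[of y] G(1) y by simp
    show "y \<in> D" by (rule G(5))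
    show "lift v u z \<in> M \<and> c1 \<le> u z" if "z \<in> D" for z
      using lM[OF that] slab[OF lM[OF that]] lift_inner[OF v_unit, of u z] by simp
  qed
qed

text \<open>The mirror image is an interior point touching the bottom plane, where \<open>M\<close> is horizontal. If \<open>M\<close> is
  outside \<open>\<Gamma>1\<close> near \<open>x\<close>, points at equal height give a pair with larger midpoint. Otherwise the Hopf lemma
  on interior balls of \<open>\<Gamma>1\<close> makes the two sheets coincide, up to the boundary.\<close>

lemma contact_open_boundary:
  assumes x: "x \<in> \<Gamma>1" "rf x \<in> M" "t0 < x \<bullet> a"
  obtains \<rho> where "\<rho> > 0" "\<And>z. z \<in> \<Gamma>1 \<Longrightarrow> z \<in> ball x \<rho> \<Longrightarrow> rf z \<in> M"
proof -
  have xb: "x \<in> bd" "b < x \<bullet> a" using x t0 by auto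
  have xM: "x \<in> M" using xb bd_subset by blast
  have xh: "x \<bullet> v = c1" by (rule \<Gamma>1_height[OF x(1)])
  define y where "y = rf x"
  have y: "y \<in> M" "y \<notin> bd" "y \<bullet> v = c1" unfolding y_def using x not_both_boundary[OF xb(1) x(3)] rf(2) xh by auto
  obtain c where "nu y = c *\<^sub>R v" by (rule interior_bottom_horizontal[OF y]) (rule that)
  then have ny: "nu y \<bullet> a = 0" using va by simp
  have nx: "nu x \<bullet> a = 0" using lower_not_tangent[OF xM x(2,3)] y ny unfolding y_def by blast
  obtain \<theta> R D u p H \<psi> g\<psi> H\<psi> where t: "tangential x \<theta> R D u p H \<psi> g\<psi> H\<psi>"
    by (rule tangential_exists[OF xb nx]) (rule that)
  have g: "graph_at x v R D u p H \<psi> g\<psi> H\<psi>" and \<theta>: "\<bar>\<theta>\<bar> = 1" and px: "p x = 0" using t unfolding tangential_def by auto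
  note G = graph_at_D[OF g]
  obtain R2 D2 u2 p2 H2 \<psi>2 g\<psi>2 H\<psi>2 where g2: "graph_at y v R2 D2 u2 p2 H2 \<psi>2 g\<psi>2 H\<psi>2"
    and y2: "p2 y = 0" "u2 y = c1" "y \<in> D2" and M2: "\<And>z. z \<in> D2 \<Longrightarrow> lift v u2 z \<in> M \<and> c1 \<le> u2 z"
    by (rule bottom_graph[OF y]) (rule that)
  note G2 = graph_at_D[OF g2]
  have lx: "lift v u x = x" by (rule G(17)) (use G(1) xM in auto)
  have ux: "u x = c1" using G(13)[of x] G(1) xM xh by simp
  have \<psi>x: "\<psi> x = 0" using G(10)[OF G(5)] lx xb(1) by simp
  have lM: "lift v u z \<in> M" if "z \<in> D" "\<psi> z \<le> 0" for z using G(9) that by blast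
  define s where "s = 2 * (x \<bullet> a - t0)"
  have s: "s > 0" "x = y + s *\<^sub>R a" unfolding s_def y_def rf(4) using x(3) by (simp_all add: algebra_simps)
  have xya: "x \<bullet> a + y \<bullet> a = 2 * t0" unfolding y_def rf(1) by simp
  \<comment> \<open>The bound \<open>mx\<close> in terms of the two graphs over the horizontal
    plane: lifts of points on one line in direction \<open>a\<close> form a pair exactly when their
    heights agree.\<close>
  have pair: "\<not> (0 < s' \<and> u z = u2 z' \<and> z = z' + s' *\<^sub>R a \<and> 2 * t0 < z \<bullet> a + z' \<bullet> a)"
    if zD: "z \<in> D" "\<psi> z \<le> 0" "z' \<in> D2" for z z' s'
  proof
    assume A: "0 < s' \<and> u z = u2 z' \<and> z = z' + s' *\<^sub>R a \<and> 2 * t0 < z \<bullet> a + z' \<bullet> a"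
    then have A1: "u z = u2 z'" and A2: "z = z' + s' *\<^sub>R a" by auto
    have zv: "z \<bullet> v = z' \<bullet> v" unfolding A2 by (simp add: inner_add_left av)
    have "z - k *\<^sub>R v + l *\<^sub>R v = z' - k *\<^sub>R v + l *\<^sub>R v + s' *\<^sub>R a" for k l using A2 by simp
    then have "lift v u z = lift v u2 z' + s' *\<^sub>R a" unfolding lift_def A1 zv .
    then have "bad_pair s' (lift v u z) (lift v u2 z')"
      unfolding bad_pair_def using lM[OF zD(1,2)] M2[OF zD(3)] A by auto
    from mx[OF this] have "z \<bullet> a + z' \<bullet> a \<le> 2 * t0"
      unfolding lift_def by (simp add: inner_add_left inner_diff_left va)
    moreover have "2 * t0 < z \<bullet> a + z' \<bullet> a" using A by blast
    ultimately show False by linarith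
  qed
  have "\<theta> = -1"
  proof (rule ccontr)
    assume "\<theta> \<noteq> -1"
    then have \<theta>1: "\<theta> = 1" using \<theta> by (auto simp: abs_if split: if_splits)
    obtain r2 where r2: "r2 > 0" "ball y r2 \<subseteq> D2" using C2_D(1)[OF G2(3)] y2(3) openE by blast
    have r3: "r2 / 2 > 0" using r2 by simp
    obtain \<epsilon> \<delta> where E: "0 < \<epsilon>" "\<epsilon> \<le> r2 / 2" "\<delta> > 0"
      "\<And>z. z \<in> ball x \<delta> \<Longrightarrow> \<exists>\<sigma>. rising_line D u p \<psi> (\<theta> *\<^sub>R a) \<epsilon> z \<sigma>"
      by (rule tangential_lines[OF t r3]) (rule that)
    have xd: "x \<in> ball x \<delta>" using E(3) by simp
    obtain \<sigma> where T: "\<And>t. \<bar>t\<bar> \<le> \<epsilon> \<Longrightarrow> x + t *\<^sub>R a \<in> D \<and> (\<psi> (x + t *\<^sub>R a) = 0 \<longleftrightarrow> t = \<sigma>) \<and>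
          (\<psi> (x + t *\<^sub>R a) \<le> 0 \<longleftrightarrow> \<sigma> \<le> t)"
      and cont: "continuous_on {-\<epsilon>..\<epsilon>} (\<lambda>t. u (x + t *\<^sub>R a))"
      using E(4)[OF xd] unfolding \<theta>1 scaleR_one rising_line_def by blast
    have \<sigma>0: "\<sigma> = 0" using T[of 0] \<psi>x E(1) by simp
    have D2l: "y + t *\<^sub>R a \<in> D2" if "0 \<le> t" "t \<le> \<epsilon>" for t
    proof -
      have "y + t *\<^sub>R a \<in> ball y r2" using that E(2) r2(1) a_unit by (simp add: dist_norm)
      then show ?thesis using r2(2) by blast
    qed
    have cont2: "continuous_on {0..\<epsilon>} (\<lambda>t. u2 (y + t *\<^sub>R a))"
      by (rule continuous_on_compose2[OF C2_D(6)[OF G2(3)]]) (use D2l in \<open>auto intro!: continuous_intros\<close>)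
    have no: "u (x + t *\<^sub>R a) \<noteq> u2 (y + t' *\<^sub>R a)" if tt: "0 \<le> t" "t \<le> \<epsilon>" "0 \<le> t'" "t' \<le> \<epsilon>" "0 < t + t'" "t' < s" for t t'
    proof
      assume eq: "u (x + t *\<^sub>R a) = u2 (y + t' *\<^sub>R a)"
      have 1: "x + t *\<^sub>R a \<in> D" "\<psi> (x + t *\<^sub>R a) \<le> 0" using T[of t] tt \<sigma>0 by auto
      have 2: "x + t *\<^sub>R a = (y + t' *\<^sub>R a) + (s + t - t') *\<^sub>R a" unfolding s(2) by (simp add: algebra_simps)
      have 3: "2 * t0 < (x + t *\<^sub>R a) \<bullet> a + (y + t' *\<^sub>R a) \<bullet> a" using xya tt(5) aa by (simp add: inner_add_left)
      have 4: "0 < s + t - t'" using tt s(1) by linarith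
      show False using pair[OF 1 D2l[OF tt(3,4)], of "s + t - t'"] eq 2 3 4 by blast
    qed
    define e where "e = min \<epsilon> (s / 2)"
    have e: "0 < e" "e \<le> \<epsilon>" "e < s" unfolding e_def using E(1) s(1) by auto
    \<comment> \<open>Both heights start at \<open>c1\<close> and never fall below it. The sheet
      that is higher after the step \<open>e\<close> has passed the height of the other at an
      earlier or equal parameter, which gives two points of equal height with midpoint beyond
      \<open>t0\<close>.\<close>
    show False
    proof (cases "u2 (y + e *\<^sub>R a) \<le> u (x + e *\<^sub>R a)")
      case True
      have "\<exists>t\<ge>0. t \<le> e \<and> u (x + t *\<^sub>R a) = u2 (y + e *\<^sub>R a)"
      proof (rule IVT')
        show "u (x + 0 *\<^sub>R a) \<le> u2 (y + e *\<^sub>R a)" using ux M2[OF D2l[of e]] e by simp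
        show "continuous_on {0..e} (\<lambda>t. u (x + t *\<^sub>R a))" by (rule continuous_on_subset[OF cont]) (use e E(1) in auto)
      qed (use True e in auto)
      then show False using no[of _ e] e by force
    next
      case False
      have "\<exists>t\<ge>0. t \<le> e \<and> u2 (y + t *\<^sub>R a) = u (x + e *\<^sub>R a)"
      proof (rule IVT')
        have "lift v u (x + e *\<^sub>R a) \<in> M" by (rule lM) (use T[of e] e E(1) \<sigma>0 in auto)
        then show "u2 (y + 0 *\<^sub>R a) \<le> u (x + e *\<^sub>R a)" using y2(2) slab lift_inner[OF v_unit, of u "x + e *\<^sub>R a"] by fastforce
        show "continuous_on {0..e} (\<lambda>t. u2 (y + t *\<^sub>R a))" by (rule continuous_on_subset[OF cont2]) (use e in auto)
      qed (use False e in auto)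
      then show False using no[of e] e by force
    qed
  qed
  then have \<theta>1: "\<theta> *\<^sub>R a = - a" by simp
  define U where "U = D \<inter> rf -` D2"
  have oU: "open U" unfolding U_def
    using open_Int[OF C2_D(1)[OF G(3)] open_vimage[OF C2_D(1)[OF G2(3)] continuous_on_reflect]] .
  have xU: "x \<in> U" unfolding U_def using G(5) y2(3) y_def by simp
  define us where "us = (\<lambda>z. u2 (rf z))"
  define ps where "ps = (\<lambda>z. reflect a 0 (p2 (rf z)))"
  define Hs where "Hs = (\<lambda>z h. reflect a 0 (H2 (rf z) (reflect a 0 h)))"
  have U1: "C2 U u p H" by (rule C2_subset[OF G(3) oU]) (auto simp: U_def)
  have U2: "C2 U us ps Hs" unfolding us_def ps_def Hs_def
    by (rule C2_subset[OF C2_reflect[OF G2(3)] oU]) (auto simp: U_def)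
  have U\<psi>: "C2 U \<psi> g\<psi> H\<psi>" by (rule C2_subset[OF G(6) oU]) (auto simp: U_def)
  obtain RU where RU: "RU > 0" "ball x RU \<subseteq> U" using oU xU openE by blast
  \<comment> \<open>If \<open>u z\<close> exceeded \<open>us z\<close>, the sheet at
    \<open>x\<close> would attain the height \<open>us z\<close> earlier on its rising profile, that
    is, farther out in direction \<open>a\<close>; with \<open>rf z\<close> this would give too
    large a midpoint.\<close>
  have le: "\<exists>\<delta>>0. \<forall>z\<in>ball x \<delta>. z \<in> U \<longrightarrow> \<psi> z \<le> 0 \<longrightarrow> u z \<le> us z"
  proof -
    obtain \<epsilon> \<delta> where E: "0 < \<epsilon>" "\<delta> > 0"
      "\<And>z. z \<in> ball x \<delta> \<Longrightarrow> \<exists>\<sigma>. rising_line D u p \<psi> (\<theta> *\<^sub>R a) \<epsilon> z \<sigma>"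
      by (rule tangential_lines[OF t zero_less_one]) (rule that)
    define \<delta>' where "\<delta>' = min \<delta> (x \<bullet> a - t0)"
    have "u z \<le> us z" if z: "z \<in> ball x \<delta>'" "z \<in> U" "\<psi> z \<le> 0" for z
    proof (rule ccontr)
      assume gt: "\<not> u z \<le> us z"
      have zd: "z \<in> ball x \<delta>" and zx: "norm (x - z) < x \<bullet> a - t0" using z(1) unfolding \<delta>'_def by (auto simp: dist_norm)
      have "\<bar>(x - z) \<bullet> a\<bar> \<le> norm (x - z) * norm a" by (rule Cauchy_Schwarz_ineq2)
      then have za: "z \<bullet> a > t0" using zx a_unit by (simp add: inner_diff_left abs_le_iff)
      obtain \<sigma> where \<sigma>: "\<bar>\<sigma>\<bar> < \<epsilon>" "u (z + \<sigma> *\<^sub>R (-a)) = c1"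
        and T: "\<And>t. \<bar>t\<bar> \<le> \<epsilon> \<Longrightarrow> z + t *\<^sub>R (-a) \<in> D \<and> (\<psi> (z + t *\<^sub>R (-a)) \<le> 0 \<longleftrightarrow> \<sigma> \<le> t)"
        and cont: "continuous_on {-\<epsilon>..\<epsilon>} (\<lambda>t. u (z + t *\<^sub>R (-a)))"
        using E(3)[OF zd] unfolding \<theta>1 rising_line_def by blast
      have \<sigma>0: "\<sigma> \<le> 0" using T[of 0] z(3) E(1) by simp
      have zD2: "rf z \<in> D2" using z(2) U_def by simp
      have "\<exists>t\<ge>\<sigma>. t \<le> 0 \<and> u (z + t *\<^sub>R (-a)) = us z"
      proof (rule IVT')
        show "u (z + \<sigma> *\<^sub>R (-a)) \<le> us z" using \<sigma>(2) M2[OF zD2] us_def by simp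
        show "continuous_on {\<sigma>..0} (\<lambda>t. u (z + t *\<^sub>R (-a)))" by (rule continuous_on_subset[OF cont]) (use \<sigma> E(1) in auto)
      qed (use gt \<sigma>0 in auto)
      then obtain t where t: "\<sigma> \<le> t" "t \<le> 0" "u (z + t *\<^sub>R (-a)) = us z" by blast
      have t0': "t < 0" using t gt by (cases "t = 0") auto
      have ta: "\<bar>t\<bar> \<le> \<epsilon>" using t \<sigma> by linarith
      have 1: "z + t *\<^sub>R (-a) \<in> D" "\<psi> (z + t *\<^sub>R (-a)) \<le> 0" using T[OF ta] t(1) by auto
      have 2: "z + t *\<^sub>R (-a) = rf z + (2 * (z \<bullet> a - t0) - t) *\<^sub>R a" unfolding rf(4) by (simp add: algebra_simps)
      have 3: "2 * t0 < (z + t *\<^sub>R (-a)) \<bullet> a + rf z \<bullet> a" unfolding rf(1) using t0' aa by (simp add: inner_diff_left)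
      have 4: "0 < 2 * (z \<bullet> a - t0) - t" using za t0' by simp
      show False using pair[OF 1 zD2, of "2 * (z \<bullet> a - t0) - t"] t(3) 2 3 4 unfolding us_def by blast
    qed
    then show ?thesis using E(2) x(3) unfolding \<delta>'_def by (intro exI[of _ "min \<delta> (x \<bullet> a - t0)"]) auto
  qed
  then obtain \<delta>0 where \<delta>0: "\<delta>0 > 0" "\<And>z. z \<in> ball x \<delta>0 \<Longrightarrow> z \<in> U \<Longrightarrow> \<psi> z \<le> 0 \<Longrightarrow> u z \<le> us z" by blast
  obtain Rc where Rc: "Rc > 0" "ball x Rc \<subseteq> U"
    "\<forall>c \<rho>. 0 < \<rho> \<and> cball c \<rho> \<subseteq> ball x Rc \<and> ordered_solutions v v c \<rho> u p H us ps Hs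
      \<longrightarrow> contact_alternative c \<rho> u p us ps"
    by (rule translator_comparison[OF U1 U2 xU v_unit v_unit]) (rule that)
  define Rm where "Rm = min Rc (min \<delta>0 RU)"
  have Rm: "Rm > 0" unfolding Rm_def using Rc(1) \<delta>0(1) RU(1) by simp
  obtain \<rho> \<delta> where B: "\<rho> > 0" "\<delta> > 0"
    "\<And>z. z \<in> ball x \<delta> \<Longrightarrow> \<psi> z = 0 \<Longrightarrow> g\<psi> z \<noteq> 0 \<and> cball (z - (\<rho> / norm (g\<psi> z)) *\<^sub>R g\<psi> z) \<rho> \<subseteq> ball x Rm \<and>
       (\<forall>y\<in>ball (z - (\<rho> / norm (g\<psi> z)) *\<^sub>R g\<psi> z) \<rho>. y \<in> U \<and> \<psi> y < 0) \<and>
       dist (z - (\<rho> / norm (g\<psi> z)) *\<^sub>R g\<psi> z) (x - (\<rho> / norm (g\<psi> x)) *\<^sub>R g\<psi> x) < \<rho>"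
    by (rule uniform_interior_ball[OF U\<psi> xU G(16)[OF xb(1)] Rm]) (rule that)
  define c where "c = (\<lambda>z. z - (\<rho> / norm (g\<psi> z)) *\<^sub>R g\<psi> z)"
  have alt: "contact_alternative (c z) \<rho> u p us ps" if z: "z \<in> ball x \<delta>" "\<psi> z = 0" for z
  proof (rule Rc(3)[rule_format], unfold ordered_solutions_def, intro conjI ballI)
    have Bz: "cball (c z) \<rho> \<subseteq> ball x Rm" "\<forall>y\<in>ball (c z) \<rho>. y \<in> U \<and> \<psi> y < 0"
      using B(3)[OF z] unfolding c_def by blast+
    show "0 < \<rho>" by (rule B(1))
    show "cball (c z) \<rho> \<subseteq> ball x Rc" using Bz(1) unfolding Rm_def by (auto simp: subset_iff)
    fix y' assume y': "y' \<in> ball (c z) \<rho>"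
    have yU: "y' \<in> U" "\<psi> y' < 0" using Bz y' by auto
    have "y' \<in> ball x Rm" using Bz y' ball_subset_cball by blast
    then have "y' \<in> ball x \<delta>0" unfolding Rm_def by simp
    then show "u y' \<le> us y'" using \<delta>0(2) yU by simp
    have yD: "y' \<in> D" "rf y' \<in> D2" using yU U_def by auto
    show "Qop v v (p y') (H y') = 0" using G(11)[OF yD(1) lM[OF yD(1)]] yU(2) by simp
    have "Qop v v (p2 (rf y')) (H2 (rf y')) = 0" using G2(11)[OF yD(2)] M2[OF yD(2)] by simp
    then show "Qop v v (ps y') (Hs y') = 0" unfolding ps_def Hs_def
      using Qop_reflect[OF a_unit C2_D(5)[OF G2(3) yD(2)] va va] by simp
  qed
  have cd: "dist (c z) z = \<rho>" if "z \<in> ball x \<delta>" "\<psi> z = 0" for z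
    using B(3)[OF that] B(1) unfolding c_def by (simp add: dist_norm)
  have xd: "x \<in> ball x \<delta>" using B(2) by simp
  \<comment> \<open>At \<open>x\<close> both graphs have height \<open>c1\<close> and zero gradient,
    so the strict inequality of Hopf's lemma fails and the graphs coincide on this ball.\<close>
  have eqx: "u z = us z" if "z \<in> ball (c x) \<rho>" for z
  proof -
    have "us x = c1" unfolding us_def using y2 y_def by simp
    moreover have "ps x = 0" unfolding ps_def using y2(1) y_def by (simp add: reflect_def)
    ultimately show ?thesis using alt[OF xd \<psi>x] cd[OF xd \<psi>x] ux px that unfolding contact_alternative_def by fastforce
  qed
  show ?thesis
  proof (rule that[of "min (min \<delta> RU) (min R R2)"])
    show "min (min \<delta> RU) (min R R2) > 0" using B(2) RU(1) G(1) G2(1) by simp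
    fix z assume z: "z \<in> \<Gamma>1" "z \<in> ball x (min (min \<delta> RU) (min R R2))"
    have zz: "z \<in> ball x \<delta>" "z \<in> U" "z \<in> ball x R" "z \<in> ball x R2" using z(2) RU(2) by auto
    have zM: "z \<in> M" using z(1) bd_subset by blast
    have lz: "lift v u z = z" by (rule G(17)[OF zz(3) zM])
    have zD: "z \<in> D" "u z = z \<bullet> v" using G(13)[OF zz(3) zM] by auto
    have \<psi>z: "\<psi> z = 0" using G(10)[OF zD(1)] lz z(1) by simp
    have cz: "c z \<in> ball (c x) \<rho>" using B(3)[OF zz(1) \<psi>z] unfolding c_def by (simp add: dist_commute)
    have "c z \<in> ball (c z) \<rho>" using B(1) by simp
    \<comment> \<open>The centre of the ball at \<open>z\<close> lies in the ball at
      \<open>x\<close>, where the graphs agree; this excludes the strict alternative at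
      \<open>z\<close>.\<close>
    then have eqz: "u y' = us y'" if "y' \<in> ball (c z) \<rho>" for y'
      using alt[OF zz(1) \<psi>z] eqx[OF cz] that unfolding contact_alternative_def by (metis less_irrefl)
    have cb: "cball (c z) \<rho> \<subseteq> U"
    proof -
      have "cball (c z) \<rho> \<subseteq> ball x Rm" using B(3)[OF zz(1) \<psi>z] unfolding c_def by blast
      also have "\<dots> \<subseteq> ball x RU" unfolding Rm_def by auto
      finally show ?thesis using RU(2) by blast
    qed
    have "u z - us z = 0"
    proof (rule continuous_constant_on_closure[of "ball (c z) \<rho>"])
      show "continuous_on (closure (ball (c z) \<rho>)) (\<lambda>z. u z - us z)"
        using B(1) cb by (auto intro!: continuous_intros continuous_on_subset[OF C2_D(6)[OF U1]] continuous_on_subset[OF C2_D(6)[OF U2]])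
      show "z \<in> closure (ball (c z) \<rho>)" using B(1) cd[OF zz(1) \<psi>z] by simp
    qed (use eqz in auto)
    then have "u2 (rf z) = rf z \<bullet> v" using zD(2) rf(2) us_def by simp
    then have "lift v u2 (rf z) = rf z" by (intro lift_self) simp
    then show "rf z \<in> M" using M2[of "rf z"] zz(2) U_def by auto
  qed
qed

text \<open>Consider the infimum of the \<open>a\<close> components of contact points on the lower
  curve beyond the mirror. If it exceeds \<open>t0\<close>, it is attained, contact persists nearby
  on the curve, and \<open>frontier_lower_point\<close> yields a contact with smaller component. If
  it equals \<open>t0\<close>, pairs accumulate at a boundary point beyond \<open>b\<close>, against
  \<open>no_bad_pair_nearby\<close>.\<close>

lemma no_boundary_contact:
  assumes "x \<in> \<Gamma>1" "rf x \<in> M" shows "x \<bullet> a \<le> t0"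
proof (rule ccontr)
  assume "\<not> x \<bullet> a \<le> t0"
  define X where "X = {z \<in> \<Gamma>1. rf z \<in> M \<and> t0 < z \<bullet> a}"
  have xX: "x \<in> X" unfolding X_def using assms \<open>\<not> x \<bullet> a \<le> t0\<close> by simp
  define m where "m = Inf ((\<lambda>z. z \<bullet> a) ` X)"
  have bb: "bdd_below ((\<lambda>z. z \<bullet> a) ` X)" unfolding X_def by (intro bdd_belowI2[of _ t0]) auto
  have mle: "m \<le> z \<bullet> a" if "z \<in> X" for z unfolding m_def by (rule cInf_lower[OF _ bb]) (use that in auto)
  have mt: "t0 \<le> m" unfolding m_def by (rule cInf_greatest) (use xX X_def in auto)
  have "\<exists>z\<in>X. z \<bullet> a < m + 1 / real (Suc n)" for n
  proof -
    have "m < m + 1 / real (Suc n)" by simp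
    then show ?thesis unfolding m_def using cInf_less_iff[OF _ bb] xX by blast
  qed
  then obtain \<xi> where \<xi>: "\<And>n. \<xi> n \<in> X" "\<And>n. \<xi> n \<bullet> a < m + 1 / real (Suc n)" by metis
  have "compact \<Gamma>1" unfolding \<Gamma>1 using B1.K(1) by (simp add: compact_rel_frontier compact_imp_bounded)
  then obtain z r where zr: "z \<in> \<Gamma>1" "strict_mono r" "(\<xi> \<circ> r) \<longlonglongrightarrow> z"
    using \<xi>(1) unfolding compact_def X_def by (metis (no_types, lifting) mem_Collect_eq)
  have lim_a: "(\<lambda>n. (\<xi> \<circ> r) n \<bullet> a) \<longlonglongrightarrow> z \<bullet> a" by (intro tendsto_intros zr(3))
  have "(\<lambda>n. m + 1 / real (Suc n)) \<longlonglongrightarrow> m + 0" by (intro tendsto_intros LIMSEQ_inverse_real_of_nat[unfolded inverse_eq_divide])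
  then have "(\<lambda>n. m + 1 / real (Suc (r n))) \<longlonglongrightarrow> m" using LIMSEQ_subseq_LIMSEQ[OF _ zr(2)] by (fastforce simp: o_def)
  then have "z \<bullet> a \<le> m" by (rule LIMSEQ_le[OF lim_a]) (use \<xi>(2) in \<open>auto intro!: exI[of _ 0] less_imp_le\<close>)
  moreover have "m \<le> z \<bullet> a" by (rule LIMSEQ_le_const[OF lim_a]) (use mle \<xi>(1) in auto)
  ultimately have zm: "z \<bullet> a = m" by simp
  have rlim: "(\<lambda>n. rf ((\<xi> \<circ> r) n)) \<longlonglongrightarrow> rf z"
    using zr(3) unfolding reflect_def by (intro tendsto_intros)
  have rzM: "rf z \<in> M"
    by (rule closed_sequentially[OF compact_imp_closed[OF compact_M] _ rlim]) (use \<xi>(1) X_def in auto)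
  show False
  proof (cases "m = t0")
    case True
    then have rz: "rf z = z" unfolding rf(4) using zm by simp
    have zb: "z \<in> bd" "b < z \<bullet> a" using zr(1) zm True t0 by auto
    obtain \<rho> where \<rho>: "\<rho> > 0" "\<And>s x y. bad_pair s x y \<Longrightarrow> x \<in> ball z \<rho> \<Longrightarrow> y \<in> ball z \<rho> \<Longrightarrow> False"
      by (rule no_bad_pair_nearby[of z]) (use zb bd_subset in blast, use zb in blast, rule that)
    have "\<forall>\<^sub>F n in sequentially. dist ((\<xi> \<circ> r) n) z < \<rho>" using zr(3) \<rho>(1) by (rule tendstoD)
    then obtain n where n: "dist (\<xi> (r n)) z < \<rho>" by (auto simp: eventually_sequentially)
    define q where "q = \<xi> (r n)"
    have q: "q \<in> \<Gamma>1" "rf q \<in> M" "t0 < q \<bullet> a" using \<xi>(1) unfolding q_def X_def by auto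
    have qM: "q \<in> M" using q(1) bd_subset by blast
    have "dist (rf q) z < \<rho>" using n rf(5)[of q z] unfolding rz q_def by simp
    then show False using \<rho>(2)[OF bad_pair_rf[OF qM q(2,3)]] n unfolding q_def by (simp add: dist_commute)
  next
    case False
    then have za: "t0 < z \<bullet> a" using mt zm by simp
    obtain \<rho> where \<rho>: "\<rho> > 0" "\<And>q. q \<in> \<Gamma>1 \<Longrightarrow> q \<in> ball z \<rho> \<Longrightarrow> rf q \<in> M"
      by (rule contact_open_boundary[OF zr(1) rzM za]) (rule that)
    have zf: "z \<in> rel_frontier K1" "b < z \<bullet> a" using zr(1) \<Gamma>1 za t0 by auto
    have mp: "min \<rho> (z \<bullet> a - t0) > 0" using \<rho>(1) za by simp
    obtain q where q: "q \<in> rel_frontier K1" "q \<in> ball z (min \<rho> (z \<bullet> a - t0))" "q \<bullet> a < z \<bullet> a"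
      by (rule B1.frontier_lower_point[OF dim zf mp]) (rule that)
    have "\<bar>(z - q) \<bullet> a\<bar> \<le> norm (z - q) * norm a" by (rule Cauchy_Schwarz_ineq2)
    then have "t0 < q \<bullet> a" using q(2) a_unit by (simp add: inner_diff_left dist_norm abs_le_iff)
    then have "q \<in> X" unfolding X_def using q \<Gamma>1 \<rho>(2)[of q] by auto
    then show False using mle[of q] q(3) zm by simp
  qed
qed

lemma contact_interior:
  assumes x: "x \<in> M" "rf x \<in> M" "t0 < x \<bullet> a" shows "x \<notin> bd"
proof
  assume xb: "x \<in> bd"
  then show False
  proof
    assume "x \<in> \<Gamma>1"
    then show False using no_boundary_contact[of x] x by simp
  next
    assume "x \<in> \<Gamma>2"
    then have "rf x \<bullet> v = c2" using \<Gamma>2_height rf(2) by metis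
    then show False using no_interior_top[OF x(2) not_both_boundary[OF xb x(3)]] by simp
  qed
qed

text \<open>Beyond the mirror the contact set is open in M and contains no boundary points. A
  maximum of \<open>z \<bullet> w\<close> over it would thus be an interior local maximum on M,
  impossible when v . w > 0.\<close>

lemma no_contact:
  assumes "x \<in> M" "rf x \<in> M" shows "x \<bullet> a \<le> t0"
proof (rule ccontr)
  assume xa: "\<not> x \<bullet> a \<le> t0"
  define C where "C = M \<inter> {z. t0 \<le> z \<bullet> a} \<inter> rf -` M"
  have cM: "closed M" by (rule compact_imp_closed[OF compact_M])
  have "closed ({z. t0 \<le> z \<bullet> a} \<inter> rf -` M)"
    by (intro closed_Int closed_vimage[OF cM continuous_on_reflect] closed_Collect_le continuous_intros)
  then have cC: "compact C" unfolding C_def Int_assoc by (rule compact_Int_closed[OF compact_M])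
  have xC: "x \<in> C" unfolding C_def using assms xa by simp
  \<comment> \<open>Heights vary by at most \<open>c2 - c1\<close>, so the maximiser keeps at least
    half the distance of \<open>x\<close> from the mirror.\<close>
  define \<epsilon> where "\<epsilon> = (x \<bullet> a - t0) / (2 * (c2 - c1))"
  have half: "(r / (2 * d)) * d = r / 2" if "d \<noteq> 0" for r d :: real using that by simp
  have \<epsilon>: "\<epsilon> > 0" "\<epsilon> * (c2 - c1) = (x \<bullet> a - t0) / 2"
    unfolding \<epsilon>_def using xa c12 by (simp, intro half, simp)
  define w where "w = a + \<epsilon> *\<^sub>R v"
  have zw: "z \<bullet> w = z \<bullet> a + \<epsilon> * (z \<bullet> v)" for z unfolding w_def by (simp add: inner_add_right)
  have "\<exists>q\<in>C. \<forall>z\<in>C. z \<bullet> w \<le> q \<bullet> w"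
    by (rule continuous_attains_sup[OF cC]) (use xC in \<open>auto intro!: continuous_intros\<close>)
  then obtain q where q: "q \<in> C" "\<And>z. z \<in> C \<Longrightarrow> z \<bullet> w \<le> q \<bullet> w" by blast
  have qM: "q \<in> M" "rf q \<in> M" using q(1) C_def by auto
  have "\<epsilon> * (q \<bullet> v - x \<bullet> v) \<le> \<epsilon> * (c2 - c1)" using slab[OF qM(1)] slab[OF assms(1)] \<epsilon> by (intro mult_left_mono) auto
  then have qa: "t0 < q \<bullet> a" using q(2)[OF xC] xa \<epsilon>(2) unfolding zw by (simp add: algebra_simps)
  have qb: "q \<notin> bd" by (rule contact_interior[OF qM qa])
  obtain \<rho> where \<rho>: "\<rho> > 0" "\<And>z. z \<in> M \<Longrightarrow> z \<in> ball q \<rho> \<Longrightarrow> rf z \<in> M"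
    by (rule contact_open_interior[OF qM qa qb]) (rule that)
  define V where "V = ball q \<rho> \<inter> {z. t0 < z \<bullet> a}"
  have "v \<bullet> w \<le> 0"
  proof (rule extremum_interior(2)[OF qM(1) qb, of V])
    show "open V" unfolding V_def by (intro open_Int open_ball open_Collect_less continuous_intros)
    show "q \<in> V" unfolding V_def using \<rho>(1) qa by simp
    fix z assume "z \<in> M" "z \<in> V"
    then have "z \<in> C" unfolding V_def C_def using \<rho>(2) by auto
    then show "z \<bullet> w \<le> q \<bullet> w" by (rule q(2))
  qed
  then show False using \<epsilon>(1) unfolding w_def by (simp add: inner_add_right va vv)
qed

text \<open>Hopf's lemma for the graph of \<open>M\<close> over its tangent plane, compared with its own reflection.\<close>

lemma no_double_point:
  assumes y: "y \<in> M" "y \<notin> bd" "nu y \<bullet> a = 0" shows "y \<bullet> a \<noteq> t0"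
proof
  assume ya: "y \<bullet> a = t0"
  have ry: "rf y = y" unfolding rf(4) using ya by simp
  have n0: "nu y \<noteq> 0" by (rule nu_nonzero[OF y(1)])
  define e where "e = nu y /\<^sub>R norm (nu y)"
  have e: "norm e = 1" "nu y = norm (nu y) *\<^sub>R e" "nu y \<bullet> e \<noteq> 0" using n0 by (auto simp: e_def dot_square_norm)
  have ea: "e \<bullet> a = 0" unfolding e_def using y(3) by simp
  obtain R D u p H \<psi> g\<psi> H\<psi> where g: "graph_at y e R D u p H \<psi> g\<psi> H\<psi>"
    by (rule graph_at_exists[OF y(1) e(1,3)]) (rule that)
  note G = graph_at_D[OF g]
  have p: "p y = 0" by (rule horizontal_gradient[OF g e(2)])
  have lM: "lift e u z \<in> M" if "z \<in> D" for z using G(9)[OF that] G(15)[OF y(2) that] by simp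
  define U where "U = D \<inter> rf -` D"
  have oU: "open U" unfolding U_def
    using open_Int[OF C2_D(1)[OF G(3)] open_vimage[OF C2_D(1)[OF G(3)] continuous_on_reflect]] .
  have yU: "y \<in> U" unfolding U_def using G(5) ry by simp
  define us where "us = (\<lambda>z. u (rf z))"
  define ps where "ps = (\<lambda>z. reflect a 0 (p (rf z)))"
  define Hs where "Hs = (\<lambda>z h. reflect a 0 (H (rf z) (reflect a 0 h)))"
  have U1: "C2 U u p H" by (rule C2_subset[OF G(3) oU]) (auto simp: U_def)
  have U2: "C2 U us ps Hs" unfolding us_def ps_def Hs_def
    by (rule C2_subset[OF C2_reflect[OF G(3)] oU]) (auto simp: U_def)
  have Q1: "Qop v e (p z) (H z) = 0" if "z \<in> D" for z using G(11)[OF that lM[OF that]] .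
  have Q2: "Qop v e (ps z) (Hs z) = 0" if "z \<in> U" for z
  proof -
    have "rf z \<in> D" using that U_def by simp
    then show ?thesis unfolding ps_def Hs_def
      using Qop_reflect[OF a_unit C2_D(5)[OF G(3)] va ea] Q1 by simp
  qed
  \<comment> \<open>Equality at a point beyond the mirror would put both the lifted point and its
    mirror image into M, against \<open>no_contact\<close>.\<close>
  have ne: "u z \<noteq> us z" if z: "z \<in> U" "t0 < z \<bullet> a" for z
  proof
    assume eq: "u z = us z"
    have la: "lift e u z \<bullet> a = z \<bullet> a" unfolding lift_def using ea by (simp add: inner_add_left inner_diff_left)
    have "a \<bullet> e = 0" using ea by (simp add: inner_commute)
    then have "rf z \<bullet> e = z \<bullet> e" unfolding rf(4) inner_add_left inner_scaleR_left by simp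
    then have "rf (lift e u z) = lift e u (rf z)"
      unfolding rf(4)[of "lift e u z"] la using eq unfolding lift_def us_def by (simp add: rf(4) algebra_simps)
    then have "rf (lift e u z) \<in> M" using lM z U_def by simp
    then show False using no_contact[OF lM] z U_def la by fastforce
  qed
  obtain R1 where R1: "R1 > 0" "ball y R1 \<subseteq> U"
    "\<forall>c \<rho>. 0 < \<rho> \<and> cball c \<rho> \<subseteq> ball y R1 \<and> ordered_solutions v e c \<rho> u p H us ps Hs
      \<longrightarrow> contact_alternative c \<rho> u p us ps"
    by (rule translator_comparison[OF U1 U2 yU v_unit e(1)]) (rule that)
  obtain R2 where R2: "R2 > 0" "ball y R2 \<subseteq> U"
    "\<forall>c \<rho>. 0 < \<rho> \<and> cball c \<rho> \<subseteq> ball y R2 \<and> ordered_solutions v e c \<rho> us ps Hs u p H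
      \<longrightarrow> contact_alternative c \<rho> us ps u p"
    by (rule translator_comparison[OF U2 U1 yU v_unit e(1)]) (rule that)
  define \<rho> where "\<rho> = min R1 R2 / 4"
  have \<rho>: "\<rho> > 0" "4 * \<rho> \<le> R1" "4 * \<rho> \<le> R2" unfolding \<rho>_def using R1(1) R2(1) by auto
  \<comment> \<open>The ball of radius \<rho> about this centre lies beyond the mirror and touches
    it at \<open>y\<close>, where the graph and its reflection agree with zero gradient.\<close>
  define c where "c = y + \<rho> *\<^sub>R a"
  have cy: "dist c y = \<rho>" unfolding c_def using \<rho>(1) a_unit by (simp add: dist_norm)
  have near: "dist y z \<le> 2 * \<rho>" if "z \<in> cball c \<rho>" for z
    using that cy dist_triangle[of y z c] by (simp add: dist_commute)
  have sub: "cball c \<rho> \<subseteq> ball y R1" "cball c \<rho> \<subseteq> ball y R2" using near \<rho> by force+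
  have bU: "z \<in> U" if "z \<in> ball c \<rho>" for z using that sub(1) R1(2) ball_subset_cball by blast
  have beyond: "t0 < z \<bullet> a" if "z \<in> ball c \<rho>" for z
  proof -
    have "\<bar>(z - c) \<bullet> a\<bar> \<le> norm (z - c) * norm a" by (rule Cauchy_Schwarz_ineq2)
    also have "\<dots> < \<rho>" using that a_unit by (simp add: dist_norm norm_minus_commute)
    finally show ?thesis unfolding c_def using ya aa by (simp add: inner_diff_left inner_add_left abs_less_iff)
  qed
  have uy: "u y = us y" "ps y = 0" unfolding us_def ps_def ry p by (simp_all add: reflect_def)
  have cont: "continuous_on (ball c \<rho>) (\<lambda>z. u z - us z)"
    using bU by (intro continuous_intros continuous_on_subset[OF C2_D(6)[OF U1]] continuous_on_subset[OF C2_D(6)[OF U2]]) auto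
  have cn: "connected ((\<lambda>z. u z - us z) ` ball c \<rho>)" by (rule connected_continuous_image[OF cont connected_ball])
  have cc: "c \<in> ball c \<rho>" using \<rho>(1) by simp
  have n0': "u z - us z \<noteq> 0" if "z \<in> ball c \<rho>" for z using ne[OF bU[OF that] beyond[OF that]] by simp
  \<comment> \<open>Which graph lies above is unknown. Their difference has no zero on the connected
    ball, so its sign is constant, and Hopf's lemma applies in one order or the other.\<close>
  have "(\<forall>z\<in>ball c \<rho>. u z < us z) \<or> (\<forall>z\<in>ball c \<rho>. us z < u z)"
  proof (rule ccontr)
    assume "\<not> ?thesis"
    then obtain z1 z2 where z: "z1 \<in> ball c \<rho>" "z2 \<in> ball c \<rho>" "0 \<le> u z1 - us z1" "u z2 - us z2 \<le> 0" by force
    have "0 \<in> (\<lambda>z. u z - us z) ` ball c \<rho>"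
      by (rule connectedD_interval[OF cn, of "u z2 - us z2" "u z1 - us z1"]) (use z in auto)
    then show False using n0' by auto
  qed
  then show False
  proof
    assume lt: "\<forall>z\<in>ball c \<rho>. u z < us z"
    have "contact_alternative c \<rho> u p us ps"
      using \<rho>(1) sub(1) Q1 Q2 bU lt unfolding U_def
      by (intro R1(3)[rule_format]) (auto simp: ordered_solutions_def intro: less_imp_le)
    then show False using lt cc cy uy p unfolding contact_alternative_def by fastforce
  next
    assume lt: "\<forall>z\<in>ball c \<rho>. us z < u z"
    have "contact_alternative c \<rho> us ps u p"
      using \<rho>(1) sub(2) Q1 Q2 bU lt unfolding U_def
      by (intro R2(3)[rule_format]) (auto simp: ordered_solutions_def intro: less_imp_le)
    then show False using lt cc cy uy p unfolding contact_alternative_def by fastforce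
  qed
qed

end

section \<open>Symmetry\<close>

context symmetric_slab begin

text \<open>A maximising sequence of pairs converges by compactness. A limit of two distinct points
  is a contact beyond the mirror at \<open>t0\<close>. A collapsed limit lies on that mirror:
  transversal points and boundary points beyond \<open>b\<close> are excluded by
  \<open>no_bad_pair_nearby\<close>, tangent interior points by
  \<open>no_double_point\<close>.\<close>

lemma midpoints_le:
  assumes bp: "bad_pair s x y"
  shows "x \<bullet> a + y \<bullet> a \<le> 2 * b"
proof (rule ccontr)
  assume gt: "\<not> x \<bullet> a + y \<bullet> a \<le> 2 * b"
  define T where "T = {x \<bullet> a + y \<bullet> a | s x y. bad_pair s x y}"
  have T0: "x \<bullet> a + y \<bullet> a \<in> T" unfolding T_def using bp by blast
  obtain B where B: "\<And>z. z \<in> M \<Longrightarrow> norm z \<le> B"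
    using compact_imp_bounded[OF compact_M] unfolding bounded_iff by blast
  have "\<bar>z \<bullet> a\<bar> \<le> B" if "z \<in> M" for z
    using Cauchy_Schwarz_ineq2[of z a] B[OF that] a_unit by simp
  then have bdd: "bdd_above T"
    unfolding T_def bad_pair_def by (intro bdd_aboveI[of _ "B + B"]) (fastforce simp: abs_le_iff intro: add_mono)
  define t0 where "t0 = Sup T / 2"
  have upper: "r \<le> 2 * t0" if "r \<in> T" for r unfolding t0_def using cSup_upper[OF that bdd] by simp
  have bt: "b < t0" using upper[OF T0] gt by simp
  interpret mp: moving_plane v M \<Gamma>1 \<Gamma>2 a b c1 c2 K1 K2 t0
    by unfold_locales (use bt upper T_def in blast)+
  have "\<exists>r\<in>T. 2 * t0 - 1 / real (Suc n) < r" for n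
  proof -
    have "2 * t0 - 1 / real (Suc n) < Sup T" unfolding t0_def by simp
    then show ?thesis using less_cSup_iff[OF _ bdd] T0 by blast
  qed
  then have "\<forall>n. \<exists>p. bad_pair (fst (snd p)) (fst p) (snd (snd p)) \<and> 2 * t0 - 1 / real (Suc n) < fst p \<bullet> a + snd (snd p) \<bullet> a"
    unfolding T_def by (fastforce simp: split_paired_Ex)
  then obtain P where P: "\<And>n. bad_pair (fst (snd (P n))) (fst (P n)) (snd (snd (P n)))"
    "\<And>n. 2 * t0 - 1 / real (Suc n) < fst (P n) \<bullet> a + snd (snd (P n)) \<bullet> a" by metis
  define X where "X = (\<lambda>n. fst (P n))"
  define Y where "Y = (\<lambda>n. snd (snd (P n)))"
  define S where "S = (\<lambda>n. fst (snd (P n)))"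
  have bpn: "bad_pair (S n) (X n) (Y n)" for n using P(1) unfolding S_def X_def Y_def .
  have mid: "2 * t0 - 1 / real (Suc n) < X n \<bullet> a + Y n \<bullet> a" for n using P(2) unfolding X_def Y_def .
  have XY: "X n \<in> M" "Y n \<in> M" "X n = Y n + S n *\<^sub>R a" "0 \<le> S n" for n using bpn[of n] unfolding bad_pair_def by auto
  have "seq_compact (M \<times> M)"
    using compact_Times[OF compact_M compact_M] by (simp add: compact_eq_seq_compact_metric)
  moreover have "\<forall>n. (X n, Y n) \<in> M \<times> M" using XY by simp
  ultimately obtain l r where r: "l \<in> M \<times> M" "strict_mono r" "((\<lambda>n. (X n, Y n)) \<circ> r) \<longlonglongrightarrow> l"
    by (rule seq_compactE)
  obtain x0 y0 where l: "l = (x0, y0)" by (cases l)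
  have M0: "x0 \<in> M" "y0 \<in> M" using r(1) l by auto
  have limX: "(\<lambda>n. X (r n)) \<longlonglongrightarrow> x0" using tendsto_fst[OF r(3)] l by (simp add: o_def)
  have limY: "(\<lambda>n. Y (r n)) \<longlonglongrightarrow> y0" using tendsto_snd[OF r(3)] l by (simp add: o_def)
  have Sn: "S n = (X n - Y n) \<bullet> a" for n using XY(3)[of n] aa by simp
  define s0 where "s0 = (x0 - y0) \<bullet> a"
  have limS: "(\<lambda>n. S (r n)) \<longlonglongrightarrow> s0" unfolding Sn s0_def by (intro tendsto_intros limX limY)
  have s0: "0 \<le> s0" by (rule LIMSEQ_le_const[OF limS]) (use XY(4) in auto)
  have "(\<lambda>n. Y (r n) + S (r n) *\<^sub>R a) \<longlonglongrightarrow> y0 + s0 *\<^sub>R a" by (intro tendsto_intros limY limS)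
  then have "(\<lambda>n. X (r n)) \<longlonglongrightarrow> y0 + s0 *\<^sub>R a" using XY(3) by simp
  then have xy0: "x0 = y0 + s0 *\<^sub>R a" by (rule LIMSEQ_unique[OF limX])
  have lim_mid: "(\<lambda>n. X (r n) \<bullet> a + Y (r n) \<bullet> a) \<longlonglongrightarrow> x0 \<bullet> a + y0 \<bullet> a" by (intro tendsto_intros limX limY)
  have "(\<lambda>n. 2 * t0 - 1 / real (Suc n)) \<longlonglongrightarrow> 2 * t0 - 0"
    by (intro tendsto_intros LIMSEQ_inverse_real_of_nat[unfolded inverse_eq_divide])
  then have "(\<lambda>n. 2 * t0 - 1 / real (Suc (r n))) \<longlonglongrightarrow> 2 * t0" using LIMSEQ_subseq_LIMSEQ[OF _ r(2)] by (fastforce simp: o_def)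
  then have "2 * t0 \<le> x0 \<bullet> a + y0 \<bullet> a"
    by (rule LIMSEQ_le[OF _ lim_mid]) (use mid in \<open>auto intro!: exI[of _ 0] less_imp_le\<close>)
  moreover have "x0 \<bullet> a + y0 \<bullet> a \<le> 2 * t0"
    by (rule LIMSEQ_le_const2[OF lim_mid]) (use bpn upper T_def in blast)
  ultimately have sum0: "x0 \<bullet> a + y0 \<bullet> a = 2 * t0" by simp
  have xa: "x0 \<bullet> a = y0 \<bullet> a + s0" unfolding xy0 using aa by (simp add: inner_add_left)
  show False
  proof (cases "s0 = 0")
    case False
    have "2 * (t0 - x0 \<bullet> a) = - s0" using sum0 xa by simp
    then have "mp.rf x0 = y0" unfolding mp.rf(4) using xy0 by simp
    then show False using mp.no_contact[of x0] M0 sum0 xa s0 False by simp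
  next
    case True
    then have eq: "y0 = x0" and x0a: "x0 \<bullet> a = t0" using xy0 xa sum0 by auto
    have "\<not> (x0 \<in> bd \<and> b < x0 \<bullet> a \<or> nu x0 \<bullet> a \<noteq> 0)"
    proof
      assume c: "x0 \<in> bd \<and> b < x0 \<bullet> a \<or> nu x0 \<bullet> a \<noteq> 0"
      obtain \<rho> where \<rho>: "\<rho> > 0" "\<And>s x y. bad_pair s x y \<Longrightarrow> x \<in> ball x0 \<rho> \<Longrightarrow> y \<in> ball x0 \<rho> \<Longrightarrow> False"
        by (rule no_bad_pair_nearby[OF M0(1) c]) (rule that)
      have "\<forall>\<^sub>F n in sequentially. dist (X (r n)) x0 < \<rho> \<and> dist (Y (r n)) x0 < \<rho>"
        using tendstoD[OF limX \<rho>(1)] tendstoD[OF limY \<rho>(1)] unfolding eq by (rule eventually_conj)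
      then obtain n where "dist (X (r n)) x0 < \<rho>" "dist (Y (r n)) x0 < \<rho>" by (auto simp: eventually_sequentially)
      then show False using \<rho>(2)[OF bpn] by (simp add: dist_commute)
    qed
    then show False using mp.no_double_point[OF M0(1)] x0a bt by auto
  qed
qed

lemma symmetric_slab_opposite: "symmetric_slab v M \<Gamma>1 \<Gamma>2 (- a) (- b) c1 c2 K1 K2"
proof -
  have r: "reflect (- a) (- b) = reflect a b" by (rule ext) (simp add: reflect_def algebra_simps)
  show ?thesis
    by unfold_locales
       (use dim c12 a_unit av body1 \<Gamma>1 body2 \<Gamma>2 slab in \<open>auto simp: symmetric_body_def r\<close>)
qed

end

text \<open>A separate locale, because interpreting \<open>symmetric_slab\<close> in itself at \<open>(-a, -b)\<close> would not
  terminate.\<close>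

locale two_sided_slab = symmetric_slab

sublocale two_sided_slab \<subseteq> opp: symmetric_slab v M \<Gamma>1 \<Gamma>2 "- a" "- b" c1 c2 K1 K2
  by (rule symmetric_slab_opposite)

context two_sided_slab begin

lemma midpoint_eq:
  assumes "x \<in> M" "y \<in> M" "x = y + s *\<^sub>R a" "0 < s"
  shows "x \<bullet> a + y \<bullet> a = 2 * b"
proof -
  have "bad_pair s x y" unfolding bad_pair_def using assms by auto
  moreover have "opp.bad_pair s y x" unfolding opp.bad_pair_def using assms by auto
  ultimately show ?thesis using midpoints_le opp.midpoints_le by fastforce
qed

lemma double_point_on_mirror:
  assumes "x \<in> M" "x \<notin> bd" "nu x \<bullet> a = 0"
  shows "x \<bullet> a = b"
proof -
  have "bad_pair 0 x x" "opp.bad_pair 0 x x" unfolding bad_pair_def opp.bad_pair_def using assms by auto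
  then show ?thesis using midpoints_le opp.midpoints_le by fastforce
qed

abbreviation "rb \<equiv> reflect a b"

lemma rb: "rb x \<bullet> a = 2 * b - x \<bullet> a" "rb x \<bullet> v = x \<bullet> v" "rb x = x + (2 * (b - x \<bullet> a)) *\<^sub>R a"
  "dist (rb x) (rb y) = dist x y"
proof -
  show "rb x \<bullet> v = x \<bullet> v" unfolding reflect_alt by (simp add: inner_add_left av)
qed (rule reflect_inner[OF a_unit] reflect_alt reflect_dist[OF a_unit])+

lemma boundary_reflect: "x \<in> bd \<Longrightarrow> rb x \<in> M"
  using B1.reflect_frontier B2.reflect_frontier \<Gamma>1 \<Gamma>2 bd_subset by blast

text \<open>\<open>open_projection\<close>, applied at the mirror image, gives a point of M on the
  line through \<open>z\<close> close to \<open>rb z\<close>; \<open>midpoint_eq\<close> leaves no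
  other position for it than \<open>rb z\<close>.\<close>

lemma partner_open:
  assumes x: "x \<in> M" "rb x \<in> M" "b < x \<bullet> a"
  obtains \<rho> where "\<rho> > 0" "\<And>z. z \<in> M \<Longrightarrow> z \<in> ball x \<rho> \<Longrightarrow> rb z \<in> M"
proof -
  define y where "y = rb x"
  have ya: "y \<bullet> a = 2 * b - x \<bullet> a" unfolding y_def by (rule rb(1))
  \<comment> \<open>The image lies strictly on the other side of the mirror, so it is not a double
    point: it is transversal to \<open>a\<close> or a boundary point beyond the mirror as seen from
    the opposite side.\<close>
  have c: "y \<in> bd \<and> - b < y \<bullet> (- a) \<or> nu y \<bullet> (- a) \<noteq> 0"
    using double_point_on_mirror[of y] x ya y_def by auto
  have e: "x \<bullet> a - b > 0" using x by simp
  obtain \<delta> where \<delta>: "\<delta> > 0" "\<And>z. z \<in> ball y \<delta> \<Longrightarrow> c1 \<le> z \<bullet> v \<Longrightarrow> z \<bullet> v \<le> c2 \<Longrightarrow> \<exists>\<sigma>. \<bar>\<sigma>\<bar> < x \<bullet> a - b \<and> z + \<sigma> *\<^sub>R (- a) \<in> M"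
    by (rule opp.open_projection[OF x(2)[folded y_def] c e]) (rule that)
  show ?thesis
  proof (rule that[of "min \<delta> ((x \<bullet> a - b) / 2)"])
    show "min \<delta> ((x \<bullet> a - b) / 2) > 0" using \<delta>(1) e by simp
    fix z assume z: "z \<in> M" "z \<in> ball x (min \<delta> ((x \<bullet> a - b) / 2))"
    have "\<bar>(x - z) \<bullet> a\<bar> \<le> norm (x - z) * norm a" by (rule Cauchy_Schwarz_ineq2)
    moreover have "norm (x - z) < (x \<bullet> a - b) / 2" using z(2) by (simp add: dist_norm)
    ultimately have za: "x \<bullet> a - b < 2 * (z \<bullet> a - b)" using a_unit by (simp add: inner_diff_left abs_le_iff)
    have "rb z \<in> ball y \<delta>" using z(2) rb(4)[of x z] unfolding y_def by simp
    then obtain \<sigma> where \<sigma>: "\<bar>\<sigma>\<bar> < x \<bullet> a - b" "rb z + \<sigma> *\<^sub>R (- a) \<in> M"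
      using \<delta>(2)[of "rb z"] slab[OF z(1)] rb(2) by auto
    have "z = (rb z + \<sigma> *\<^sub>R (- a)) + (2 * (z \<bullet> a - b) + \<sigma>) *\<^sub>R a" unfolding rb(3) by (simp add: algebra_simps)
    moreover have "0 < 2 * (z \<bullet> a - b) + \<sigma>" using za \<sigma>(1) by linarith
    ultimately have "z \<bullet> a + (rb z + \<sigma> *\<^sub>R (- a)) \<bullet> a = 2 * b" by (rule midpoint_eq[OF z(1) \<sigma>(2)])
    then have "\<sigma> = 0" using rb(1)[of z] aa by (simp add: inner_diff_left)
    then show "rb z \<in> M" using \<sigma>(2) by simp
  qed
qed

text \<open>A maximiser of \<open>z \<bullet> w\<close> over the closure of the points without
  mirror image has itself no image, by \<open>partner_open\<close>, and is interior because the
  boundary is symmetric. Lacking an image is an open condition, M being closed, so the maximiser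
  would be an interior local maximum on M.\<close>

lemma half_symmetric:
  assumes x: "x \<in> M" "b < x \<bullet> a" shows "rb x \<in> M"
proof (rule ccontr)
  assume nx: "rb x \<notin> M"
  define N where "N = {z \<in> M. b < z \<bullet> a \<and> rb z \<notin> M}"
  have cM: "closed M" by (rule compact_imp_closed[OF compact_M])
  have NM: "closure N \<subseteq> M" by (rule closure_minimal[OF _ cM]) (auto simp: N_def)
  then have cN: "compact (closure N)" using compact_Int_closed[OF compact_M closed_closure, of N] by (simp add: Int_absorb1)
  have "x \<in> N" unfolding N_def using x nx by simp
  then have xN: "x \<in> closure N" by (rule subsetD[OF closure_subset])
  \<comment> \<open>Small enough, as in \<open>no_contact\<close>, for the maximiser to stay
    strictly beyond the mirror.\<close>
  define \<epsilon> where "\<epsilon> = (x \<bullet> a - b) / (2 * (c2 - c1))"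
  have half: "(r / (2 * d)) * d = r / 2" if "d \<noteq> 0" for r d :: real using that by simp
  have \<epsilon>: "\<epsilon> > 0" "\<epsilon> * (c2 - c1) = (x \<bullet> a - b) / 2"
    unfolding \<epsilon>_def using x c12 by (simp, intro half, simp)
  define w where "w = a + \<epsilon> *\<^sub>R v"
  have zw: "z \<bullet> w = z \<bullet> a + \<epsilon> * (z \<bullet> v)" for z unfolding w_def by (simp add: inner_add_right)
  have "\<exists>q\<in>closure N. \<forall>z\<in>closure N. z \<bullet> w \<le> q \<bullet> w"
    by (rule continuous_attains_sup[OF cN]) (use xN in \<open>auto intro!: continuous_intros\<close>)
  then obtain q where q: "q \<in> closure N" "\<And>z. z \<in> closure N \<Longrightarrow> z \<bullet> w \<le> q \<bullet> w" by blast
  have qM: "q \<in> M" using q(1) NM by blast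
  have "\<epsilon> * (q \<bullet> v - x \<bullet> v) \<le> \<epsilon> * (c2 - c1)" using slab[OF qM] slab[OF x(1)] \<epsilon> by (intro mult_left_mono) auto
  then have qa: "b < q \<bullet> a" using q(2)[OF xN] x(2) \<epsilon>(2) unfolding zw by (simp add: algebra_simps)
  have rq: "rb q \<notin> M"
  proof
    assume "rb q \<in> M"
    then obtain \<rho> where \<rho>: "\<rho> > 0" "\<And>z. z \<in> M \<Longrightarrow> z \<in> ball q \<rho> \<Longrightarrow> rb z \<in> M"
      by (rule partner_open[OF qM _ qa]) (rule that)
    obtain z where "z \<in> N" "dist z q < \<rho>" using q(1) \<rho>(1) unfolding closure_approachable by blast
    then show False using \<rho>(2)[of z] unfolding N_def by (simp add: dist_commute)
  qed
  then have qb: "q \<notin> bd" using boundary_reflect by blast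
  define V where "V = rb -` (- M) \<inter> {z. b < z \<bullet> a}"
  have "v \<bullet> w \<le> 0"
  proof (rule extremum_interior(2)[OF qM qb, of V])
    show "open V" unfolding V_def
      by (intro open_Int open_vimage continuous_on_reflect open_Compl cM open_Collect_less continuous_intros)
    show "q \<in> V" unfolding V_def using rq qa by simp
    fix z assume "z \<in> M" "z \<in> V"
    then have "z \<in> N" unfolding V_def N_def by simp
    then show "z \<bullet> w \<le> q \<bullet> w" using q(2) closure_subset by blast
  qed
  then show False using \<epsilon>(1) unfolding w_def by (simp add: inner_add_right va vv)
qed

end

lemma (in symmetric_slab) reflect_subset: "reflect a b ` M \<subseteq> M"
proof -
  have r: "reflect (- a) (- b) = reflect a b" by (rule ext) (simp add: reflect_def algebra_simps)
  interpret one: two_sided_slab v M \<Gamma>1 \<Gamma>2 a b c1 c2 K1 K2 by unfold_locales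
  interpret other: two_sided_slab v M \<Gamma>1 \<Gamma>2 "- a" "- b" c1 c2 K1 K2
    by (rule two_sided_slab.intro[OF symmetric_slab_opposite])
  have "reflect a b x \<in> M" if x: "x \<in> M" for x
  proof (cases "x \<bullet> a" b rule: linorder_cases)
    case less
    then show ?thesis using other.half_symmetric[OF x] unfolding r by simp
  next
    case equal
    then show ?thesis using x by (simp add: reflect_def)
  next
    case greater
    then show ?thesis by (rule one.half_symmetric[OF x])
  qed
  then show ?thesis by blast
qed

section \<open>Passage from the hypotheses of the theorem to the locales\<close>

lemma strictly_convex_symmetric_body:
  fixes v a :: "'a::euclidean_space"
  assumes G: "strictly_convex_closed_hypersurface_in \<Gamma> (hyperplane v c)" and v: "norm v = 1"
    and sym: "reflect a b ` \<Gamma> = \<Gamma>"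
  obtains K where "symmetric_body v a b c K" "\<Gamma> = rel_frontier K"
proof -
  from G obtain K where K: "compact K" "convex K" "K \<subseteq> hyperplane v c" "aff_dim K = int DIM('a) - 1"
    "\<forall>x\<in>K. \<forall>y\<in>K. x \<noteq> y \<longrightarrow> open_segment x y \<subseteq> rel_interior K" "\<Gamma> = rel_frontier K"
    unfolding strictly_convex_closed_hypersurface_in_def by blast
  have h: "hyperplane v c = {x. v \<bullet> x = c}" unfolding hyperplane_def by (simp add: inner_commute)
  have "v \<noteq> 0" using v by auto
  then have d: "aff_dim (hyperplane v c) = int DIM('a) - 1" unfolding h using aff_dim_hyperplane[of v c] DIM_positive[where 'a='a] by (simp add: of_nat_diff)
  have "affine hull K = affine hull (hyperplane v c)"
    using aff_dim_eq_full_gen[OF K(3)] by (simp add: d K(4))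
  also have "\<dots> = hyperplane v c" unfolding h by (simp add: affine_hyperplane hull_same)
  finally have "symmetric_body v a b c K" unfolding symmetric_body_def using K sym by auto
  then show ?thesis by (rule that[OF _ K(6)])
qed

lemma reflect_image_translator_subset:
  fixes v a :: "'a::euclidean_space"
  assumes dim: "DIM('a) \<ge> 3" and v: "norm v = 1"
    and transl: "compact_translator_with_boundary v M (\<Gamma>1 \<union> \<Gamma>2)" and c12: "c1 < c2"
    and G1: "strictly_convex_closed_hypersurface_in \<Gamma>1 (hyperplane v c1)"
    and G2: "strictly_convex_closed_hypersurface_in \<Gamma>2 (hyperplane v c2)"
    and slab: "\<And>x. x \<in> M \<Longrightarrow> c1 \<le> x \<bullet> v \<and> x \<bullet> v \<le> c2"
    and a: "norm a = 1" "a \<bullet> v = 0" and sym: "reflect a b ` \<Gamma>1 = \<Gamma>1" "reflect a b ` \<Gamma>2 = \<Gamma>2"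
  shows "reflect a b ` M \<subseteq> M"
proof -
  obtain K1 where K1: "symmetric_body v a b c1 K1" "\<Gamma>1 = rel_frontier K1"
    by (rule strictly_convex_symmetric_body[OF G1 v sym(1)]) (rule that)
  obtain K2 where K2: "symmetric_body v a b c2 K2" "\<Gamma>2 = rel_frontier K2"
    by (rule strictly_convex_symmetric_body[OF G2 v sym(2)]) (rule that)
  have "compact K1" "compact K2" using K1(1) K2(1) unfolding symmetric_body_def by auto
  then have cl: "closed (\<Gamma>1 \<union> \<Gamma>2)" unfolding K1(2) K2(2)
    by (intro closed_Un compact_imp_closed compact_rel_frontier compact_imp_bounded)
  interpret symmetric_slab v M \<Gamma>1 \<Gamma>2 a b c1 c2 K1 K2
    by unfold_locales (fact v transl cl dim c12 a K1 K2 slab)+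
  show ?thesis by (rule reflect_subset)
qed

theorem mainTheorem8:
  fixes v :: "'a::euclidean_space"
    and M \<Gamma>1 \<Gamma>2 :: "'a set"
    and c1 c2 b :: real
    and a :: 'a
  assumes dim: "DIM('a) \<ge> 3"
    and v_unit: "norm v = 1"
    and transl: "compact_translator_with_boundary v M (\<Gamma>1 \<union> \<Gamma>2)"
    and conn: "connected M"
    and planes: "c1 \<noteq> c2"
    and G1: "strictly_convex_closed_hypersurface_in \<Gamma>1 (hyperplane v c1)"
    and G2: "strictly_convex_closed_hypersurface_in \<Gamma>2 (hyperplane v c2)"
    and slab: "\<forall>x\<in>M. min c1 c2 \<le> x \<bullet> v \<and> x \<bullet> v \<le> max c1 c2"
    and a_unit: "norm a = 1"
    and Pi_v: "a \<bullet> v = 0"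
    and sym1: "reflect a b ` \<Gamma>1 = \<Gamma>1"
    and sym2: "reflect a b ` \<Gamma>2 = \<Gamma>2"
  shows "reflect a b ` M = M"
proof -
  have sub: "reflect a b ` M \<subseteq> M"
  proof (cases "c1 < c2")
    case True
    show ?thesis
      by (rule reflect_image_translator_subset[OF dim v_unit transl True G1 G2 _ a_unit Pi_v sym1 sym2])
         (use slab True in auto)
  next
    case False
    then have lt: "c2 < c1" using planes by simp
    show ?thesis
      by (rule reflect_image_translator_subset[OF dim v_unit transl[unfolded Un_commute[of \<Gamma>1]] lt G2 G1 _ a_unit Pi_v sym2 sym1])
         (use slab lt in auto)
  qed
  show ?thesis
  proof
    show "M \<subseteq> reflect a b ` M"
      using sub reflect_reflect[OF a_unit] by (metis image_eqI image_subset_iff subsetI)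
  qed (rule sub)
qed

end
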